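(* Let $R$ be a real closed field, let $G$ be a linear algebraic group over $R$ with $G(R)$ semialgebraically compact, let $V$ be an affine $G$-variety, and let $W=V/\!/G$, so $R[W]=R[V]^G$. Let $\rho=\rho_V\colon R[V]\to R[W]$ be the Reynolds operator. Write $\Sigma R[V]^2$ for the set of all finite sums of squares in $R[V]$. (a) $\rho\bigl(\Sigma R[V]^2\bigr)=R[W]\cap\Sigma R[V]^2=\bigl(\Sigma R[V]^2\bigr)^G$. This is a preordering in $R[W]$; denote it by $S_0$. (b) If $M$ is any quadratic module in $R[V]$, then $\rho(M)$ is an $S_0$-module in $R[W]$. (c) If $M$ is a $G$-invariant quadratic module in $R[V]$, then $\rho(M)=M\cap R[W]$.
   Context: An affine $R$-variety is a reduced affine scheme of finite type over $R$ with coordinate ring $R[V]$. Standing assumption: $G(R)$ is Zariski dense in $G$. $G(R)$ is semialgebraically compact if it is closed and bounded in some $R^N$ (then $G$ is reductive). An affine $G$-variety is an affine $R$-variety $V$ with an action $G\times V\to V$ by a morphism of $R$-varieties; $G(R)$ acts on $R[V]$ by $f^g(x)=f(gx)$; $R[V]^G$ is the ring of invariants, a finitely generated $R$-algebra, and $V/\!/G$ is the affine $R$-variety with coordinate ring $R[V]^G$. Subsets of $R[V]$ are called $G$-invariant if they are stable under $G(R)$; for a subset $S$ of $R[V]$, $S^G=S\cap R[V]^G$. Reynolds operator: the $G$-module $R[V]$ has a unique $G$-stable complement $N$ to $R[V]^G$, and $\rho_V$ is the projection $R[V]\to R[V]^G$ along $R[V]=R[V]^G\oplus N$. A quadratic module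 in a ring $A$ is a subset $M\subset A$ with $1\in M$, $M+M\subset M$, and $a^2M\subset M$ for all $a\in A$; a preordering is a quadratic module closed under multiplication. For a preordering $S_0$ of $A$, an $S_0$-module in $A$ is a quadratic module $N$ in $A$ with $S_0N\subset N$. *)

theory Defs
  imports Complex_Main "HOL-Library.Multiset"
begin

class real_closed_field = linordered_field +
  assumes nonneg_imp_square: "0 \<le> x \<Longrightarrow> \<exists>y. x = y * y"
    and odd_degree_imp_root: "odd n \<Longrightarrow> f n \<noteq> 0 \<Longrightarrow> \<exists>x. (\<Sum>k\<le>n. f k * x ^ k) = 0"


section \<open>Affine varieties\<close>

text \<open>
  An affine variety is given by its coordinate ring. The class \<open>comm_ring\<close> with the unit as a
  parameter is used instead of \<open>comm_ring_1\<close>, since the latter requires \<open>0 \<noteq> 1\<close> and would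
  exclude the empty variety.
\<close>

definition subalgebra :: "('r::field \<Rightarrow> 'a::comm_ring \<Rightarrow> 'a) \<Rightarrow> 'a \<Rightarrow> 'a set \<Rightarrow> bool" where
  "subalgebra scale e B \<longleftrightarrow>
     module.subspace scale B \<and> e \<in> B \<and> (\<forall>x\<in>B. \<forall>y\<in>B. x * y \<in> B)"

definition generates :: "('r::field \<Rightarrow> 'a::comm_ring \<Rightarrow> 'a) \<Rightarrow> 'a \<Rightarrow> 'a set \<Rightarrow> bool" where
  "generates scale e X \<longleftrightarrow> subalgebra scale e hull X = UNIV"

locale affine_variety = vector_space scale
  for scale :: "'r::field \<Rightarrow> 'a::comm_ring \<Rightarrow> 'a" +
  fixes e :: 'a
  assumes unit_mult: "e * x = x"
    and scale_mult: "scale c (x * y) = scale c x * y"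
    and reduced: "((*) x ^^ n) e = 0 \<Longrightarrow> x = 0"
    and finite_type: "\<exists>X. finite X \<and> generates scale e X"

definition algebra_hom ::
  "('r::field \<Rightarrow> 'a::comm_ring \<Rightarrow> 'a) \<Rightarrow> 'a \<Rightarrow> ('r \<Rightarrow> 'b::comm_ring \<Rightarrow> 'b) \<Rightarrow> 'b \<Rightarrow> ('a \<Rightarrow> 'b) \<Rightarrow> bool" where
  "algebra_hom sA eA sB eB \<phi> \<longleftrightarrow>
     Vector_Spaces.linear sA sB \<phi> \<and> (\<forall>x y. \<phi> (x * y) = \<phi> x * \<phi> y) \<and> \<phi> eA = eB"

text \<open>The \<open>R\<close>-points of a variety are the \<open>R\<close>-algebra homomorphisms from its coordinate ring to \<open>R\<close>.\<close>

definition rational_points :: "('r::field \<Rightarrow> 'a::comm_ring \<Rightarrow> 'a) \<Rightarrow> 'a \<Rightarrow> ('a \<Rightarrow> 'r) set" where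
  "rational_points scale e = {g. algebra_hom scale e (*) 1 g}"

definition rational_points_dense :: "('r::field \<Rightarrow> 'a::comm_ring \<Rightarrow> 'a) \<Rightarrow> 'a \<Rightarrow> bool" where
  "rational_points_dense scale e \<longleftrightarrow>
     (\<forall>h. (\<forall>g\<in>rational_points scale e. g h = 0) \<longrightarrow> h = 0)"


section \<open>Tensor products\<close>

text \<open>
  An element of \<open>A \<otimes> B\<close> is represented by a multiset of pairs, \<open>{#(a\<^sub>1, b\<^sub>1), \<dots>, (a\<^sub>n, b\<^sub>n)#}\<close>
  standing for \<open>\<Sum>\<^sub>i a\<^sub>i \<otimes> b\<^sub>i\<close>; two multisets represent the same element iff they are
  identified by the congruence on the free commutative monoid that is generated by the
  bilinearity relations. Likewise for threefold tensor products.
\<close>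

inductive tensor_eq ::
  "('r::field \<Rightarrow> 'a::comm_ring \<Rightarrow> 'a) \<Rightarrow> ('r \<Rightarrow> 'b::comm_ring \<Rightarrow> 'b) \<Rightarrow>
   ('a \<times> 'b) multiset \<Rightarrow> ('a \<times> 'b) multiset \<Rightarrow> bool"
  for sA sB where
  refl: "tensor_eq sA sB X X"
| sym: "tensor_eq sA sB X Y \<Longrightarrow> tensor_eq sA sB Y X"
| trans: "tensor_eq sA sB X Y \<Longrightarrow> tensor_eq sA sB Y Z \<Longrightarrow> tensor_eq sA sB X Z"
| cong: "tensor_eq sA sB X Y \<Longrightarrow> tensor_eq sA sB (X + Z) (Y + Z)"
| zero: "tensor_eq sA sB {#(0, b)#} {#}"
| add1: "tensor_eq sA sB {#(a + a', b)#} {#(a, b), (a', b)#}"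
| add2: "tensor_eq sA sB {#(a, b + b')#} {#(a, b), (a, b')#}"
| scale: "tensor_eq sA sB {#(sA c a, b)#} {#(a, sB c b)#}"

inductive tensor3_eq ::
  "('r::field \<Rightarrow> 'a::comm_ring \<Rightarrow> 'a) \<Rightarrow> ('r \<Rightarrow> 'b::comm_ring \<Rightarrow> 'b) \<Rightarrow> ('r \<Rightarrow> 'c::comm_ring \<Rightarrow> 'c) \<Rightarrow>
   ('a \<times> 'b \<times> 'c) multiset \<Rightarrow> ('a \<times> 'b \<times> 'c) multiset \<Rightarrow> bool"
  for sA sB sC where
  refl: "tensor3_eq sA sB sC X X"
| sym: "tensor3_eq sA sB sC X Y \<Longrightarrow> tensor3_eq sA sB sC Y X"
| trans: "tensor3_eq sA sB sC X Y \<Longrightarrow> tensor3_eq sA sB sC Y Z \<Longrightarrow> tensor3_eq sA sB sC X Z"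
| cong: "tensor3_eq sA sB sC X Y \<Longrightarrow> tensor3_eq sA sB sC (X + Z) (Y + Z)"
| zero: "tensor3_eq sA sB sC {#(0, b, c)#} {#}"
| add1: "tensor3_eq sA sB sC {#(a + a', b, c)#} {#(a, b, c), (a', b, c)#}"
| add2: "tensor3_eq sA sB sC {#(a, b + b', c)#} {#(a, b, c), (a, b', c)#}"
| add3: "tensor3_eq sA sB sC {#(a, b, c + c')#} {#(a, b, c), (a, b, c')#}"
| scale12: "tensor3_eq sA sB sC {#(sA r a, b, c)#} {#(a, sB r b, c)#}"
| scale23: "tensor3_eq sA sB sC {#(a, sB r b, c)#} {#(a, b, sC r c)#}"

definition tensor_mult ::
  "('a::comm_ring \<times> 'b::comm_ring) multiset \<Rightarrow> ('a \<times> 'b) multiset \<Rightarrow> ('a \<times> 'b) multiset" where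
  "tensor_mult X Y = (\<Sum>(a, b)\<in>#X. image_mset (\<lambda>(a', b'). (a * a', b * b')) Y)"

text \<open>\<open>\<phi>\<close> represents an algebra homomorphism \<open>C \<rightarrow> A \<otimes> B\<close>, that is, a morphism from the product of the
  varieties with coordinate rings \<open>A\<close> and \<open>B\<close> to the one with coordinate ring \<open>C\<close>.\<close>

definition tensor_algebra_hom ::
  "('r::field \<Rightarrow> 'c::comm_ring \<Rightarrow> 'c) \<Rightarrow> 'c \<Rightarrow> ('r \<Rightarrow> 'a::comm_ring \<Rightarrow> 'a) \<Rightarrow> 'a \<Rightarrow>
   ('r \<Rightarrow> 'b::comm_ring \<Rightarrow> 'b) \<Rightarrow> 'b \<Rightarrow> ('c \<Rightarrow> ('a \<times> 'b) multiset) \<Rightarrow> bool" where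
  "tensor_algebra_hom sC eC sA eA sB eB \<phi> \<longleftrightarrow>
     (\<forall>x y. tensor_eq sA sB (\<phi> (x + y)) (\<phi> x + \<phi> y)) \<and>
     (\<forall>c x. tensor_eq sA sB (\<phi> (sC c x)) (image_mset (\<lambda>(a, b). (sA c a, b)) (\<phi> x))) \<and>
     (\<forall>x y. tensor_eq sA sB (\<phi> (x * y)) (tensor_mult (\<phi> x) (\<phi> y))) \<and>
     tensor_eq sA sB (\<phi> eC) {#(eA, eB)#}"


section \<open>Linear algebraic groups and their actions\<close>

text \<open>
  \<open>\<Delta>\<close>, \<open>\<epsilon>\<close> and \<open>S\<close> are the comorphisms of multiplication, neutral element and inversion; the
  assumptions are the group axioms.
\<close>

locale linear_algebraic_group = affine_variety sG eG
  for sG :: "'r::field \<Rightarrow> 'h::comm_ring \<Rightarrow> 'h" and eG :: 'h +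
  fixes \<Delta> :: "'h \<Rightarrow> ('h \<times> 'h) multiset"
    and \<epsilon> :: "'h \<Rightarrow> 'r"
    and S :: "'h \<Rightarrow> 'h"
  assumes comult_hom: "tensor_algebra_hom sG eG sG eG sG eG \<Delta>"
    and counit_hom: "algebra_hom sG eG (*) 1 \<epsilon>"
    and antipode_hom: "algebra_hom sG eG sG eG S"
    and coassoc: "tensor3_eq sG sG sG
          (\<Sum>(h, k)\<in>#\<Delta> x. image_mset (\<lambda>(h', h''). (h', h'', k)) (\<Delta> h))
          (\<Sum>(h, k)\<in>#\<Delta> x. image_mset (\<lambda>(k', k''). (h, k', k'')) (\<Delta> k))"
    and counit_left: "(\<Sum>(h, k)\<in>#\<Delta> x. sG (\<epsilon> h) k) = x"
    and counit_right: "(\<Sum>(h, k)\<in>#\<Delta> x. sG (\<epsilon> k) h) = x"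
    and antipode_left: "(\<Sum>(h, k)\<in>#\<Delta> x. S h * k) = sG (\<epsilon> x) eG"
    and antipode_right: "(\<Sum>(h, k)\<in>#\<Delta> x. h * S k) = sG (\<epsilon> x) eG"

text \<open>\<open>\<alpha>\<close> is the comorphism \<open>R[V] \<rightarrow> R[G] \<otimes> R[V]\<close> of the action \<open>G \<times> V \<rightarrow> V\<close>.\<close>

locale affine_G_variety =
  G: linear_algebraic_group sG eG \<Delta> \<epsilon> S + V: affine_variety sV eV
  for sG :: "'r::field \<Rightarrow> 'h::comm_ring \<Rightarrow> 'h" and eG \<Delta> \<epsilon> S
    and sV :: "'r \<Rightarrow> 'a::comm_ring \<Rightarrow> 'a" and eV +
  fixes \<alpha> :: "'a \<Rightarrow> ('h \<times> 'a) multiset"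
  assumes coact_hom: "tensor_algebra_hom sV eV sG eG sV eV \<alpha>"
    and coact_assoc: "tensor3_eq sG sG sV
          (\<Sum>(h, f)\<in>#\<alpha> x. image_mset (\<lambda>(h', h''). (h', h'', f)) (\<Delta> h))
          (\<Sum>(h, f)\<in>#\<alpha> x. image_mset (\<lambda>(h', f'). (h, h', f')) (\<alpha> f))"
    and coact_counit: "(\<Sum>(h, f)\<in>#\<alpha> x. sV (\<epsilon> h) f) = x"


section \<open>Semialgebraic compactness\<close>

text \<open>Points of \<open>R\<^sup>N\<close> are lists of length \<open>N\<close>; the topology is the product of the order topology.\<close>

definition closed_in_power :: "nat \<Rightarrow> 'r::linordered_field list set \<Rightarrow> bool" where
  "closed_in_power N K \<longleftrightarrow>
     (\<forall>p. length p = N \<and> (\<forall>\<delta>>0. \<exists>q\<in>K. \<forall>i<N. \<bar>p ! i - q ! i\<bar> < \<delta>) \<longrightarrow> p \<in> K)"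

definition bounded_in_power :: "nat \<Rightarrow> 'r::linordered_field list set \<Rightarrow> bool" where
  "bounded_in_power N K \<longleftrightarrow> (\<exists>b. \<forall>p\<in>K. \<forall>i<N. \<bar>p ! i\<bar> \<le> b)"

text \<open>A list of \<open>N\<close> generators of the coordinate ring is a closed embedding into affine \<open>N\<close>-space.\<close>

definition semialgebraically_compact ::
  "('r::linordered_field \<Rightarrow> 'a::comm_ring \<Rightarrow> 'a) \<Rightarrow> 'a \<Rightarrow> bool" where
  "semialgebraically_compact scale e \<longleftrightarrow>
     (\<exists>xs. generates scale e (set xs) \<and>
       closed_in_power (length xs) ((\<lambda>g. map g xs) ` rational_points scale e) \<and>
       bounded_in_power (length xs) ((\<lambda>g. map g xs) ` rational_points scale e))"


section \<open>Invariants and the Reynolds operator\<close>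

text \<open>The function \<open>f\<^sup>g(x) = f(gx)\<close>, i.e. \<open>(g \<otimes> id)(\<alpha>(f))\<close>.\<close>

definition act ::
  "('r::field \<Rightarrow> 'a::comm_ring \<Rightarrow> 'a) \<Rightarrow> ('a \<Rightarrow> ('h \<times> 'a) multiset) \<Rightarrow> ('h \<Rightarrow> 'r) \<Rightarrow> 'a \<Rightarrow> 'a" where
  "act sV \<alpha> g f = (\<Sum>(h, f')\<in>#\<alpha> f. sV (g h) f')"

definition G_invariant ::
  "('r::field \<Rightarrow> 'h::comm_ring \<Rightarrow> 'h) \<Rightarrow> 'h \<Rightarrow> ('r \<Rightarrow> 'a::comm_ring \<Rightarrow> 'a) \<Rightarrow>
   ('a \<Rightarrow> ('h \<times> 'a) multiset) \<Rightarrow> 'a set \<Rightarrow> bool" where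
  "G_invariant sG eG sV \<alpha> T \<longleftrightarrow> (\<forall>g\<in>rational_points sG eG. \<forall>f\<in>T. act sV \<alpha> g f \<in> T)"

definition invariants ::
  "('r::field \<Rightarrow> 'h::comm_ring \<Rightarrow> 'h) \<Rightarrow> 'h \<Rightarrow> ('r \<Rightarrow> 'a::comm_ring \<Rightarrow> 'a) \<Rightarrow>
   ('a \<Rightarrow> ('h \<times> 'a) multiset) \<Rightarrow> 'a set" where
  "invariants sG eG sV \<alpha> = {f. \<forall>g\<in>rational_points sG eG. act sV \<alpha> g f = f}"

definition invariant_part ::
  "('r::field \<Rightarrow> 'h::comm_ring \<Rightarrow> 'h) \<Rightarrow> 'h \<Rightarrow> ('r \<Rightarrow> 'a::comm_ring \<Rightarrow> 'a) \<Rightarrow>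
   ('a \<Rightarrow> ('h \<times> 'a) multiset) \<Rightarrow> 'a set \<Rightarrow> 'a set" where
  "invariant_part sG eG sV \<alpha> T = T \<inter> invariants sG eG sV \<alpha>"

text \<open>For reductive \<open>G\<close> the stable complement exists and is unique, so this determines \<open>\<rho>\<close>.\<close>

definition reynolds_operator ::
  "('r::field \<Rightarrow> 'h::comm_ring \<Rightarrow> 'h) \<Rightarrow> 'h \<Rightarrow> ('r \<Rightarrow> 'a::comm_ring \<Rightarrow> 'a) \<Rightarrow>
   ('a \<Rightarrow> ('h \<times> 'a) multiset) \<Rightarrow> ('a \<Rightarrow> 'a) \<Rightarrow> bool" where
  "reynolds_operator sG eG sV \<alpha> \<rho> \<longleftrightarrow>
     (\<exists>N. module.subspace sV N \<and> G_invariant sG eG sV \<alpha> N \<and>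
       invariants sG eG sV \<alpha> \<inter> N = {0} \<and>
       (\<forall>f. \<exists>u\<in>invariants sG eG sV \<alpha>. \<exists>n\<in>N. f = u + n) \<and>
       (\<forall>u\<in>invariants sG eG sV \<alpha>. \<forall>n\<in>N. \<rho> (u + n) = u))"


section \<open>Quadratic modules\<close>

text \<open>These notions are relative to a subring \<open>A\<close> with unit \<open>e\<close>.\<close>

definition sums_of_squares :: "'a::comm_ring set" where
  "sums_of_squares = {s. \<exists>xs. s = (\<Sum>x\<leftarrow>xs. x * x)}"

definition quadratic_module :: "'a::comm_ring set \<Rightarrow> 'a \<Rightarrow> 'a set \<Rightarrow> bool" where
  "quadratic_module A e M \<longleftrightarrow>
     M \<subseteq> A \<and> e \<in> M \<and> (\<forall>x\<in>M. \<forall>y\<in>M. x + y \<in> M) \<and> (\<forall>a\<in>A. \<forall>x\<in>M. a * a * x \<in> M)"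

definition ring_preordering :: "'a::comm_ring set \<Rightarrow> 'a \<Rightarrow> 'a set \<Rightarrow> bool" where
  "ring_preordering A e T \<longleftrightarrow> quadratic_module A e T \<and> (\<forall>x\<in>T. \<forall>y\<in>T. x * y \<in> T)"

definition preordering_module :: "'a::comm_ring set \<Rightarrow> 'a \<Rightarrow> 'a set \<Rightarrow> 'a set \<Rightarrow> bool" where
  "preordering_module A e T M \<longleftrightarrow> quadratic_module A e M \<and> (\<forall>s\<in>T. \<forall>x\<in>M. s * x \<in> M)"

end

(*
  For a compact group the Reynolds operator is an average, so it should preserve convex cones.
  Over a real closed field there is no Haar integral; instead one shows that every n in a G-stable
  complement N of the invariants has 0 in the convex hull of its orbit. Following Kakutani, the
  function a |-> max_g |g a|^2 on that hull is G-invariant and strictly convex, so it has a unique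
  minimum, which is a fixed point and hence 0. The extreme values exist because everything in sight
  is semialgebraic, closed and bounded; this rests on Tarski-Seidenberg, which is proved by the
  Cohen-Hoermander induction on degrees, and on the intermediate value theorem for polynomials,
  which is obtained from Laplace's proof that R(i) is algebraically closed. Finitely many equations
  define G(R) by Hilbert's basis theorem. Composing averages annihilates two elements of N at once,
  and this yields that the Reynolds operator is linear over the invariants.
*)

theory Submission
  imports
    "HOL-Algebra.Algebraic_Closure_Type"
    "HOL-Computational_Algebra.Computational_Algebra"
    "HOL-Library.Function_Algebras"
    Defs
begin

section \<open>Real closed fields\<close>

text \<open>Averages are useful because nonnegative scalars are squares in \<open>R\<close>: a
  quadratic module is a convex cone, and a G-invariant one is preserved by every convex combination
  of translations. The average that is used depends on the elements at hand; none is claimed to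
  equal \<open>\<rho>\<close> everywhere. The obstacle is that bounded subsets of \<open>R\<close>
  are only guaranteed to have suprema when they are semialgebraic. So every set that is minimized
  over has to be described by the signs of finitely many polynomials in finitely many variables:
  Caratheodory's theorem bounds the number of points in a convex combination, and local finiteness
  of the coaction confines an orbit to a finite-dimensional space. Linearity over the invariants is
  what part (b) rests on, since there M need not be G-invariant: for s in S_0 and y in M one has s
  \<rho>(y) = \<rho>(s y), and s y lies in M because s is a sum of squares in R[V].\<close>

lemma fps_deriv_prod_linear:
  fixes y :: "'i \<Rightarrow> 'a::field_char_0"
  assumes "finite I"
  shows "fps_deriv (\<Prod>i\<in>I. 1 - fps_const (y i) * fps_X) =
    - (\<Prod>i\<in>I. 1 - fps_const (y i) * fps_X) * (\<Sum>i\<in>I. Abs_fps (\<lambda>n. y i ^ Suc n))"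
  using assms
proof (induction I rule: finite_induct)
  case (insert i I)
  have geo: "(1 - fps_const (y i) * fps_X) * Abs_fps (\<lambda>n. y i ^ Suc n) = fps_const (y i)"
    by (rule fps_ext) (auto simp: algebra_simps fps_X_mult_nth gr0_conv_Suc split: if_splits)
  let ?P = "\<Prod>i\<in>I. 1 - fps_const (y i) * fps_X"
  have "fps_deriv ((1 - fps_const (y i) * fps_X) * ?P) =
      - fps_const (y i) * ?P + (1 - fps_const (y i) * fps_X) * fps_deriv ?P"
    by simp
  also have "\<dots> = - ((1 - fps_const (y i) * fps_X) * Abs_fps (\<lambda>n. y i ^ Suc n)) * ?P
      + (1 - fps_const (y i) * fps_X) * fps_deriv ?P"
    unfolding geo by simp
  finally show ?case
    using insert by (simp add: algebra_simps)
qed simp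

text \<open>Coefficient \<open>n\<close> of the logarithmic derivative of the product of the
  \<open>1 - y i X\<close>. In characteristic 0 it can be solved for the next coefficient as well as
  for the next power sum.\<close>

lemma newton_identity:
  fixes y :: "'i \<Rightarrow> 'a::field_char_0"
  assumes "finite I"
  defines "P \<equiv> \<Prod>i\<in>I. 1 - fps_const (y i) * fps_X"
  shows "of_nat (Suc n) * fps_nth P (Suc n) =
    - (\<Sum>k\<le>n. fps_nth P k * (\<Sum>i\<in>I. y i ^ Suc (n - k)))"
proof -
  have "fps_nth (fps_deriv P) n = fps_nth (- P * (\<Sum>i\<in>I. Abs_fps (\<lambda>n. y i ^ Suc n))) n"
    unfolding P_def by (subst fps_deriv_prod_linear[OF assms(1)]) simp
  then show ?thesis
    by (simp add: fps_mult_nth fps_sum_nth sum_negf atLeast0AtMost)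
qed

lemma range_to_ac_closed:
  "x \<in> range to_ac \<Longrightarrow> y \<in> range to_ac \<Longrightarrow> x + y \<in> range to_ac"
  "x \<in> range to_ac \<Longrightarrow> y \<in> range to_ac \<Longrightarrow> x - y \<in> range to_ac"
  "x \<in> range to_ac \<Longrightarrow> y \<in> range to_ac \<Longrightarrow> x * y \<in> range to_ac"
  "x \<in> range to_ac \<Longrightarrow> y \<in> range to_ac \<Longrightarrow> x / y \<in> range to_ac"
  "x \<in> range to_ac \<Longrightarrow> - x \<in> range to_ac"
  "of_nat n \<in> range to_ac" "numeral m \<in> range to_ac" "0 \<in> range to_ac" "1 \<in> range to_ac"
  by (metis (no_types, lifting) rangeE rangeI to_ac_add to_ac_diff to_ac_mult to_ac_divide
      to_ac_minus to_ac_of_nat to_ac_numeral to_ac_0 to_ac_1)+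

lemma range_to_ac_sum: "(\<And>i. i \<in> I \<Longrightarrow> f i \<in> range to_ac) \<Longrightarrow> sum f I \<in> range to_ac"
  by (induction I rule: infinite_finite_induct) (auto intro: range_to_ac_closed)

lemma fps_nth_0_prod: "fps_nth (prod f I) 0 = (\<Prod>i\<in>I. fps_nth (f i) 0)"
  for f :: "'i \<Rightarrow> 'a::comm_ring_1 fps"
  by (induction I rule: infinite_finite_induct) auto

text \<open>Newton's identities solved in both directions by strong induction. This stands in for
  the theorem on symmetric polynomials: whether a product of linear factors has coefficients in the
  base field can be tested on power sums, which are easy to compute for new families of
  roots.\<close>

lemma coeffs_in_range_iff_power_sums:
  fixes y :: "'i \<Rightarrow> 'r::field_char_0 alg_closure"
  assumes "finite I"
  shows "(\<forall>n. coeff (\<Prod>i\<in>I. [:- y i, 1:]) n \<in> range to_ac) \<longleftrightarrow>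
    (\<forall>n. (\<Sum>i\<in>I. y i ^ n) \<in> range to_ac)" (is "?L \<longleftrightarrow> ?R")
proof -
  define p where "p = (\<Prod>i\<in>I. [:- y i, 1:])"
  define P where "P = (\<Prod>i\<in>I. 1 - fps_const (y i) * fps_X)"
  \<comment> \<open>Reversing the coefficients turns \<open>X - y i\<close> into
    \<open>1 - y i X\<close>, the form to which Newton's identities apply.\<close>
  have "reflect_poly p = (\<Prod>i\<in>I. [:1, - y i:])"
    unfolding p_def reflect_poly_prod
    by (intro prod.cong HOL.refl) (auto intro!: poly_eqI simp: coeff_reflect_poly coeff_pCons split: nat.splits)
  then have P: "fps_of_poly (reflect_poly p) = P"
    by (simp add: P_def fps_of_poly_prod fps_of_poly_pCons mult.commute flip: fps_const_neg)
  have nthP: "fps_nth P n = (if n > degree p then 0 else coeff p (degree p - n))" for n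
    unfolding P[symmetric] by (simp add: coeff_reflect_poly)
  have "?L \<longleftrightarrow> (\<forall>n. fps_nth P n \<in> range to_ac)" (is "_ \<longleftrightarrow> ?P")
  proof
    assume ?L
    then show ?P
      by (auto simp: nthP p_def range_to_ac_closed)
  next
    assume P: ?P
    show ?L
    proof
      fix n
      show "coeff (\<Prod>i\<in>I. [:- y i, 1:]) n \<in> range to_ac"
        unfolding p_def[symmetric]
        using P[rule_format, of "degree p - n"] nthP[of "degree p - n"]
        by (cases "n \<le> degree p") (auto simp: coeff_eq_0 range_to_ac_closed diff_less_mono2 split: if_splits)
    qed
  qed
  also have "\<dots> \<longleftrightarrow> ?R"
  proof
    assume P: ?P
    have P0: "fps_nth P 0 = 1"
      unfolding P_def fps_nth_0_prod by simp
    show ?R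
    proof
      fix n
      show "(\<Sum>i\<in>I. y i ^ n) \<in> range to_ac"
      proof (induction n rule: less_induct)
        case (less n)
        show ?case
        proof (cases n)
          case 0
          then show ?thesis by (simp add: range_to_ac_closed)
        next
          case (Suc m)
          have "(\<Sum>k\<le>m. fps_nth P k * (\<Sum>i\<in>I. y i ^ Suc (m - k))) =
            (\<Sum>i\<in>I. y i ^ n) + (\<Sum>k\<in>{1..m}. fps_nth P k * (\<Sum>i\<in>I. y i ^ Suc (m - k)))"
            using Suc P0 by (subst atMost_atLeast0, subst sum.atLeast_Suc_atMost) auto
          moreover have "of_nat n * fps_nth P n = - (\<Sum>k\<le>m. fps_nth P k * (\<Sum>i\<in>I. y i ^ Suc (m - k)))"
            using newton_identity[OF assms, of m y] Suc unfolding P_def by (simp only:)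
          moreover have "s = - a - t" if "b = s + t" "a = - b" for a b s t :: "'r alg_closure"
            using that by simp
          ultimately have "(\<Sum>i\<in>I. y i ^ n) = - (of_nat n * fps_nth P n) -
              (\<Sum>k\<in>{1..m}. fps_nth P k * (\<Sum>i\<in>I. y i ^ Suc (m - k)))"
            by blast
          also have "\<dots> \<in> range to_ac"
            using P less Suc
            by (intro range_to_ac_closed range_to_ac_sum[where I = "{1..m}"])
              (auto intro!: range_to_ac_closed(3) simp del: power_Suc)
          finally show ?thesis .
        qed
      qed
    qed
  next
    assume R: ?R
    show ?P
    proof
      fix n
      show "fps_nth P n \<in> range to_ac"
      proof (induction n rule: less_induct)
        case (less n)
        show ?case
        proof (cases n)
          case 0
          have "fps_nth P 0 = 1"
            unfolding P_def fps_nth_0_prod by simp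
          then show ?thesis using 0 by (simp add: range_to_ac_closed)
        next
          case (Suc m)
          have "fps_nth P n = - (\<Sum>k\<le>m. fps_nth P k * (\<Sum>i\<in>I. y i ^ Suc (m - k))) / of_nat n"
            using newton_identity[OF assms, of m y] Suc unfolding P_def
            by (simp add: field_simps del: of_nat_Suc)
          also have "\<dots> \<in> range to_ac"
            using R less Suc
            by (intro range_to_ac_closed range_to_ac_sum[where I = "{..m}"])
              (auto intro!: range_to_ac_closed(3) simp del: power_Suc)
          finally show ?thesis .
        qed
      qed
    qed
  qed
  finally show ?thesis .
qed


text \<open>The summand is symmetric in \<open>i\<close> and \<open>j\<close>, so the sum over
  \<open>i < j\<close> is half of the sum over the full square minus the diagonal; both of these are
  polynomials in the power sums of \<open>x\<close>.\<close>

lemma sum_pairs_in_range: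
  fixes x :: "nat \<Rightarrow> 'r::field_char_0 alg_closure"
  assumes s: "\<And>n. (\<Sum>i<d. x i ^ n) \<in> range to_ac"
  shows "(\<Sum>(i, j)\<in>{(i, j). i < j \<and> j < d}. (x i + x j + of_nat c * x i * x j) ^ n) \<in> range to_ac"
proof -
  let ?y = "\<lambda>i j. x i + x j + of_nat c * x i * x j"
  have sym: "?y i j = ?y j i" for i j
    by (simp add: algebra_simps)
  \<comment> \<open>The monomial weights make the induction on \<open>n\<close> work: one more
    factor \<open>?y i j\<close> only shifts the exponents \<open>a\<close> and
    \<open>b\<close>.\<close>
  have full: "(\<Sum>i<d. \<Sum>j<d. x i ^ a * x j ^ b * ?y i j ^ n) \<in> range to_ac" for a b n
  proof (induction n arbitrary: a b)
    case 0
    have "(\<Sum>i<d. \<Sum>j<d. x i ^ a * x j ^ b) = (\<Sum>i<d. x i ^ a) * (\<Sum>j<d. x j ^ b)"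
      by (simp add: sum_product)
    then show ?case using s by (simp add: range_to_ac_closed)
  next
    case (Suc n)
    have "(\<Sum>i<d. \<Sum>j<d. x i ^ a * x j ^ b * ?y i j ^ Suc n) =
      (\<Sum>i<d. \<Sum>j<d. x i ^ Suc a * x j ^ b * ?y i j ^ n) +
      (\<Sum>i<d. \<Sum>j<d. x i ^ a * x j ^ Suc b * ?y i j ^ n) +
      of_nat c * (\<Sum>i<d. \<Sum>j<d. x i ^ Suc a * x j ^ Suc b * ?y i j ^ n)"
      unfolding sum_distrib_left sum.distrib[symmetric]
      by (rule sum.cong[OF HOL.refl], rule sum.cong[OF HOL.refl]) (simp add: algebra_simps)
    then show ?case
      using Suc[of "Suc a" b] Suc[of a "Suc b"] Suc[of "Suc a" "Suc b"]
      by (simp only: range_to_ac_closed)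
  qed
  have diag: "(\<Sum>i<d. x i ^ a * ?y i i ^ n) \<in> range to_ac" for a n
  proof (induction n arbitrary: a)
    case 0
    then show ?case using s by simp
  next
    case (Suc n)
    have "(\<Sum>i<d. x i ^ a * ?y i i ^ Suc n) =
      2 * (\<Sum>i<d. x i ^ Suc a * ?y i i ^ n) + of_nat c * (\<Sum>i<d. x i ^ Suc (Suc a) * ?y i i ^ n)"
      unfolding sum_distrib_left sum.distrib[symmetric]
      by (intro sum.cong HOL.refl) (simp add: algebra_simps)
    then show ?case
      using Suc[of "Suc a"] Suc[of "Suc (Suc a)"] by (simp only: range_to_ac_closed)
  qed
  let ?L = "{(i, j). i < j \<and> j < d}" and ?G = "{(i, j). j < i \<and> i < d}" and ?D = "(\<lambda>i. (i, i)) ` {..<d}"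
  let ?f = "\<lambda>(i, j). ?y i j ^ n"
  have split: "{..<d} \<times> {..<d} = ?L \<union> (?G \<union> ?D)"
    by auto
  have fin: "finite ?L" "finite ?G"
    by (rule finite_subset[of _ "{..<d} \<times> {..<d}"]; auto)+
  have "sum ?f ({..<d} \<times> {..<d}) = sum ?f ?L + (sum ?f ?G + sum ?f ?D)"
    unfolding split using fin by (subst sum.union_disjoint; (subst sum.union_disjoint)?; auto)
  also have "sum ?f ?G = sum ?f ?L"
    by (rule sum.reindex_bij_witness[of _ "\<lambda>(i, j). (j, i)" "\<lambda>(i, j). (j, i)"])
      (auto simp: algebra_simps)
  also have "sum ?f ?D = (\<Sum>i<d. ?y i i ^ n)"
    by (subst sum.reindex) (auto simp: inj_on_def)
  also have "sum ?f ({..<d} \<times> {..<d}) = (\<Sum>i<d. \<Sum>j<d. ?y i j ^ n)"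
    by (simp add: sum.cartesian_product)
  finally have "sum ?f ?L = ((\<Sum>i<d. \<Sum>j<d. ?y i j ^ n) - (\<Sum>i<d. ?y i i ^ n)) / 2"
    by simp
  also have "\<dots> \<in> range to_ac"
    using full[of 0 0 n] diag[of 0 n] by (auto intro!: range_to_ac_closed)
  finally show ?thesis
    by simp
qed

section \<open>Arithmetic and square roots in R(i)\<close>

definition imag_unit :: "'r::real_closed_field alg_closure" where
  "imag_unit = (SOME z. z ^ 2 = -1)"

lemma imag_unit_square [simp]: "imag_unit * imag_unit = (-1 :: 'r::real_closed_field alg_closure)"
proof -
  have "\<exists>z. z ^ 2 = (-1 :: 'r alg_closure)"
    by (rule nth_root_exists) simp
  then have "imag_unit ^ 2 = (-1 :: 'r alg_closure)"
    unfolding imag_unit_def by (rule someI_ex)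
  then show ?thesis
    by (simp add: power2_eq_square)
qed

definition cplx :: "'r \<Rightarrow> 'r \<Rightarrow> 'r::real_closed_field alg_closure" where
  "cplx a b = to_ac a + imag_unit * to_ac b"

lemma
  fixes a b c d :: "'r::real_closed_field"
  shows cplx_add: "cplx a b + cplx c d = cplx (a + c) (b + d)"
  and cplx_diff: "cplx a b - cplx c d = cplx (a - c) (b - d)"
  and cplx_mult: "cplx a b * cplx c d = cplx (a * c - b * d) (a * d + b * c)"
  and cplx_minus: "- cplx a b = cplx (- a) (- b)"
  and cplx_real: "to_ac a = cplx a 0"
proof -
  have "imag_unit * (imag_unit * z) = - z" for z :: "'r alg_closure"
    by (simp flip: mult.assoc)
  from this[of "to_ac b * to_ac d"]
  show "cplx a b * cplx c d = cplx (a * c - b * d) (a * d + b * c)"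
    by (simp add: cplx_def algebra_simps)
qed (simp_all add: cplx_def algebra_simps)

text \<open>Multiplication by the conjugate gives a sum of two squares, which vanishes only
  trivially in an ordered field.\<close>

lemma cplx_eq_0_iff: "cplx a b = 0 \<longleftrightarrow> a = 0 \<and> b = 0"
proof
  assume "cplx a b = 0"
  then have "cplx a b * cplx a (- b) = 0"
    by simp
  then have "to_ac (a * a + b * b) = 0"
    by (simp only: cplx_mult) (simp add: cplx_def)
  then show "a = 0 \<and> b = 0"
    by (simp only: to_ac_eq_0_iff sum_squares_eq_zero_iff)
qed (simp add: cplx_def)

definition cplx_numbers :: "'r::real_closed_field alg_closure set" where
  "cplx_numbers = {cplx a b | a b. True}"

lemma cplx_numbers_closed:
  "z \<in> cplx_numbers \<Longrightarrow> w \<in> cplx_numbers \<Longrightarrow> z + w \<in> cplx_numbers"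
  "z \<in> cplx_numbers \<Longrightarrow> w \<in> cplx_numbers \<Longrightarrow> z - w \<in> cplx_numbers"
  "z \<in> cplx_numbers \<Longrightarrow> w \<in> cplx_numbers \<Longrightarrow> z * w \<in> cplx_numbers"
  "z \<in> cplx_numbers \<Longrightarrow> - z \<in> cplx_numbers"
  "to_ac a \<in> cplx_numbers"
  unfolding cplx_numbers_def
  by (auto simp: cplx_add cplx_diff cplx_mult cplx_minus cplx_real; metis)+

text \<open>With \<open>r\<close> the modulus, the parts of the root satisfy
  \<open>u^2 = (r + a) / 2\<close> and \<open>v^2 = (r - a) / 2\<close>; both right-hand sides are
  nonnegative and hence squares. The sign of \<open>v\<close> is then adjusted so that
  \<open>2 u v = b\<close>.\<close>

lemma cplx_sqrt:
  assumes "z \<in> cplx_numbers"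
  shows "\<exists>w\<in>cplx_numbers. w * w = z"
proof -
  obtain a b where z: "z = cplx a b"
    using assms by (auto simp: cplx_numbers_def)
  obtain r0 where "a * a + b * b = r0 * r0"
    using nonneg_imp_square[of "a * a + b * b"] by auto
  then obtain r where r: "r \<ge> 0" "a * a + b * b = r * r"
    by (intro that[of "\<bar>r0\<bar>"]) auto
  have "\<bar>a\<bar> \<le> r"
    using r zero_le_square[of b] by (intro abs_le_square_iff[THEN iffD2, of a r, simplified abs_of_nonneg[OF r(1)]])
      (simp add: power2_eq_square flip: r(2))
  then have "(r + a) / 2 \<ge> 0" "(r - a) / 2 \<ge> 0"
    by auto
  then obtain u v0 where u: "(r + a) / 2 = u * u" and v0: "(r - a) / 2 = v0 * v0"
    using nonneg_imp_square by metis
  have "(2 * u * v0) * (2 * u * v0) = 4 * ((r + a) / 2) * ((r - a) / 2)"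
    unfolding u v0 by (simp add: algebra_simps)
  also have "\<dots> = r * r - a * a"
    by (simp add: field_simps)
  also have "\<dots> = b * b"
    using r by (simp add: algebra_simps)
  finally have "2 * u * v0 = b \<or> 2 * u * v0 = - b"
    by (simp only: square_eq_iff)
  then obtain v where v: "v * v = v0 * v0" "2 * u * v = b"
    by (metis minus_mult_minus mult_minus_right minus_minus)
  have "a = u * u - v * v"
    unfolding v(1) u[symmetric] v0[symmetric] by (simp add: field_simps)
  then have "cplx u v * cplx u v = z"
    unfolding z cplx_mult using v(2) by (metis mult.commute mult.left_commute mult_2)
  then show ?thesis
    by (auto simp: cplx_numbers_def)
qed

text \<open>The discriminant \<open>(x + y)^2 - 4 x y\<close> is the square of \<open>x - y\<close>.
  Its square root in R(i) is \<open>x - y\<close> up to sign, and \<open>x\<close> is half of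
  \<open>(x + y) + (x - y)\<close>.\<close>

lemma cplx_quadratic_root:
  assumes "x + y \<in> cplx_numbers" "x * y \<in> cplx_numbers"
  shows "x \<in> cplx_numbers"
proof -
  have "(x + y) * (x + y) - to_ac 4 * (x * y) \<in> cplx_numbers"
    using cplx_numbers_closed(2)[OF cplx_numbers_closed(3)[OF assms(1) assms(1)]
      cplx_numbers_closed(3)[OF cplx_numbers_closed(5) assms(2)]] .
  then obtain w where w: "w \<in> cplx_numbers" "w * w = (x + y) * (x + y) - to_ac 4 * (x * y)"
    using cplx_sqrt by blast
  then have "w * w = (x - y) * (x - y)"
    by (simp add: algebra_simps)
  then have "w = x - y \<or> w = - (x - y)"
    by (simp only: square_eq_iff)
  then have "x - y = w \<or> x - y = - w"
    by (metis minus_minus)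
  then have "x - y \<in> cplx_numbers"
    using w(1) cplx_numbers_closed(4)[OF w(1)] by metis
  then have "to_ac (1 / 2) * ((x + y) + (x - y)) \<in> cplx_numbers"
    using assms by (intro cplx_numbers_closed(3)[OF cplx_numbers_closed(5)] cplx_numbers_closed(1)[of "x + y"])
  then show ?thesis
    by simp
qed

section \<open>Roots in R(i) of polynomials over R\<close>

lemma odd_degree_root:
  fixes p :: "'r::real_closed_field poly"
  assumes "odd (degree p)"
  shows "\<exists>x. poly p x = 0"
proof -
  have "lead_coeff p \<noteq> 0"
    using assms by (cases "p = 0") auto
  then obtain x where "(\<Sum>k\<le>degree p. coeff p k * x ^ k) = 0"
    using odd_degree_imp_root[of "degree p" "coeff p"] assms by auto
  then show ?thesis
    by (auto simp: poly_altdef)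
qed

lemma map_poly_to_ac_altdef: "poly (map_poly to_ac p) (to_ac x) = to_ac (poly p x)"
  by (induction p) (auto simp: map_poly_pCons)

lemma poly_of_coeffs_in_range:
  assumes "\<And>n. coeff q n \<in> range to_ac"
  obtains p where "q = map_poly to_ac p"
proof -
  have "map_poly to_ac (map_poly of_ac q) = q"
    using assms by (intro poly_eqI) (simp add: coeff_map_poly to_ac_of_ac)
  then show ?thesis
    using that by metis
qed

text \<open>Laplace's argument: the sums \<open>x\<^sub>i + x\<^sub>j + c x\<^sub>i x\<^sub>j\<close> over pairs of roots are the roots of a
  polynomial whose degree is divisible by fewer powers of \<open>2\<close>.\<close>

lemma fundamental_theorem_of_algebra_rcf_aux:
  fixes p :: "'r::real_closed_field poly"
  assumes "\<not> 2 ^ Suc k dvd degree p" "degree p > 0"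
  shows "\<exists>z\<in>cplx_numbers. poly (map_poly to_ac p) z = 0"
  using assms
proof (induction k arbitrary: p)
  case 0
  then obtain x where "poly p x = 0"
    using odd_degree_root[of p] by auto
  then have "poly (map_poly to_ac p) (to_ac x) = 0"
    by (simp add: map_poly_to_ac_altdef)
  then show ?case
    using cplx_numbers_closed by blast
next
  case (Suc k)
  define d where "d = degree p"
  show ?case
  proof (cases "2 ^ Suc k dvd d")
    case False
    then show ?thesis using Suc d_def by auto
  next
    case True
    define P where "P = map_poly to_ac p"
    have [simp]: "degree P = d" "P \<noteq> 0"
      using Suc.prems by (auto simp: P_def d_def degree_map_poly map_poly_eq_0_iff)
    obtain A where A: "size A = degree P" "P = smult (lead_coeff P) (\<Prod>x\<in>#A. [:-x, 1:])"
      using alg_closed_imp_factorization[of P] by auto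
    obtain xs where xs: "mset xs = A"
      using ex_mset by auto
    define x where "x = (!) xs"
    have len: "length xs = d"
      using A xs by (metis \<open>degree P = d\<close> size_mset)
    have "(\<Prod>x\<in>#A. [:-x, 1:]) = prod_list (map (\<lambda>x. [:-x, 1:]) xs)"
      unfolding xs[symmetric] by (metis mset_map prod_mset_prod_list)
    also have "\<dots> = (\<Prod>i<d. [:- x i, 1:])"
      by (simp add: prod.list_conv_set_nth len x_def atLeast0LessThan)
    finally have P: "P = smult (lead_coeff P) (\<Prod>i<d. [:- x i, 1:])"
      using A by simp
    have "coeff (\<Prod>i<d. [:- x i, 1:]) n = coeff P n / lead_coeff P" for n
      using arg_cong[OF P, of "\<lambda>p. coeff p n"] \<open>P \<noteq> 0\<close> unfolding coeff_smult
      by (metis leading_coeff_0_iff nonzero_mult_div_cancel_left)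
    then have "coeff (\<Prod>i<d. [:- x i, 1:]) n \<in> range to_ac" for n
      by (auto simp: P_def coeff_map_poly intro!: range_to_ac_closed)
    then have ps: "(\<Sum>i<d. x i ^ n) \<in> range to_ac" for n
      using coeffs_in_range_iff_power_sums[of "{..<d}" x] by auto
    define I where "I = {(i, j). i < j \<and> j < d}"
    have "finite I"
      unfolding I_def by (rule finite_subset[of _ "{..<d} \<times> {..<d}"]) auto
    define y where "y c = (\<lambda>(i, j). x i + x j + of_nat c * x i * x j)" for c :: nat
    have cardI: "2 * card I = d * (d - 1)"
    proof -
      have "bij_betw (\<lambda>(i, j). {i, j}) I {B. B \<subseteq> {..<d} \<and> card B = 2}"
      proof (rule bij_betwI')
        fix B assume "B \<in> {B. B \<subseteq> {..<d} \<and> card B = 2}"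
        then obtain a b where "B = {a, b}" "a \<noteq> b" "a < d" "b < d"
          by (auto simp: card_2_iff)
        then show "\<exists>ij\<in>I. B = (case ij of (i, j) \<Rightarrow> {i, j})"
          by (intro bexI[of _ "(min a b, max a b)"]) (auto simp: I_def min_def max_def)
      qed (auto simp: I_def doubleton_eq_iff)
      then have "card I = card {B. B \<subseteq> {..<d} \<and> card B = 2}"
        by (rule bij_betw_same_card)
      then have "card I = d choose 2"
        by (simp add: n_subsets)
      moreover have "even (d * (d - 1))"
        by (cases d) auto
      ultimately show ?thesis
        by (simp add: choose_two)
    qed
    have "even d" "d > 0"
      using True Suc.prems by (auto simp: d_def elim: dvd_trans[rotated])
    \<comment> \<open>Since \<open>d\<close> is even, \<open>d - 1\<close> is odd, so
      \<open>card I = d (d - 1) / 2\<close> contains exactly one factor 2 fewer than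
      \<open>d\<close> and the induction hypothesis applies.\<close>
    have nd: "\<not> 2 ^ Suc k dvd card I"
    proof
      assume "2 ^ Suc k dvd card I"
      then have "2 ^ Suc (Suc k) dvd d * (d - 1)"
        unfolding cardI[symmetric] by simp
      moreover have "coprime (2 ^ Suc (Suc k)) (d - 1)"
        using \<open>even d\<close> \<open>d > 0\<close> by (cases d) (auto simp: coprime_power_left_iff simp del: power_Suc)
      ultimately show False
        using Suc.prems by (simp add: coprime_dvd_mult_left_iff d_def)
    qed
    have "\<exists>ij\<in>I. y c ij \<in> cplx_numbers" for c
    proof -
      have "(\<Sum>ij\<in>I. y c ij ^ n) \<in> range to_ac" for n
        using sum_pairs_in_range[OF ps, where c = c and n = n] unfolding I_def y_def
        by (simp add: case_prod_unfold)
      then obtain q where q: "(\<Prod>ij\<in>I. [:- y c ij, 1:]) = map_poly to_ac q"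
        using coeffs_in_range_iff_power_sums[OF \<open>finite I\<close>, of "y c"] poly_of_coeffs_in_range by metis
      have "degree q = degree (\<Prod>ij\<in>I. [:- y c ij, 1:])"
        unfolding q by (simp add: degree_map_poly)
      also have "\<dots> = card I"
        by (subst degree_prod_eq_sum_degree) auto
      finally have "degree q = card I" .
      moreover have "card I > 0"
        using nd by (cases "card I") auto
      ultimately obtain z where z: "z \<in> cplx_numbers" "poly (map_poly to_ac q) z = 0"
        using Suc.IH[of q] nd by auto
      then have "\<exists>ij\<in>I. z = y c ij"
        unfolding q[symmetric] using \<open>finite I\<close> by (auto simp: poly_prod)
      then show ?thesis
        using z by auto
    qed
    then obtain ij where ij: "ij c \<in> I" "y c (ij c) \<in> cplx_numbers" for c
      by metis
    \<comment> \<open>There are infinitely many \<open>c\<close> but only finitely many pairs, so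
      one pair (i, j) serves two values of \<open>c\<close>. Subtracting gives
      \<open>x i * x j\<close>, then \<open>x i + x j\<close>, and the quadratic case gives
      \<open>x i\<close>.\<close>
    have "\<exists>a. \<not> finite {c\<in>UNIV. ij c = ij a}"
      using pigeonhole_infinite[of "UNIV :: nat set" ij] ij \<open>finite I\<close>
      by (auto intro: finite_subset[of "range ij" I])
    then obtain a where a: "infinite {c. ij c = ij a}"
      by auto
    then obtain b where b: "ij b = ij a" "b > a"
      by (auto simp: infinite_nat_iff_unbounded)
    obtain i j where eq: "ij a = (i, j)"
      by force
    have C: "x i + x j + of_nat a * (x i * x j) \<in> cplx_numbers"
      "x i + x j + of_nat b * (x i * x j) \<in> cplx_numbers"
      using ij(2)[of a] ij(2)[of b] by (auto simp: b eq y_def mult.assoc)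
    have ne: "(of_nat b - of_nat a :: 'r) \<noteq> 0"
      using b by simp
    have "to_ac (1 / (of_nat b - of_nat a)) *
      ((x i + x j + of_nat b * (x i * x j)) - (x i + x j + of_nat a * (x i * x j))) \<in> cplx_numbers"
      using C by (intro cplx_numbers_closed(3)[OF cplx_numbers_closed(5)] cplx_numbers_closed(2))
    also have "((x i + x j + of_nat b * (x i * x j)) - (x i + x j + of_nat a * (x i * x j))) =
      to_ac (of_nat b - of_nat a) * (x i * x j)"
      by (simp add: algebra_simps)
    also have "to_ac (1 / (of_nat b - of_nat a)) * (to_ac (of_nat b - of_nat a) * (x i * x j)) = x i * x j"
      unfolding mult.assoc[symmetric] to_ac_mult[symmetric] using ne by simp
    finally have prod: "x i * x j \<in> cplx_numbers" .
    have "(x i + x j + of_nat a * (x i * x j)) - to_ac (of_nat a) * (x i * x j) \<in> cplx_numbers"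
      using C prod by (intro cplx_numbers_closed(3)[OF cplx_numbers_closed(5)] cplx_numbers_closed(2))
    then have "x i \<in> cplx_numbers"
      using cplx_quadratic_root[OF _ prod] by simp
    moreover have "i < d"
      using ij(1)[of a] eq by (auto simp: I_def)
    then have "poly P (x i) = 0"
      by (subst P) (auto simp: poly_prod)
    ultimately show ?thesis
      by (auto simp: P_def)
  qed
qed

lemma fundamental_theorem_of_algebra_rcf:
  fixes p :: "'r::real_closed_field poly"
  assumes "degree p > 0"
  obtains u v where "poly (map_poly to_ac p) (cplx u v) = 0"
proof -
  \<comment> \<open>The degree itself is a large enough exponent, because
    \<open>2 ^ Suc n > n\<close>.\<close>
  have "\<not> 2 ^ Suc (degree p) dvd degree p"
    using assms by (auto dest!: dvd_imp_le) (metis less_exp not_less power_Suc less_le_trans le_add2 mult_2)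
  then show ?thesis
    using fundamental_theorem_of_algebra_rcf_aux[of "degree p" p] assms that
    by (auto simp: cplx_numbers_def)
qed

section \<open>Intermediate value, Rolle and mean value theorems for polynomials\<close>

lemma poly_real_factor:
  fixes p :: "'r::real_closed_field poly"
  assumes "degree p > 0"
  shows "(\<exists>u q. p = [:- u, 1:] * q) \<or>
    (\<exists>u v q. v \<noteq> 0 \<and> p = [:u * u + v * v, - 2 * u, 1:] * q)"
proof -
  obtain u v where z: "poly (map_poly to_ac p) (cplx u v) = 0"
    using fundamental_theorem_of_algebra_rcf[OF assms] .
  show ?thesis
  proof (cases "v = 0")
    case True
    then have "poly p u = 0"
      using z by (simp add: map_poly_to_ac_altdef flip: cplx_real)
    then have "[:- u, 1:] dvd p"
      by (simp add: poly_eq_0_iff_dvd)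
    then show ?thesis
      unfolding dvd_def by blast
  next
    case False
    define q where "q = [:u * u + v * v, - 2 * u, 1:]"
    have mp: "map_poly to_ac (f * g) = map_poly to_ac f * map_poly to_ac g"
      "map_poly to_ac (f + g) = map_poly to_ac f + map_poly to_ac g" for f g :: "'r poly"
      by (rule poly_eqI, simp add: coeff_map_poly coeff_mult to_ac_sum)+
    \<comment> \<open>A remainder of degree at most 1 that has the non-real root
      \<open>u + v i\<close> must vanish, so the quadratic \<open>(X - u)^2 + v^2\<close> divides
      \<open>p\<close>.\<close>
    define r where "r = p mod q"
    have "degree r < 2"
      using degree_mod_less[of q p] by (auto simp: r_def q_def)
    then obtain a b where ab: "r = [:a, b:]"
      by (metis degree_eq_zeroE degree_pCons_eq_if less_2_cases pCons_0_0 pCons_cases nat.inject One_nat_def)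
    have "poly (map_poly to_ac q) (cplx u v) = cplx (u * u + v * v) 0 + cplx u v * (cplx (- 2 * u) 0 + cplx u v)"
      by (simp add: q_def map_poly_pCons algebra_simps flip: cplx_real)
    also have "\<dots> = 0"
      unfolding cplx_add cplx_mult cplx_eq_0_iff by (simp add: algebra_simps)
    finally have "poly (map_poly to_ac r) (cplx u v) = 0"
      using z mult_div_mod_eq[of q p] mp unfolding r_def
      by (metis add_cancel_right_left mult_zero_left poly_add poly_mult)
    then have "cplx a 0 + cplx u v * cplx b 0 = 0"
      by (simp add: ab map_poly_pCons flip: cplx_real)
    then have "a = 0" "b = 0"
      using False by (auto simp: cplx_add cplx_mult cplx_eq_0_iff)
    then have "q dvd p"
      using ab by (auto simp: r_def mod_eq_0_iff_dvd)
    then show ?thesis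
      unfolding dvd_def q_def using False by blast
  qed
qed

text \<open>Induction on the degree, splitting off a real factor. A quadratic factor
  \<open>(x - u)^2 + v^2\<close> is positive everywhere, and a linear factor whose root lies outside
  \<open>[a, b]\<close> keeps its sign there.\<close>

lemma poly_sgn_const:
  fixes p :: "'r::real_closed_field poly"
  assumes "a \<le> b" "\<And>x. a \<le> x \<Longrightarrow> x \<le> b \<Longrightarrow> poly p x \<noteq> 0"
  shows "sgn (poly p a) = sgn (poly p b)"
  using assms(2)
proof (induction "degree p" arbitrary: p rule: less_induct)
  case (less p)
  show ?case
  proof (cases "degree p = 0")
    case True
    then show ?thesis
      by (auto elim: degree_eq_zeroE)
  next
    case False
    have "p \<noteq> 0"
      using False by auto
    consider u q where "p = [:- u, 1:] * q" | u v q where "v \<noteq> 0" "p = [:u * u + v * v, - 2 * u, 1:] * q"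
      using poly_real_factor[of p] False by blast
    then show ?thesis
    proof cases
      case (1 u q)
      then have "degree p = Suc (degree q)"
        using \<open>p \<noteq> 0\<close> by (subst 1, subst degree_mult_eq) auto
      then have "sgn (poly q a) = sgn (poly q b)"
        using 1 less by auto
      moreover have "sgn (a - u) = sgn (b - u)"
        using less.prems[of u] assms(1) 1 by (auto simp: sgn_if not_le)
      moreover have "poly p x = (x - u) * poly q x" for x
        by (simp add: 1 algebra_simps)
      ultimately show ?thesis
        by (simp add: sgn_mult)
    next
      case (2 u v q)
      then have "degree p = Suc (Suc (degree q))"
        using \<open>p \<noteq> 0\<close> by (subst 2, subst degree_mult_eq) auto
      then have "sgn (poly q a) = sgn (poly q b)"
        using less.prems by (intro less.hyps) (simp, simp only: 2(2) poly_mult mult_eq_0_iff, blast)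
      moreover have "poly [:u * u + v * v, - 2 * u, 1:] x > 0" for x
      proof -
        have "poly [:u * u + v * v, - 2 * u, 1:] x = (x - u) * (x - u) + v * v"
          by (simp add: algebra_simps)
        moreover have "v * v > 0"
          using \<open>v \<noteq> 0\<close> by (auto simp: zero_less_mult_iff linorder_neq_iff)
        ultimately show ?thesis
          by (simp only: add_nonneg_pos zero_le_square)
      qed
      moreover have "poly p x = poly [:u * u + v * v, - 2 * u, 1:] x * poly q x" for x
        by (simp only: 2 poly_mult)
      ultimately show ?thesis
        by (simp only: sgn_mult sgn_pos)
    qed
  qed
qed

lemma poly_IVT:
  fixes p :: "'r::real_closed_field poly"
  assumes "a \<le> b" "sgn (poly p a) \<noteq> sgn (poly p b)"
  shows "\<exists>x. a \<le> x \<and> x \<le> b \<and> poly p x = 0"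
  using poly_sgn_const[OF assms(1)] assms(2) by blast

text \<open>Instead of an extremum the argument uses factorizations. With \<open>c\<close> the next
  root after \<open>a\<close>, write \<open>p = (X - a)^(m+1) (X - c)^(n+1) q\<close>. Then the
  derivative is \<open>(X - a)^m (X - c)^n r\<close>, and \<open>r\<close> has opposite signs at
  \<open>a\<close> and \<open>c\<close> because \<open>q\<close> has constant sign on
  \<open>[a, c]\<close>.\<close>

lemma poly_Rolle:
  fixes p :: "'r::real_closed_field poly"
  assumes "a < b" "poly p a = 0" "poly p b = 0"
  shows "\<exists>x. a < x \<and> x < b \<and> poly (pderiv p) x = 0"
proof (cases "p = 0")
  case True
  then show ?thesis
    using assms dense by auto
next
  case False
  define c where "c = Min {x. poly p x = 0 \<and> a < x}"
  have fin: "finite {x. poly p x = 0 \<and> a < x}"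
    using poly_roots_finite[OF False] by (rule rev_finite_subset) auto
  moreover have "{x. poly p x = 0 \<and> a < x} \<noteq> {}"
    using assms by auto
  ultimately have "c \<in> {x. poly p x = 0 \<and> a < x}"
    unfolding c_def by (rule Min_in)
  then have c: "poly p c = 0" "a < c"
    by auto
  have "c \<le> b"
    unfolding c_def using fin assms by (intro Min_le) auto
  have nr: "poly p x \<noteq> 0" if "a < x" "x < c" for x
    using Min_le[OF fin, of x] that unfolding c_def by (auto simp: not_less[symmetric])
  obtain p1 where p1: "p = [:- a, 1:] ^ order a p * p1" "\<not> [:- a, 1:] dvd p1"
    using order_decomp[OF False] by metis
  have "p1 \<noteq> 0"
    using False p1 by auto
  obtain q where q: "p1 = [:- c, 1:] ^ order c p1 * q" "\<not> [:- c, 1:] dvd q"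
    using order_decomp[OF \<open>p1 \<noteq> 0\<close>] by metis
  have "order a p \<noteq> 0"
    using assms False by (simp add: order_root)
  then obtain m where m: "order a p = Suc m"
    by (cases "order a p") auto
  have "poly p1 c = 0"
    using c p1 by (metis (no_types, lifting) mult_eq_0_iff poly_mult poly_power power_not_zero
        poly_pCons poly_0 mult_zero_right add.right_neutral mult.right_neutral eq_neg_iff_add_eq_0 less_irrefl minus_minus)
  then have "order c p1 \<noteq> 0"
    using \<open>p1 \<noteq> 0\<close> by (simp add: order_root)
  then obtain n where n: "order c p1 = Suc n"
    by (cases "order c p1") auto
  have p: "p = [:- a, 1:] ^ Suc m * [:- c, 1:] ^ Suc n * q"
    using p1 q m n by (simp only: mult.assoc)
  have qa: "poly q a \<noteq> 0"
    using p1(2) q(1) unfolding poly_eq_0_iff_dvd by (metis dvd_mult)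
  have qc: "poly q c \<noteq> 0"
    using q(2) by (auto simp: poly_eq_0_iff_dvd)
  have "poly q x \<noteq> 0" if "a \<le> x" "x \<le> c" for x
    using qa qc nr[of x] that by (cases "x = a \<or> x = c") (auto simp: p)
  then have sq: "sgn (poly q a) = sgn (poly q c)"
    using c by (intro poly_sgn_const) auto
  define A B where "A = [:- a, 1:]" and "B = [:- c, 1:]"
  define r where "r = smult (of_nat (Suc m)) (B * q) + smult (of_nat (Suc n)) (A * q) + A * B * pderiv q"
  have [simp]: "pderiv A = 1" "pderiv B = 1"
    by (simp_all add: A_def B_def pderiv_pCons)
  have d: "pderiv p = A ^ m * B ^ n * r"
    unfolding p r_def A_def[symmetric] B_def[symmetric] pderiv_mult pderiv_power_Suc
    by (simp add: algebra_simps smult_add_right del: of_nat_Suc)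
  have ra: "poly r a = of_nat (Suc m) * (a - c) * poly q a"
    and rc: "poly r c = of_nat (Suc n) * (c - a) * poly q c"
    by (simp_all add: r_def A_def B_def algebra_simps)
  have "sgn (poly r a) = - sgn (poly q a)" "sgn (poly r c) = sgn (poly q c)"
    unfolding ra rc using c sgn_pos[of "of_nat (Suc m) :: 'r"] sgn_pos[of "of_nat (Suc n) :: 'r"]
    by (simp_all add: sgn_mult del: of_nat_Suc)
  then have "sgn (poly r a) \<noteq> sgn (poly r c)" "poly r a \<noteq> 0" "poly r c \<noteq> 0"
    using sq qa qc by (auto simp: sgn_if split: if_splits)
  then obtain x where "a \<le> x" "x \<le> c" "poly r x = 0" "x \<noteq> a" "x \<noteq> c"
    using poly_IVT[of a c r] c by fastforce
  then show ?thesis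
    using d \<open>c \<le> b\<close> by (intro exI[of _ x]) auto
qed

lemma poly_mean_value:
  fixes p :: "'r::real_closed_field poly"
  assumes "a < b"
  obtains x where "a < x" "x < b" "poly p b - poly p a = (b - a) * poly (pderiv p) x"
proof -
  define s where "s = (poly p b - poly p a) / (b - a)"
  define q where "q = p - [:poly p a - s * a, s:]"
  have "poly q a = 0"
    by (simp add: q_def algebra_simps)
  moreover have "s * (b - a) = poly p b - poly p a"
    using assms by (simp add: s_def)
  then have "poly q b = 0"
    by (simp add: q_def algebra_simps)
  ultimately obtain x where x: "a < x" "x < b" "poly (pderiv q) x = 0"
    using poly_Rolle[OF assms] by blast
  then have "poly (pderiv p) x = s"
    by (simp add: q_def pderiv_diff pderiv_pCons)
  then show ?thesis
    using that[OF x(1,2)] assms by (simp add: s_def)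
qed

section \<open>Order isomorphisms matching signs of polynomials\<close>

text \<open>A uniform positive bound, rather than mere positivity, is what survives the Horner step
  \<open>a + t * poly q t\<close>.\<close>

lemma poly_bounded_below_at_top:
  fixes p :: "'r::linordered_field poly"
  assumes "lead_coeff p > 0"
  shows "\<exists>c>0. \<exists>M. \<forall>t\<ge>M. poly p t \<ge> c"
  using assms
proof (induction p)
  case (pCons a q)
  show ?case
  proof (cases "q = 0")
    case True
    then show ?thesis using pCons by auto
  next
    case False
    then obtain c M where c: "c > 0" and M: "\<And>t. t \<ge> M \<Longrightarrow> poly q t \<ge> c"
      using pCons by auto
    have "poly (pCons a q) t \<ge> 1" if t: "t \<ge> max (max M 0) ((1 - a) / c)" for t
    proof -
      have "1 - a \<le> t * c"
        using t c by (simp add: field_simps)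
      also have "\<dots> \<le> t * poly q t"
        using t M[of t] by (intro mult_left_mono) auto
      finally show ?thesis by simp
    qed
    then show ?thesis
      by (intro exI[of _ 1] conjI exI[of _ "max (max M 0) ((1 - a) / c)"]) auto
  qed
qed simp

lemma square_pos: "x \<noteq> 0 \<Longrightarrow> x * x > 0" for x :: "'a::linordered_idom"
  by (auto simp: zero_less_mult_iff linorder_neq_iff)

text \<open>The leading coefficient of \<open>p * pderiv p\<close> is the degree times a square. Far
  to the right \<open>p\<close> thus has the sign of its derivative; this stands in for a right end
  point when there is no further zero.\<close>

lemma poly_times_pderiv_pos_at_top:
  fixes p :: "'r::linordered_field poly"
  assumes "degree p > 0"
  shows "\<exists>s>M. poly p s * poly (pderiv p) s > 0"
proof -
  have "p \<noteq> 0"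
    using assms by auto
  have "lead_coeff (pderiv p) = of_nat (degree p) * lead_coeff p"
    using assms by (simp add: degree_pderiv coeff_pderiv)
  then have "lead_coeff (p * pderiv p) = of_nat (degree p) * (lead_coeff p * lead_coeff p)"
    by (simp add: lead_coeff_mult)
  also have "\<dots> > 0"
    using assms \<open>p \<noteq> 0\<close> by (intro mult_pos_pos square_pos) auto
  finally obtain c N where "c > 0" "\<And>t. t \<ge> N \<Longrightarrow> poly (p * pderiv p) t \<ge> c"
    using poly_bounded_below_at_top by blast
  then have "poly (p * pderiv p) (max N (M + 1)) > 0"
    by (meson less_le_trans max.cobounded1)
  then show ?thesis
    by (intro exI[of _ "max N (M + 1)"]) (auto simp: less_max_iff_disj)
qed

lemma poly_times_pderiv_neg_at_bot:
  fixes p :: "'r::linordered_field poly"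
  assumes "degree p > 0"
  shows "\<exists>s<M. poly p s * poly (pderiv p) s < 0"
proof -
  have "degree (pcompose p [:0, -1:]) > 0"
    using assms by (simp add: degree_pcompose)
  then obtain s where "s > - M" "poly (pcompose p [:0, -1:]) s * poly (pderiv (pcompose p [:0, -1:])) s > 0"
    using poly_times_pderiv_pos_at_top by blast
  then show ?thesis
    by (intro exI[of _ "- s"]) (auto simp: poly_pcompose pderiv_pcompose pderiv_pCons)
qed

text \<open>The end points may be critical points, since the intervals are later cut out by the
  zeros of a family that contains the derivative; \<open>w\<close> is the sample point at which the
  sign is read off.\<close>

lemma poly_increment_sgn:
  fixes p :: "'r::real_closed_field poly"
  assumes "a < b" "a \<le> w" "w \<le> b"
    and nz: "\<And>x. a < x \<and> x < b \<or> x = w \<Longrightarrow> poly (pderiv p) x \<noteq> 0"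
  shows "sgn (poly p b - poly p a) = sgn (poly (pderiv p) w)"
proof -
  obtain c where c: "a < c" "c < b" "poly p b - poly p a = (b - a) * poly (pderiv p) c"
    using poly_mean_value[OF assms(1)] by metis
  have "sgn (poly (pderiv p) c) = sgn (poly (pderiv p) w)"
  proof (cases "c \<le> w")
    case True
    then show ?thesis
      using c assms by (intro poly_sgn_const nz) auto
  next
    case False
    then show ?thesis
      using c assms by (intro poly_sgn_const[symmetric] nz) auto
  qed
  then show ?thesis
    using c assms by (simp add: sgn_mult)
qed

text \<open>Affine on \<open>[u, a]\<close> and on \<open>[a, v]\<close> with the positive slopes
  \<open>k\<close> and \<open>l\<close>, and the identity elsewhere.\<close>

lemma bump_exists:
  fixes u v a b :: "'r::linordered_field"
  assumes "u < a" "a < v" "u < b" "b < v"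
  obtains \<beta> where "strict_mono \<beta>" "surj \<beta>" "\<beta> a = b"
    "\<And>x. x \<le> u \<or> v \<le> x \<Longrightarrow> \<beta> x = x" "\<And>x. u < x \<Longrightarrow> x < v \<Longrightarrow> u < \<beta> x \<and> \<beta> x < v"
proof -
  define k l where "k = (b - u) / (a - u)" and "l = (v - b) / (v - a)"
  have kl: "k > 0" "l > 0"
    using assms by (simp_all add: k_def l_def)
  define f g where "f x = u + (x - u) * k" and "g x = v - (v - x) * l" for x
  have f: "x < y \<longleftrightarrow> f x < f y" and g: "x < y \<longleftrightarrow> g x < g y" for x y
    using kl by (simp_all add: f_def g_def)
  have ends: "f u = u" "f a = b" "g a = b" "g v = v"
    using assms by (simp_all add: f_def g_def k_def l_def)
  have finv: "f (u + (y - u) / k) = y" and ginv: "g (v - (v - y) / l) = y" for y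
    using kl by (simp_all add: f_def g_def)
  define \<beta> where "\<beta> x = (if x \<le> u then x else if x \<le> a then f x else if x < v then g x else x)" for x
  have fr: "u < f x \<and> f x \<le> b" if "u < x" "x \<le> a" for x
    using that f[of u x] f[of a x] ends by auto
  have gr: "b < g x \<and> g x < v" if "a < x" "x < v" for x
    using that g[of a x] g[of x v] ends by auto
  have "\<beta> x < \<beta> y" if "x < y" for x y
    using that f[of x y] g[of x y] fr[of x] fr[of y] gr[of x] gr[of y] assms
    unfolding \<beta>_def by (auto split: if_splits)
  then have "strict_mono \<beta>"
    by (simp add: strict_mono_def)
  moreover have "\<exists>x. \<beta> x = y" for y
  proof -
    consider "y \<le> u \<or> v \<le> y" | "u < y" "y \<le> b" | "b < y" "y < v"
      by fastforce
    then show ?thesis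
    proof cases
      case 1
      then show ?thesis using assms by (intro exI[of _ y]) (auto simp: \<beta>_def)
    next
      case 2
      then show ?thesis
        using finv[of y] f[of u "u + (y - u) / k"] f[of a "u + (y - u) / k"] ends
        by (intro exI[of _ "u + (y - u) / k"]) (auto simp: \<beta>_def)
    next
      case 3
      then show ?thesis
        using ginv[of y] g[of a "v - (v - y) / l"] g[of "v - (v - y) / l" v] ends assms
        by (intro exI[of _ "v - (v - y) / l"]) (auto simp: \<beta>_def)
    qed
  qed
  then have "surj \<beta>"
    by (metis surjI)
  moreover have "\<beta> a = b" "\<And>x. x \<le> u \<or> v \<le> x \<Longrightarrow> \<beta> x = x"
    using assms ends by (auto simp: \<beta>_def)
  moreover have "u < \<beta> x \<and> \<beta> x < v" if "u < x" "x < v" for x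
    using that fr[of x] gr[of x] assms by (auto simp: \<beta>_def)
  ultimately show ?thesis
    using that by blast
qed

lemma finite_gap_left:
  fixes Z :: "'r::linorder set"
  assumes "finite Z"
  shows "(\<exists>u\<in>Z. u < t \<and> (\<forall>v\<in>Z. v \<le> u \<or> t \<le> v)) \<or> (\<forall>v\<in>Z. t \<le> v)"
proof (cases "{v\<in>Z. v < t} = {}")
  case False
  then have "Max {v\<in>Z. v < t} \<in> {v\<in>Z. v < t}"
    using assms by (intro Max_in) auto
  moreover have "v \<le> Max {v\<in>Z. v < t} \<or> t \<le> v" if "v \<in> Z" for v
    using assms that Max_ge[of "{v\<in>Z. v < t}" v] by (cases "v < t") auto
  ultimately show ?thesis by blast
next
  case True
  then have "\<forall>v\<in>Z. t \<le> v"
    using leI by blast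
  then show ?thesis by blast
qed

lemma finite_gap_right:
  fixes Z :: "'r::linorder set"
  assumes "finite Z"
  shows "(\<exists>u\<in>Z. t < u \<and> (\<forall>v\<in>Z. u \<le> v \<or> v \<le> t)) \<or> (\<forall>v\<in>Z. v \<le> t)"
proof (cases "{v\<in>Z. t < v} = {}")
  case False
  then have "Min {v\<in>Z. t < v} \<in> {v\<in>Z. t < v}"
    using assms by (intro Min_in) auto
  moreover have "Min {v\<in>Z. t < v} \<le> v \<or> v \<le> t" if "v \<in> Z" for v
    using assms that Min_le[of "{v\<in>Z. t < v}" v] by (cases "t < v") auto
  ultimately show ?thesis by blast
next
  case True
  then have "\<forall>v\<in>Z. v \<le> t"
    using leI by blast
  then show ?thesis by blast
qed

text \<open>An order automorphism that carries one sign table onto the other. It replaces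
  bookkeeping with lists of roots and sample points: by surjectivity every point of either line has
  a counterpart with the same signs.\<close>

definition sign_match :: "'i set \<Rightarrow> ('i \<Rightarrow> 'r poly) \<Rightarrow> ('i \<Rightarrow> 'r poly) \<Rightarrow> ('r \<Rightarrow> 'r::real_closed_field) \<Rightarrow> bool" where
  "sign_match J f g \<phi> \<longleftrightarrow> strict_mono \<phi> \<and> surj \<phi> \<and>
    (\<forall>i\<in>J. \<forall>t. sgn (poly (f i) t) = sgn (poly (g i) (\<phi> t)))"

text \<open>What is known about \<open>P\<close> and \<open>Q\<close> before they are compared:
  their signs at the zeros of the simpler family, later supplied by pseudo-remainders.\<close>

definition sign_match_at_roots ::
  "'i set \<Rightarrow> ('i \<Rightarrow> 'r poly) \<Rightarrow> 'r poly \<Rightarrow> 'r poly \<Rightarrow> ('r \<Rightarrow> 'r::real_closed_field) \<Rightarrow> bool" where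
  "sign_match_at_roots J f P Q \<phi> \<longleftrightarrow>
    (\<forall>i\<in>J. \<forall>t. poly (f i) t = 0 \<longrightarrow> sgn (poly P t) = sgn (poly Q (\<phi> t)))"

lemma sign_match_zero_iff:
  "sign_match J f g \<phi> \<Longrightarrow> i \<in> J \<Longrightarrow> poly (g i) (\<phi> t) = 0 \<longleftrightarrow> poly (f i) t = 0"
  unfolding sign_match_def by (metis sgn_0_0)

lemma sign_match_inv:
  assumes "sign_match J f g \<phi>"
  shows "sign_match J g f (inv_into UNIV \<phi>)"
proof -
  have "strict_mono \<phi>" "surj \<phi>"
    using assms by (auto simp: sign_match_def)
  then have "strict_mono (inv_into UNIV \<phi>)"
    by (metis (no_types, lifting) strict_mono_def strict_mono_less surj_f_inv_f)
  moreover have "surj (inv_into UNIV \<phi>)"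
    using \<open>strict_mono \<phi>\<close> by (simp add: strict_mono_imp_increasing inj_imp_surj_inv strict_mono_on_imp_inj_on)
  ultimately show ?thesis
    using assms unfolding sign_match_def by (auto simp: surj_f_inv_f)
qed

lemma sign_match_at_roots_inv:
  assumes "sign_match J f g \<phi>" "sign_match_at_roots J f P Q \<phi>"
  shows "sign_match_at_roots J g Q P (inv_into UNIV \<phi>)"
  using assms sign_match_zero_iff[OF assms(1)] unfolding sign_match_at_roots_def sign_match_def
  by (metis surj_f_inv_f)

text \<open>On the gap around \<open>t\<close> between zeros of the family the derivative has
  constant nonzero sign, so \<open>P\<close> takes opposite signs at the two ends. \<open>Q\<close>
  has these signs at the images of the ends, and the intermediate value theorem yields a root of
  \<open>Q\<close> in the image of the gap.\<close>

lemma sign_match_root_transfer: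
  fixes P Q :: "'r::real_closed_field poly"
  assumes J: "finite J" "\<And>i. i \<in> J \<Longrightarrow> f i \<noteq> 0"
    and d: "d \<in> J" "f d = pderiv P" "g d = pderiv Q"
    and m: "sign_match J f g \<phi>" "sign_match_at_roots J f P Q \<phi>"
    and t: "poly P t = 0" "\<And>i. i \<in> J \<Longrightarrow> poly (f i) t \<noteq> 0"
  shows "\<exists>t'. poly Q (\<phi> t') = 0 \<and>
    (\<forall>i\<in>J. \<forall>s. t \<le> s \<and> s \<le> t' \<or> t' \<le> s \<and> s \<le> t \<longrightarrow> poly (f i) s \<noteq> 0)"
proof -
  define Z where "Z = {s. \<exists>i\<in>J. poly (f i) s = 0}"
  have "finite Z"
    unfolding Z_def using J by (auto intro: poly_roots_finite)
  have sm: "strict_mono \<phi>" "surj \<phi>"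
    using m by (auto simp: sign_match_def)
  have sd: "sgn (poly (pderiv Q) (\<phi> s)) = sgn (poly (pderiv P) s)" for s
    using m(1) d unfolding sign_match_def by metis
  have dZ: "poly (pderiv P) s \<noteq> 0" if "s \<notin> Z" for s
    using that d by (auto simp: Z_def)
  have tZ: "t \<notin> Z"
    using t by (auto simp: Z_def)
  have zQ: "sgn (poly Q (\<phi> s)) = sgn (poly P s)" if "s \<in> Z" for s
    using that m(2) unfolding Z_def sign_match_at_roots_def by auto
  have degQ: "degree Q > 0"
    using sd[of t] dZ[OF tZ] by (metis bot_nat_0.not_eq_extremum pderiv_eq_0_iff poly_0 sgn_0 sgn_0_0)
  have L: "\<exists>s<t. (\<forall>u. s < u \<and> u \<le> t \<longrightarrow> u \<notin> Z) \<and> sgn (poly Q (\<phi> s)) = - sgn (poly (pderiv P) t)"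
    using finite_gap_left[OF \<open>finite Z\<close>, of t]
  proof (elim disjE bexE conjE)
    fix u assume u: "u \<in> Z" "u < t" "\<forall>v\<in>Z. v \<le> u \<or> t \<le> v"
    then have n: "v \<notin> Z" if "u < v" "v \<le> t" for v
      using that tZ by (cases "v = t") force+
    have "sgn (poly P t - poly P u) = sgn (poly (pderiv P) t)"
      using u n by (intro poly_increment_sgn dZ) auto
    then have "sgn (poly Q (\<phi> u)) = - sgn (poly (pderiv P) t)"
      using t zQ[OF u(1)] by (simp add: sgn_minus)
    then show ?thesis
      using u n by blast
  next
    assume n: "\<forall>v\<in>Z. t \<le> v"
    \<comment> \<open>There is no zero on the left, so the missing end is replaced by a point where
      \<open>Q\<close> and its derivative have opposite signs.\<close>
    obtain s' where s': "s' < \<phi> t" "poly Q s' * poly (pderiv Q) s' < 0"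
      using poly_times_pderiv_neg_at_bot[OF degQ] by blast
    obtain s where s: "s' = \<phi> s"
      using sm by (metis surjD)
    have "s < t"
      using s s' sm by (simp add: strict_mono_less)
    have n': "v \<notin> Z" if "v \<le> t" for v
      using that tZ n by (cases "v = t") force+
    have "sgn (poly (pderiv P) s) = sgn (poly (pderiv P) t)"
      using \<open>s < t\<close> n' by (intro poly_sgn_const dZ) auto
    moreover have "sgn (poly Q s') = - sgn (poly (pderiv Q) s')"
      using s' by (auto simp: mult_less_0_iff)
    ultimately show ?thesis
      using \<open>s < t\<close> n' sd[of s] s by (intro exI[of _ s]) auto
  qed
  have R: "\<exists>s>t. (\<forall>u. t \<le> u \<and> u < s \<longrightarrow> u \<notin> Z) \<and> sgn (poly Q (\<phi> s)) = sgn (poly (pderiv P) t)"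
    using finite_gap_right[OF \<open>finite Z\<close>, of t]
  proof (elim disjE bexE conjE)
    fix u assume u: "u \<in> Z" "t < u" "\<forall>v\<in>Z. u \<le> v \<or> v \<le> t"
    then have n: "v \<notin> Z" if "v < u" "t \<le> v" for v
      using that tZ by (cases "v = t") force+
    have "sgn (poly P u - poly P t) = sgn (poly (pderiv P) t)"
      using u n by (intro poly_increment_sgn dZ) auto
    then have "sgn (poly Q (\<phi> u)) = sgn (poly (pderiv P) t)"
      using t zQ[OF u(1)] by simp
    then show ?thesis
      using u n by blast
  next
    assume n: "\<forall>v\<in>Z. v \<le> t"
    obtain s' where s': "s' > \<phi> t" "poly Q s' * poly (pderiv Q) s' > 0"
      using poly_times_pderiv_pos_at_top[OF degQ] by blast
    obtain s where s: "s' = \<phi> s"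
      using sm by (metis surjD)
    have "s > t"
      using s s' sm by (simp add: strict_mono_less)
    have n': "v \<notin> Z" if "v \<ge> t" for v
      using that tZ n by (cases "v = t") force+
    have "sgn (poly (pderiv P) t) = sgn (poly (pderiv P) s)"
      using \<open>s > t\<close> n' by (intro poly_sgn_const dZ) auto
    moreover have "sgn (poly Q s') = sgn (poly (pderiv Q) s')"
      using s' by (auto simp: zero_less_mult_iff)
    ultimately show ?thesis
      using \<open>s > t\<close> n' sd[of s] s by (intro exI[of _ s]) auto
  qed
  obtain s where s: "s < t" "\<And>u. s < u \<Longrightarrow> u \<le> t \<Longrightarrow> u \<notin> Z" "sgn (poly Q (\<phi> s)) = - sgn (poly (pderiv P) t)"
    using L by blast
  obtain r where r: "r > t" "\<And>u. t \<le> u \<Longrightarrow> u < r \<Longrightarrow> u \<notin> Z" "sgn (poly Q (\<phi> r)) = sgn (poly (pderiv P) t)"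
    using R by blast
  have ne: "sgn (poly (pderiv P) t) \<noteq> 0"
    using dZ[OF tZ] by (simp add: sgn_0_0)
  have "\<phi> s \<le> \<phi> r"
    using s r sm by (simp add: strict_mono_less_eq)
  moreover have "sgn (poly Q (\<phi> s)) \<noteq> sgn (poly Q (\<phi> r))"
    using s r ne by simp
  ultimately obtain y where y: "\<phi> s \<le> y" "y \<le> \<phi> r" "poly Q y = 0"
    using poly_IVT by blast
  obtain t' where t': "y = \<phi> t'"
    using sm by (metis surjD)
  have "t' \<noteq> s" "t' \<noteq> r"
    using y t' s r ne by auto
  then have "s < t'" "t' < r"
    using y t' sm by (auto simp: strict_mono_less_eq less_le)
  then have "u \<notin> Z" if "t \<le> u \<and> u \<le> t' \<or> t' \<le> u \<and> u \<le> t" for u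
    using that s(2)[of u] r(2)[of u] by (meson le_less_trans less_le_trans)
  then show ?thesis
    using y t' by (auto simp: Z_def)
qed

lemma poly_root_unique:
  fixes P :: "'r::real_closed_field poly"
  assumes "poly P s = 0" "poly P t = 0"
    and "\<And>x. s \<le> x \<and> x \<le> t \<or> t \<le> x \<and> x \<le> s \<Longrightarrow> poly (pderiv P) x \<noteq> 0"
  shows "s = t"
proof (rule ccontr)
  assume "s \<noteq> t"
  then have "s < t \<or> t < s" by auto
  then show False
    using poly_Rolle[of s t P] poly_Rolle[of t s P] assms by (metis less_imp_le)
qed

text \<open>A root of \<open>P\<close> that \<open>\<phi>\<close> does not map to a root of \<open>Q\<close> is repaired by composing \<open>\<phi>\<close> with a bump
  map supported in an interval without roots of the \<open>g i\<close>.\<close>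

lemma sign_match_fix_roots:
  fixes P Q :: "'r::real_closed_field poly"
  assumes J: "finite J" "\<And>i. i \<in> J \<Longrightarrow> f i \<noteq> 0" "\<And>i. i \<in> J \<Longrightarrow> g i \<noteq> 0"
    and d: "d \<in> J" "f d = pderiv P" "g d = pderiv Q" and "P \<noteq> 0"
    and m: "sign_match J f g \<phi>" "sign_match_at_roots J f P Q \<phi>"
  shows "\<exists>\<phi>. sign_match J f g \<phi> \<and> sign_match_at_roots J f P Q \<phi> \<and>
    (\<forall>t. poly P t = 0 \<longrightarrow> poly Q (\<phi> t) = 0)"
  using m
proof (induction "card {t. poly P t = 0 \<and> poly Q (\<phi> t) \<noteq> 0}" arbitrary: \<phi> rule: less_induct)
  case (less \<phi>)
  note m = less.prems
  \<comment> \<open>The measure: roots of \<open>P\<close> that are not yet sent to roots of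
    \<open>Q\<close>.\<close>
  let ?B = "\<lambda>\<phi>. {t. poly P t = 0 \<and> poly Q (\<phi> t) \<noteq> 0}"
  have finB: "finite (?B \<phi>)" for \<phi>
    using poly_roots_finite[OF \<open>P \<noteq> 0\<close>] by (rule rev_finite_subset) auto
  show ?case
  proof (cases "?B \<phi> = {}")
    case True
    then show ?thesis using m by blast
  next
    case False
    then obtain t where t: "poly P t = 0" "poly Q (\<phi> t) \<noteq> 0"
      by auto
    have tZ: "poly (f i) t \<noteq> 0" if "i \<in> J" for i
      using m(2) t that unfolding sign_match_at_roots_def by (metis sgn_0 sgn_0_0)
    obtain t' where t': "poly Q (\<phi> t') = 0"
      "\<And>i s. i \<in> J \<Longrightarrow> t \<le> s \<and> s \<le> t' \<or> t' \<le> s \<and> s \<le> t \<Longrightarrow> poly (f i) s \<noteq> 0"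
      using sign_match_root_transfer[OF J(1,2) d m t(1) tZ] by blast
    have sm: "strict_mono \<phi>" "surj \<phi>"
      using m by (auto simp: sign_match_def)
    define Z where "Z = {y. \<exists>i\<in>J. poly (g i) y = 0}"
    have "finite Z"
      unfolding Z_def using J by (auto intro: poly_roots_finite)
    define lo hi where "lo = min (\<phi> t) (\<phi> t')" and "hi = max (\<phi> t) (\<phi> t')"
    have nZ: "y \<notin> Z" if "lo \<le> y" "y \<le> hi" for y
    proof -
      obtain s where s: "y = \<phi> s"
        using sm by (metis surjD)
      have "t \<le> s \<and> s \<le> t' \<or> t' \<le> s \<and> s \<le> t"
        using that sm unfolding s lo_def hi_def min_def max_def
        by (auto simp: strict_mono_less_eq split: if_splits)
      then show ?thesis
        using t'(2) sign_match_zero_iff[OF m(1)] by (auto simp: s Z_def)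
    qed
    \<comment> \<open>\<open>u\<close> and \<open>v\<close> are neighbouring zeros of the family, or
      arbitrary outer points if there are none. The bump moves only points strictly between them, so
      it preserves all signs of the \<open>g i\<close>.\<close>
    obtain u where u: "u < lo" "\<And>y. y \<in> Z \<Longrightarrow> y \<le> u \<or> lo \<le> y"
      using finite_gap_left[OF \<open>finite Z\<close>, of lo] lt_ex[of lo] by blast
    obtain v where v: "hi < v" "\<And>y. y \<in> Z \<Longrightarrow> v \<le> y \<or> y \<le> hi"
      using finite_gap_right[OF \<open>finite Z\<close>, of hi] gt_ex[of hi] by blast
    have nZ': "y \<notin> Z" if "u < y" "y < v" for y
    proof
      assume "y \<in> Z"
      then have "lo \<le> y" "y \<le> hi"
        using that u(2)[of y] v(2)[of y] by (metis not_le)+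
      then show False
        using nZ \<open>y \<in> Z\<close> by blast
    qed
    obtain \<beta> where \<beta>: "strict_mono \<beta>" "surj \<beta>" "\<beta> (\<phi> t) = \<phi> t'"
      "\<And>x. x \<le> u \<or> v \<le> x \<Longrightarrow> \<beta> x = x" "\<And>x. u < x \<Longrightarrow> x < v \<Longrightarrow> u < \<beta> x \<and> \<beta> x < v"
      using bump_exists[of u "\<phi> t" v "\<phi> t'"] u(1) v(1) unfolding lo_def hi_def by auto
    have \<beta>sgn: "sgn (poly (g i) (\<beta> y)) = sgn (poly (g i) y)" if "i \<in> J" for i y
    proof (cases "u < y \<and> y < v")
      case True
      then have \<beta>y: "u < \<beta> y" "\<beta> y < v"
        using \<beta>(5) by auto
      have nz: "poly (g i) x \<noteq> 0" if "u < x" "x < v" for x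
        using nZ'[OF that] \<open>i \<in> J\<close> by (auto simp: Z_def)
      show ?thesis
      proof (cases "y \<le> \<beta> y")
        case le: True
        show ?thesis
          by (rule poly_sgn_const[symmetric, OF le]) (metis nz True \<beta>y less_le_trans le_less_trans)
      next
        case ge: False
        then have "\<beta> y \<le> y"
          by simp
        then show ?thesis
          by (rule poly_sgn_const) (metis nz True \<beta>y less_le_trans le_less_trans)
      qed
    next
      case False
      then have "\<beta> y = y"
        by (intro \<beta>(4)) (simp add: not_less)
      then show ?thesis by (simp only:)
    qed
    have \<beta>Z: "\<beta> y = y" if "y \<in> Z" for y
    proof (rule \<beta>(4))
      show "y \<le> u \<or> v \<le> y"
        using nZ'[of y] that by (meson not_le)
    qed
    have m1: "sign_match J f g (\<beta> \<circ> \<phi>)"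
      using m(1) \<beta>(1) \<beta>sgn comp_surj[OF sm(2) \<beta>(2)] sm(1) unfolding sign_match_def
      by (auto simp: strict_mono_def)
    have m2: "sign_match_at_roots J f P Q (\<beta> \<circ> \<phi>)"
      unfolding sign_match_at_roots_def
    proof (intro ballI allI impI)
      fix i s assume i: "i \<in> J" "poly (f i) s = 0"
      then have "\<phi> s \<in> Z"
        using sign_match_zero_iff[OF m(1)] by (auto simp: Z_def)
      then show "sgn (poly P s) = sgn (poly Q ((\<beta> \<circ> \<phi>) s))"
        using \<beta>Z i m(2) by (auto simp: sign_match_at_roots_def)
    qed
    have "s \<in> ?B \<phi> \<and> s \<noteq> t" if "s \<in> ?B (\<beta> \<circ> \<phi>)" for s
    proof -
      have s: "poly P s = 0" "poly Q (\<beta> (\<phi> s)) \<noteq> 0"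
        using that by auto
      have "s \<noteq> t"
        using s t' \<beta>(3) by auto
      moreover have "poly Q (\<phi> s) \<noteq> 0"
      proof
        assume Q0: "poly Q (\<phi> s) = 0"
        then have us: "u < \<phi> s" "\<phi> s < v"
          using s \<beta>(4)[of "\<phi> s"] by (metis not_le)+
        have ut: "u < \<phi> t" "\<phi> t < v"
          using u(1) v(1) unfolding lo_def hi_def by auto
        \<comment> \<open>A matched root of \<open>P\<close> that the bump moves would share with
          \<open>t\<close> an interval on which the derivative has no zero; by Rolle's theorem it is
          \<open>t\<close>. Hence no matched root is spoiled.\<close>
        have "s = t"
        proof (rule poly_root_unique[OF s(1) t(1)])
          fix x assume "s \<le> x \<and> x \<le> t \<or> t \<le> x \<and> x \<le> s"
          then have "\<phi> s \<le> \<phi> x \<and> \<phi> x \<le> \<phi> t \<or> \<phi> t \<le> \<phi> x \<and> \<phi> x \<le> \<phi> s"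
            using sm by (simp add: strict_mono_less_eq)
          then have "u < \<phi> x" "\<phi> x < v"
            using us ut by auto
          then have "\<phi> x \<notin> Z"
            by (rule nZ')
          then show "poly (pderiv P) x \<noteq> 0"
            using d sign_match_zero_iff[OF m(1) d(1)] by (auto simp: Z_def)
        qed
        then show False
          using \<open>s \<noteq> t\<close> by simp
      qed
      ultimately show ?thesis
        using s by auto
    qed
    then have "?B (\<beta> \<circ> \<phi>) \<subset> ?B \<phi>"
      using t by blast
    then have "card (?B (\<beta> \<circ> \<phi>)) < card (?B \<phi>)"
      by (rule psubset_card_mono[OF finB])
    then show ?thesis
      using less.hyps m1 m2 by blast
  qed
qed

text \<open>First the roots are aligned in both directions. The sign at any other point is then
  determined from the left end of its gap: by the derivative if that end is a root of
  \<open>P\<close>, by constancy if it is another zero, and by the behaviour at minus infinity if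
  there is no end.\<close>

lemma sign_match_extend:
  fixes P Q :: "'r::real_closed_field poly"
  assumes J: "finite J" "\<And>i. i \<in> J \<Longrightarrow> f i \<noteq> 0" "\<And>i. i \<in> J \<Longrightarrow> g i \<noteq> 0"
    and d: "d \<in> J" "f d = pderiv P" "g d = pderiv Q"
    and m: "sign_match J f g \<phi>" "sign_match_at_roots J f P Q \<phi>"
  shows "\<exists>\<phi>. sign_match J f g \<phi> \<and> (\<forall>t. sgn (poly P t) = sgn (poly Q (\<phi> t)))"
proof -
  have dP: "degree P > 0" "P \<noteq> 0" "degree Q > 0"
    using J(2,3)[OF d(1)] d by (auto simp: pderiv_eq_0_iff)
  obtain \<phi> where m: "sign_match J f g \<phi>" "sign_match_at_roots J f P Q \<phi>"
    and z: "\<And>t. poly P t = 0 \<Longrightarrow> poly Q (\<phi> t) = 0"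
    using sign_match_fix_roots[OF J d dP(2) m] by blast
  have sm: "strict_mono \<phi>" "surj \<phi>"
    using m by (auto simp: sign_match_def)
  have inv: "inv_into UNIV \<phi> (\<phi> t) = t" for t
    using sm by (simp add: strict_mono_on_imp_inj_on)
  define Z where "Z = {s. \<exists>i\<in>J. poly (f i) s = 0}"
  have sd: "sgn (poly (pderiv Q) (\<phi> s)) = sgn (poly (pderiv P) s)" for s
    using m(1) d unfolding sign_match_def by metis
  have dZ: "poly (pderiv P) s \<noteq> 0" if "s \<notin> Z" for s
    using that d by (auto simp: Z_def)
  have dZ': "poly (pderiv Q) y \<noteq> 0" if "inv_into UNIV \<phi> y \<notin> Z" for y
    using dZ[OF that] sd[of "inv_into UNIV \<phi> y"] sm by (metis sgn_0_0 surj_f_inv_f)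
  have zQ: "sgn (poly P s) = sgn (poly Q (\<phi> s))" if "s \<in> Z" for s
    using that m(2) unfolding Z_def sign_match_at_roots_def by auto
  \<comment> \<open>The inverse map transfers a root of \<open>Q\<close> to a root of
    \<open>P\<close>, whose image \<open>y\<close> is a root of \<open>Q\<close> as well. Between
    the two roots the derivative of \<open>Q\<close> has no zero, so they coincide.\<close>
  have z': "poly P t = 0" if Q0: "poly Q (\<phi> t) = 0" for t
  proof (cases "t \<in> Z")
    case True
    then show ?thesis
      using zQ Q0 by (metis sgn_0 sgn_0_0)
  next
    case False
    then have "poly (g i) (\<phi> t) \<noteq> 0" if "i \<in> J" for i
      using sign_match_zero_iff[OF m(1) that] that by (auto simp: Z_def)
    then obtain y where y: "poly P (inv_into UNIV \<phi> y) = 0"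
      "\<And>i s. i \<in> J \<Longrightarrow> \<phi> t \<le> s \<and> s \<le> y \<or> y \<le> s \<and> s \<le> \<phi> t \<Longrightarrow> poly (g i) s \<noteq> 0"
      using sign_match_root_transfer[OF J(1) J(3) d(1) d(3,2) sign_match_inv[OF m(1)]
        sign_match_at_roots_inv[OF m] Q0] by blast
    have "\<phi> t = y"
    proof (rule poly_root_unique[OF Q0])
      show "poly Q y = 0"
        using z[OF y(1)] sm by (simp add: surj_f_inv_f)
      show "poly (pderiv Q) x \<noteq> 0" if "\<phi> t \<le> x \<and> x \<le> y \<or> y \<le> x \<and> x \<le> \<phi> t" for x
        using y(2)[OF d(1) that] d by simp
    qed
    then show ?thesis
      using y inv by metis
  qed
  define Y where "Y = Z \<union> {t. poly P t = 0}"
  have "finite Y"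
    unfolding Y_def Z_def using J dP by (auto intro: poly_roots_finite)
  have "sgn (poly P t) = sgn (poly Q (\<phi> t))" for t
  proof (cases "t \<in> Y")
    case True
    then show ?thesis
      using zQ z by (auto simp: Y_def)
  next
    case False
    then have tY: "t \<notin> Z" "poly P t \<noteq> 0"
      by (auto simp: Y_def)
    have PQ: "poly P s \<noteq> 0 \<Longrightarrow> poly Q (\<phi> s) \<noteq> 0" for s
      using z' by blast
    have betw: "\<exists>s. y = \<phi> s \<and> a \<le> s \<and> s \<le> b" if "\<phi> a \<le> y" "y \<le> \<phi> b" for a b y
      using that sm by (metis strict_mono_less_eq surjD)
    have betw': "\<exists>s. y = \<phi> s \<and> a < s \<and> s < b" if "\<phi> a < y" "y < \<phi> b" for a b y
      using that sm by (metis strict_mono_less surjD)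
    show ?thesis
      using finite_gap_left[OF \<open>finite Y\<close>, of t]
    proof (elim disjE bexE conjE)
      fix u assume u: "u \<in> Y" "u < t" "\<forall>v\<in>Y. v \<le> u \<or> t \<le> v"
      then have n: "v \<notin> Y" if "u < v" "v \<le> t" for v
        using that False by (cases "v = t") force+
      have \<phi>u: "\<phi> u < \<phi> t"
        using u sm by (simp add: strict_mono_less)
      show ?thesis
      proof (cases "poly P u = 0")
        case True
        have "sgn (poly P t - poly P u) = sgn (poly (pderiv P) t)"
          using u n by (intro poly_increment_sgn dZ) (auto simp: Y_def)
        moreover have "sgn (poly Q (\<phi> t) - poly Q (\<phi> u)) = sgn (poly (pderiv Q) (\<phi> t))"
        proof (rule poly_increment_sgn)
          fix y assume "\<phi> u < y \<and> y < \<phi> t \<or> y = \<phi> t"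
          then obtain s where "y = \<phi> s" "u < s" "s \<le> t"
            using betw'[of u y t] u by (auto intro: less_imp_le)
          then show "poly (pderiv Q) y \<noteq> 0"
            using n[of s] inv by (intro dZ') (auto simp: Y_def)
        qed (use \<phi>u in auto)
        ultimately show ?thesis
          using True z[OF True] sd[of t] by simp
      next
        case nz: False
        have "poly P s \<noteq> 0" if "u \<le> s" "s \<le> t" for s
          using n[of s] nz that by (cases "s = u") (auto simp: Y_def)
        note nr = this
        have "sgn (poly P u) = sgn (poly P t)"
          using u nr by (intro poly_sgn_const) auto
        moreover have "sgn (poly Q (\<phi> u)) = sgn (poly Q (\<phi> t))"
        proof (rule poly_sgn_const)
          fix y assume "\<phi> u \<le> y" "y \<le> \<phi> t"
          then show "poly Q y \<noteq> 0"
            using betw[of u y t] nr PQ by auto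
        qed (use \<phi>u in auto)
        moreover have "u \<in> Z"
          using nz u by (auto simp: Y_def)
        ultimately show ?thesis
          using zQ by simp
      qed
    next
      assume n0: "\<forall>v\<in>Y. t \<le> v"
      have n: "v \<notin> Y" if "v \<le> t" for v
        using that False n0 by (cases "v = t") force+
      have nr: "poly P s \<noteq> 0" "poly (pderiv P) s \<noteq> 0" if "s \<le> t" for s
        using n[OF that] dZ by (auto simp: Y_def)
      have nr': "poly Q y \<noteq> 0" "poly (pderiv Q) y \<noteq> 0" if "y \<le> \<phi> t" for y
      proof -
        obtain s where "y = \<phi> s" "s \<le> t"
          using \<open>y \<le> \<phi> t\<close> sm by (metis strict_mono_less_eq surjD)
        then show "poly Q y \<noteq> 0" "poly (pderiv Q) y \<noteq> 0"
          using nr[of s] PQ[of s] n[of s] inv by (auto intro!: dZ' simp: Y_def)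
      qed
      obtain s where s: "s < t" "poly P s * poly (pderiv P) s < 0"
        using poly_times_pderiv_neg_at_bot[OF dP(1)] by blast
      obtain y where y: "y < \<phi> t" "poly Q y * poly (pderiv Q) y < 0"
        using poly_times_pderiv_neg_at_bot[OF dP(3)] by blast
      have "sgn (poly P s) = sgn (poly P t)" "sgn (poly (pderiv P) s) = sgn (poly (pderiv P) t)"
        using s nr by (intro poly_sgn_const; simp)+
      moreover have "sgn (poly Q y) = sgn (poly Q (\<phi> t))" "sgn (poly (pderiv Q) y) = sgn (poly (pderiv Q) (\<phi> t))"
        using y nr' by (intro poly_sgn_const; simp)+
      moreover have "sgn (poly P s) = - sgn (poly (pderiv P) s)" "sgn (poly Q y) = - sgn (poly (pderiv Q) y)"
        using s y by (auto simp: mult_less_0_iff)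
      ultimately show ?thesis
        using sd[of t] by simp
    qed
  qed
  then show ?thesis
    using m by blast
qed

section \<open>Semialgebraic predicates and quantifier elimination\<close>

lemma sign_match_mono:
  "sign_match \<F> f g \<phi> \<Longrightarrow> \<F>' \<subseteq> \<F> \<Longrightarrow> sign_match \<F>' f g \<phi>"
  by (auto simp: sign_match_def)

lemma sign_matchD: "sign_match J f g \<phi> \<Longrightarrow> i \<in> J \<Longrightarrow> sgn (poly (f i) t) = sgn (poly (g i) (\<phi> t))"
  by (auto simp: sign_match_def)

section \<open>Polynomials in one variable whose coefficients depend on parameters\<close>

locale function_algebra =
  fixes C :: "('x \<Rightarrow> 'r::real_closed_field) set"
  assumes const_closed: "(\<lambda>x. a) \<in> C"
    and add_closed: "c \<in> C \<Longrightarrow> d \<in> C \<Longrightarrow> (\<lambda>x. c x + d x) \<in> C"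
    and mult_closed: "c \<in> C \<Longrightarrow> d \<in> C \<Longrightarrow> (\<lambda>x. c x * d x) \<in> C"
begin

lemma diff_closed: "c \<in> C \<Longrightarrow> d \<in> C \<Longrightarrow> (\<lambda>x. c x - d x) \<in> C"
  using add_closed[of c "\<lambda>x. -1 * d x"] mult_closed[of "\<lambda>x. -1" d] const_closed by simp

lemma power_closed: "c \<in> C \<Longrightarrow> (\<lambda>x. c x ^ n) \<in> C"
  by (induction n) (simp_all add: const_closed mult_closed)

lemma sum_closed: "(\<And>i. i \<in> I \<Longrightarrow> c i \<in> C) \<Longrightarrow> (\<lambda>x. \<Sum>i\<in>I. c i x) \<in> C"
  by (induction I rule: infinite_finite_induct) (simp_all add: const_closed add_closed)

text \<open>A parametric polynomial of formal length \<open>n\<close>; the actual degree may drop at special parameters.\<close>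

definition ppoly :: "nat \<Rightarrow> ('x \<Rightarrow> 'r poly) \<Rightarrow> bool" where
  "ppoly n F \<longleftrightarrow> (\<forall>x. \<forall>i\<ge>n. coeff (F x) i = 0) \<and> (\<forall>i. (\<lambda>x. coeff (F x) i) \<in> C)"

lemma ppoly_mono: "ppoly n F \<Longrightarrow> n \<le> m \<Longrightarrow> ppoly m F"
  by (auto simp: ppoly_def)

lemma ppoly_const: "c \<in> C \<Longrightarrow> ppoly 1 (\<lambda>x. [:c x:])"
  unfolding ppoly_def
proof (intro conjI allI impI)
  show "(\<lambda>x. coeff [:c x:] i) \<in> C" if "c \<in> C" for i
    using that by (cases i) (auto simp: const_closed)
qed (auto simp: coeff_pCons split: nat.splits)

lemma ppoly_X: "ppoly 2 (\<lambda>x. [:0, 1:])"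
  by (auto simp: ppoly_def const_closed numeral_2_eq_2 coeff_pCons split: nat.splits)

lemma ppoly_add: "ppoly n F \<Longrightarrow> ppoly m G \<Longrightarrow> ppoly (max n m) (\<lambda>x. F x + G x)"
  by (auto simp: ppoly_def add_closed)

lemma ppoly_mult:
  assumes "ppoly n F" "ppoly m G"
  shows "ppoly (n + m) (\<lambda>x. F x * G x)"
  unfolding ppoly_def
proof (intro conjI allI impI)
  fix x i assume i: "n + m \<le> i"
  have "coeff (F x) j * coeff (G x) (i - j) = 0" for j
    using assms i by (cases "n \<le> j") (auto simp: ppoly_def)
  then show "coeff (F x * G x) i = 0"
    unfolding coeff_mult by (intro sum.neutral) simp
next
  fix i
  show "(\<lambda>x. coeff (F x * G x) i) \<in> C"
    unfolding coeff_mult using assms by (intro sum_closed mult_closed) (auto simp: ppoly_def)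
qed

lemma ppoly_pderiv: "ppoly (Suc n) F \<Longrightarrow> ppoly n (\<lambda>x. pderiv (F x))"
  unfolding ppoly_def by (auto simp: coeff_pderiv intro!: mult_closed const_closed simp del: of_nat_Suc)

lemma ppoly_cutoff: "ppoly n F \<Longrightarrow> ppoly m (\<lambda>x. poly_cutoff m (F x))"
  unfolding ppoly_def
proof (intro conjI allI impI)
  show "(\<lambda>x. coeff (poly_cutoff m (F x)) i) \<in> C"
    if "(\<forall>x. \<forall>i\<ge>n. coeff (F x) i = 0) \<and> (\<forall>i. (\<lambda>x. coeff (F x) i) \<in> C)" for i
    using that by (cases "i < m") (auto simp: coeff_poly_cutoff const_closed)
qed (auto simp: coeff_poly_cutoff)

text \<open>The leading coefficient is cleared instead of inverted, as it may vanish for some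
  parameters. The exponent is even so that the multiplier preserves signs wherever that coefficient
  is nonzero.\<close>

lemma ppoly_pseudo_remainder:
  assumes "ppoly n F" "ppoly (Suc m) G"
  shows "\<exists>H e. ppoly m H \<and> (\<forall>x. \<exists>q. smult (coeff (G x) m ^ (2 * e)) (F x) = q * G x + H x)"
  using assms(1)
proof (induction n arbitrary: F)
  case 0
  then show ?case
    by (intro exI[of _ F] exI[of _ 0]) (auto intro: ppoly_mono exI[of _ 0])
next
  case (Suc n)
  show ?case
  proof (cases "Suc n \<le> m")
    case True
    then show ?thesis
      using Suc.prems by (intro exI[of _ F] exI[of _ 0]) (auto intro: ppoly_mono exI[of _ 0])
  next
    case False
    then have "m \<le> n" by simp
    let ?c = "\<lambda>x. coeff (G x) m"
    let ?q = "\<lambda>x. monom (?c x * coeff (F x) n) (n - m)"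
    define F1 where "F1 x = smult (?c x ^ 2) (F x) - ?q x * G x" for x
    have "ppoly n F1"
      unfolding ppoly_def
    proof (intro conjI allI impI)
      fix x i assume "n \<le> i"
      then have "coeff (F1 x) i = ?c x ^ 2 * coeff (F x) i - ?c x * coeff (F x) n * coeff (G x) (i - (n - m))"
        by (simp add: F1_def coeff_monom_mult)
      moreover have "coeff (F x) i = 0" "coeff (G x) (i - (n - m)) = 0" if "i \<noteq> n"
        using \<open>n \<le> i\<close> \<open>m \<le> n\<close> that Suc.prems assms(2) by (auto simp: ppoly_def)
      ultimately show "coeff (F1 x) i = 0"
        using \<open>m \<le> n\<close> by (cases "i = n") (auto simp: power2_eq_square)
    next
      fix i
      have "(\<lambda>x. ?c x ^ 2 * coeff (F x) i - (if i < n - m then 0 else ?c x * coeff (F x) n) * coeff (G x) (i - (n - m))) \<in> C"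
        using Suc.prems assms(2) unfolding ppoly_def
        by (cases "i < n - m") (auto intro!: diff_closed mult_closed power_closed const_closed)
      also have "(\<lambda>x. ?c x ^ 2 * coeff (F x) i - (if i < n - m then 0 else ?c x * coeff (F x) n) * coeff (G x) (i - (n - m)))
        = (\<lambda>x. coeff (F1 x) i)"
        by (auto simp: F1_def coeff_monom_mult)
      finally show "(\<lambda>x. coeff (F1 x) i) \<in> C" .
    qed
    then obtain H e where H: "ppoly m H" "\<And>x. \<exists>q. smult (?c x ^ (2 * e)) (F1 x) = q * G x + H x"
      using Suc.IH by blast
    have "\<exists>q. smult (?c x ^ (2 * Suc e)) (F x) = q * G x + H x" for x
    proof -
      obtain q where "smult (?c x ^ (2 * e)) (F1 x) = q * G x + H x"
        using H by blast
      then have "smult (?c x ^ (2 * Suc e)) (F x) = (q + smult (?c x ^ (2 * e)) (?q x)) * G x + H x"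
        by (simp add: F1_def algebra_simps smult_diff_right power_add power2_eq_square)
      then show ?thesis ..
    qed
    then show ?thesis
      using H(1) by blast
  qed
qed

text \<open>The degree of \<open>G x\<close> varies with \<open>x\<close>, so there is one remainder
  for each possible degree \<open>j\<close>: cutting \<open>G\<close> off after index
  \<open>j\<close> makes coefficient \<open>j\<close> the leading one wherever the degree is
  \<open>j\<close>.\<close>

lemma ppoly_remainder_at_roots:
  assumes "ppoly n F" "ppoly m G"
  shows "\<exists>R. \<forall>j<m. ppoly j (R j) \<and>
    (\<forall>x z. G x \<noteq> 0 \<and> degree (G x) = j \<and> poly (G x) z = 0 \<longrightarrow> sgn (poly (F x) z) = sgn (poly (R j x) z))"
proof -
  define T where "T j H \<longleftrightarrow> ppoly j H \<and>
    (\<forall>x z. G x \<noteq> 0 \<and> degree (G x) = j \<and> poly (G x) z = 0 \<longrightarrow> sgn (poly (F x) z) = sgn (poly (H x) z))" for j H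
  have "\<exists>H. T j H" for j
  proof -
    obtain H e where H: "ppoly j H"
      "\<And>x. \<exists>q. smult (coeff (poly_cutoff (Suc j) (G x)) j ^ (2 * e)) (F x) = q * poly_cutoff (Suc j) (G x) + H x"
      using ppoly_pseudo_remainder[OF assms(1) ppoly_cutoff[OF assms(2), of "Suc j"]] by blast
    have "sgn (poly (F x) z) = sgn (poly (H x) z)" if x: "G x \<noteq> 0" "degree (G x) = j" "poly (G x) z = 0" for x z
    proof -
      have "poly_cutoff (Suc j) (G x) = G x"
        using x by (intro poly_eqI) (auto simp: coeff_poly_cutoff coeff_eq_0)
      then obtain q where "smult (coeff (G x) j ^ (2 * e)) (F x) = q * G x + H x"
        using H(2)[of x] x by (metis coeff_poly_cutoff lessI)
      then have "poly (smult (coeff (G x) j ^ (2 * e)) (F x)) z = poly (q * G x + H x) z"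
        by (simp only:)
      then have "coeff (G x) j ^ (2 * e) * poly (F x) z = poly (H x) z"
        using x(3) by simp
      moreover have "coeff (G x) j \<noteq> 0"
        using x by (metis leading_coeff_0_iff)
      then have "coeff (G x) j ^ (2 * e) > 0"
        by (simp add: zero_less_power_eq)
      ultimately show ?thesis
        using sgn_mult[of "coeff (G x) j ^ (2 * e)" "poly (F x) z"] by (simp only: sgn_pos mult_1)
    qed
    then show ?thesis
      using H(1) unfolding T_def by blast
  qed
  then have "\<exists>R. \<forall>j. T j (R j)"
    by (intro choice allI)
  then show ?thesis
    unfolding T_def by blast
qed

section \<open>Sign tables and the Cohen-Hoermander induction\<close>

definition same_signs :: "('x \<Rightarrow> 'r) set \<Rightarrow> 'x \<Rightarrow> 'x \<Rightarrow> bool" where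
  "same_signs D x y \<longleftrightarrow> (\<forall>c\<in>D. sgn (c x) = sgn (c y))"

text \<open>Elimination of one variable in semantic form: the signs of finitely many coefficient
  functions decide the whole sign table, up to an order automorphism of the line.\<close>

definition tame :: "('x \<Rightarrow> 'r poly) set \<Rightarrow> bool" where
  "tame \<F> \<longleftrightarrow> (\<exists>D. finite D \<and> D \<subseteq> C \<and>
    (\<forall>x y. same_signs D x y \<longrightarrow> (\<exists>\<phi>. sign_match \<F> (\<lambda>F. F x) (\<lambda>F. F y) \<phi>)))"

text \<open>A long polynomial \<open>F\<close> is traded for its derivative, its truncation (for
  parameters at which the top coefficient vanishes) and its remainders modulo the other members and
  the derivative. All of these have length at most \<open>n\<close>, so they may join
  \<open>\<B>\<close>, and \<open>IH\<close> admits any finite number of such polynomials.\<close>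

lemma tame_insert:
  assumes fin: "finite \<A>" "finite \<B>"
    and A: "\<And>G. G \<in> \<A> \<Longrightarrow> ppoly (Suc n) G" and B: "\<And>G. G \<in> \<B> \<Longrightarrow> ppoly n G"
    and F: "ppoly (Suc n) F"
    and IH: "\<And>\<B>. finite \<B> \<Longrightarrow> (\<And>G. G \<in> \<B> \<Longrightarrow> ppoly n G) \<Longrightarrow> tame (\<A> \<union> \<B>)"
  shows "tame (insert F (\<A> \<union> \<B>))"
proof -
  define F' F0 where "F' x = pderiv (F x)" and "F0 x = poly_cutoff n (F x)" for x
  have F': "ppoly n F'" and F0: "ppoly n F0"
    unfolding F'_def F0_def using F by (auto intro: ppoly_pderiv ppoly_cutoff)
  define \<G> where "\<G> = insert F' (\<A> \<union> \<B>)"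
  have G: "ppoly (Suc n) G" if "G \<in> \<G>" for G
    using that A ppoly_mono[OF B] ppoly_mono[OF F', of "Suc n"] by (auto simp: \<G>_def)
  then obtain R where R: "\<And>G j. G \<in> \<G> \<Longrightarrow> j \<le> n \<Longrightarrow> ppoly j (R G j)"
    "\<And>G j x z. G \<in> \<G> \<Longrightarrow> j \<le> n \<Longrightarrow> G x \<noteq> 0 \<Longrightarrow> degree (G x) = j \<Longrightarrow> poly (G x) z = 0 \<Longrightarrow>
      sgn (poly (F x) z) = sgn (poly (R G j x) z)"
    using ppoly_remainder_at_roots[OF F G] unfolding less_Suc_eq_le by metis
  define \<R> where "\<R> = (\<lambda>(G, j). R G j) ` (\<G> \<times> {..n})"
  have "tame (\<A> \<union> insert F0 \<B>)"
    using F0 B fin by (intro IH) auto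
  then obtain D1 where D1: "finite D1" "D1 \<subseteq> C"
    "\<And>x y. same_signs D1 x y \<Longrightarrow> \<exists>\<phi>. sign_match (\<A> \<union> insert F0 \<B>) (\<lambda>F. F x) (\<lambda>F. F y) \<phi>"
    unfolding tame_def by auto
  have "tame (\<A> \<union> (insert F' \<B> \<union> \<R>))"
  proof (rule IH)
    show "finite (insert F' \<B> \<union> \<R>)"
      using fin by (auto simp: \<R>_def \<G>_def)
    show "ppoly n H" if "H \<in> insert F' \<B> \<union> \<R>" for H
      using that F' B ppoly_mono[OF R(1)] unfolding \<R>_def by auto
  qed
  then obtain D2 where D2: "finite D2" "D2 \<subseteq> C"
    "\<And>x y. same_signs D2 x y \<Longrightarrow> \<exists>\<phi>. sign_match (\<A> \<union> (insert F' \<B> \<union> \<R>)) (\<lambda>F. F x) (\<lambda>F. F y) \<phi>"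
    unfolding tame_def by auto
  \<comment> \<open>Signs of all coefficients are included so that each member has the same degree
    at \<open>x\<close> and at \<open>y\<close>, and hence the same remainder is relevant at
    both.\<close>
  define D3 where "D3 = (\<lambda>(G, i) x. coeff (G x) i) ` (insert F \<G> \<times> {..n})"
  have D3: "finite D3" "D3 \<subseteq> C"
    using fin F G unfolding D3_def \<G>_def ppoly_def by auto
  have "\<exists>\<phi>. sign_match (insert F (\<A> \<union> \<B>)) (\<lambda>F. F x) (\<lambda>F. F y) \<phi>"
    if xy: "same_signs (D1 \<union> D2 \<union> D3) x y" for x y
  proof -
    have sc: "sgn (coeff (G x) i) = sgn (coeff (G y) i)" if "G \<in> insert F \<G>" for G i
    proof (cases "i \<le> n")
      case True
      then have "(\<lambda>x. coeff (G x) i) \<in> D3"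
        using that unfolding D3_def by auto
      then show ?thesis
        using xy[unfolded same_signs_def, rule_format, of "\<lambda>x. coeff (G x) i"] by simp
    next
      case False
      have "ppoly (Suc n) G"
        using that F G by auto
      then show ?thesis
        using False unfolding ppoly_def by auto
    qed
    have cz: "coeff (G x) i = 0 \<longleftrightarrow> coeff (G y) i = 0" if "G \<in> insert F \<G>" for G i
      using sc[OF that, of i] by (metis sgn_0_0)
    have dg: "degree (G x) = degree (G y)" "G x = 0 \<longleftrightarrow> G y = 0" if "G \<in> insert F \<G>" for G
      using cz[OF that] by (auto simp: degree_def poly_eq_iff)
    have dn: "degree (G x) \<le> n" if "G \<in> insert F \<G>" for G
    proof -
      have "ppoly (Suc n) G"
        using that F G by auto
      then show ?thesis
        unfolding ppoly_def by (intro degree_le) auto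
    qed
    have "same_signs D1 x y" "same_signs D2 x y"
      using xy by (auto simp: same_signs_def)
    then obtain \<phi> \<psi> where \<phi>: "sign_match (\<A> \<union> insert F0 \<B>) (\<lambda>F. F x) (\<lambda>F. F y) \<phi>"
      and \<psi>: "sign_match (\<A> \<union> (insert F' \<B> \<union> \<R>)) (\<lambda>F. F x) (\<lambda>F. F y) \<psi>"
      using D1(3) D2(3) by blast
    consider "coeff (F x) n = 0" | "coeff (F x) n \<noteq> 0" "n = 0" | "coeff (F x) n \<noteq> 0" "n > 0"
      by auto
    then show ?thesis
    proof cases
      case 1
      have "F0 z = F z" if "coeff (F z) n = 0" for z
      proof (rule poly_eqI)
        fix i
        have "coeff (F z) i = 0" if "Suc n \<le> i"
          using F that unfolding ppoly_def by blast
        then have "coeff (F z) i = 0" if "\<not> i < n"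
          using \<open>coeff (F z) n = 0\<close> that by (cases "i = n") (simp_all add: not_less Suc_le_eq)
        then show "coeff (F0 z) i = coeff (F z) i"
          unfolding F0_def coeff_poly_cutoff by presburger
      qed
      then have F0: "F0 x = F x" "F0 y = F y"
        using 1 cz[of F n] by simp_all
      have "sgn (poly (G x) t) = sgn (poly (G y) (\<phi> t))" if "G \<in> insert F (\<A> \<union> \<B>)" for G t
        using that sign_matchD[OF \<phi>, of G t] sign_matchD[OF \<phi>, of F0 t] F0 by (cases "G = F") simp_all
      moreover have "strict_mono \<phi>" "surj \<phi>"
        using \<phi> unfolding sign_match_def by blast+
      ultimately show ?thesis
        unfolding sign_match_def by blast
    next
      case 2
      have "\<exists>a. F z = [:a:]" for z
        using F 2 unfolding ppoly_def by (metis degree_eq_zeroE degree_le le_zero_eq less_Suc0 linorder_not_le not_less_eq_eq)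
      then have "poly (F z) t = coeff (F z) 0" for z t
        by (metis coeff_pCons_0 mult_zero_right poly_0 poly_pCons add.right_neutral)
      then have "sgn (poly (F x) t) = sgn (poly (F y) (\<psi> t))" for t
        using sc[of F 0] by simp
      moreover have "sgn (poly (G x) t) = sgn (poly (G y) (\<psi> t))" if "G \<in> \<A> \<union> \<B>" for G t
        by (rule sign_matchD[OF \<psi>]) (use that in blast)
      ultimately have "sgn (poly (G x) t) = sgn (poly (G y) (\<psi> t))" if "G \<in> insert F (\<A> \<union> \<B>)" for G t
        using that by blast
      moreover have "strict_mono \<psi>" "surj \<psi>"
        using \<psi> unfolding sign_match_def by blast+
      ultimately show ?thesis
        unfolding sign_match_def by blast
    next
      case 3
      \<comment> \<open>A member that vanishes identically at \<open>x\<close> does so at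
        \<open>y\<close> too, and is matched by every map; it must be left out because its zeros are
        not isolated.\<close>
      define J where "J = {G \<in> \<G>. G x \<noteq> 0}"
      have m: "sign_match J (\<lambda>F. F x) (\<lambda>F. F y) \<psi>"
        using \<psi> by (rule sign_match_mono) (auto simp: J_def \<G>_def)
      have "sign_match_at_roots J (\<lambda>F. F x) (F x) (F y) \<psi>"
        unfolding sign_match_at_roots_def
      proof (intro ballI allI impI)
        fix G t assume G: "G \<in> J" "poly (G x) t = 0"
        define j where "j = degree (G x)"
        have j: "j \<le> n" "G \<in> \<G>" "G x \<noteq> 0" "G y \<noteq> 0" "degree (G y) = j"
          using G dn[of G] dg[of G] by (auto simp: J_def j_def)
        have "poly (G y) (\<psi> t) = 0"
          using sign_match_zero_iff[OF m G(1)] G by simp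
        then have "sgn (poly (F y) (\<psi> t)) = sgn (poly (R G j y) (\<psi> t))"
          by (intro R(2)) (use j in simp_all)
        moreover have "sgn (poly (F x) t) = sgn (poly (R G j x) t)"
          by (intro R(2)) (use j j_def G in simp_all)
        moreover have "R G j \<in> \<R>"
          using j(1,2) unfolding \<R>_def by force
        then have "sgn (poly (R G j x) t) = sgn (poly (R G j y) (\<psi> t))"
          using sign_matchD[OF \<psi>, of "R G j" t] by simp
        ultimately show "sgn (poly (F x) t) = sgn (poly (F y) (\<psi> t))"
          by simp
      qed
      note atr = this
      have "F' \<in> J"
      proof -
        have "degree (F x) \<noteq> 0"
          using 3 le_degree[of "F x" n] by auto
        then show ?thesis
          by (auto simp: J_def \<G>_def F'_def pderiv_eq_0_iff)
      qed
      have "finite J"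
        using fin by (auto simp: J_def \<G>_def)
      have nz: "G x \<noteq> 0" "G y \<noteq> 0" if "G \<in> J" for G
        using that dg(2)[of G] by (simp_all add: J_def)
      have "\<exists>\<theta>. sign_match J (\<lambda>F. F x) (\<lambda>F. F y) \<theta> \<and>
          (\<forall>t. sgn (poly (F x) t) = sgn (poly (F y) (\<theta> t)))"
      proof (rule sign_match_extend[OF \<open>finite J\<close> _ _ \<open>F' \<in> J\<close> _ _ m atr])
        show "G x \<noteq> 0" "G y \<noteq> 0" if "G \<in> J" for G
          by (rule nz[OF that])+
      qed (simp_all only: F'_def)
      then obtain \<theta> where \<theta>: "sign_match J (\<lambda>F. F x) (\<lambda>F. F y) \<theta>"
        "\<And>t. sgn (poly (F x) t) = sgn (poly (F y) (\<theta> t))"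
        by blast
      have "sgn (poly (G x) t) = sgn (poly (G y) (\<theta> t))" if "G \<in> insert F (\<A> \<union> \<B>)" for G t
      proof (cases "G = F")
        case False
        then have "G \<in> \<G>"
          using that by (simp add: \<G>_def)
        show ?thesis
        proof (cases "G x = 0")
          case True
          then show ?thesis
            using dg(2)[of G] \<open>G \<in> \<G>\<close> by simp
        next
          case False
          then have "G \<in> J"
            using \<open>G \<in> \<G>\<close> by (simp add: J_def)
          then show ?thesis
            using \<theta>(1) unfolding sign_match_def by blast
        qed
      qed (simp only: \<theta>(2))
      moreover have "strict_mono \<theta>" "surj \<theta>"
        using \<theta>(1) unfolding sign_match_def by blast+
      ultimately show ?thesis
        unfolding sign_match_def by blast
    qed
  qed
  moreover have "finite (D1 \<union> D2 \<union> D3)" "D1 \<union> D2 \<union> D3 \<subseteq> C"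
    using D1(1,2) D2(1,2) D3 by simp_all
  ultimately show ?thesis
    unfolding tame_def by (intro exI[of _ "D1 \<union> D2 \<union> D3"] conjI allI impI)
qed

text \<open>Outer induction on the formal length, inner induction on the set of members of top
  length. The inner claim quantifies over all families \<open>\<B>\<close> of shorter polynomials,
  because inserting one long polynomial enlarges that family.\<close>

theorem tame_ppoly:
  "finite \<F> \<Longrightarrow> (\<And>F. F \<in> \<F> \<Longrightarrow> ppoly n F) \<Longrightarrow> tame \<F>"
proof (induction n arbitrary: \<F>)
  case 0
  have z: "F x = 0" if "F \<in> \<F>" for F x
  proof -
    have "ppoly 0 F"
      by (rule "0.prems"(2)[OF that])
    then show ?thesis
      unfolding ppoly_def by (intro poly_eqI) simp
  qed
  have "sgn (poly (F x) t) = sgn (poly (F y) t)" if "F \<in> \<F>" for F x y t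
    using z[OF that, of x] z[OF that, of y] by simp
  then have "sign_match \<F> (\<lambda>F. F x) (\<lambda>F. F y) (\<lambda>t. t)" for x y
    unfolding sign_match_def strict_mono_def by (intro conjI ballI allI surj_id[unfolded id_def]) blast+
  then show ?case
    unfolding tame_def by (intro exI[of _ "{}"]) blast
next
  case (Suc n)
  have base: "tame \<B>" if "finite \<B>" "\<forall>F\<in>\<B>. ppoly n F" for \<B>
    by (rule Suc.IH[OF that(1)]) (rule that(2)[rule_format])
  have "\<forall>F\<in>\<F>. ppoly (Suc n) F"
    by (rule ballI) (rule Suc.prems(2))
  with Suc.prems(1) have "\<forall>\<B>. finite \<B> \<and> (\<forall>F\<in>\<B>. ppoly n F) \<longrightarrow> tame (\<F> \<union> \<B>)"
  proof (induction \<F> rule: finite_induct)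
    case empty
    show ?case
      using base by simp
  next
    case (insert F \<A>)
    show ?case
    proof (intro allI impI, elim conjE)
      fix \<B> assume \<B>: "finite \<B>" "\<forall>F\<in>\<B>. ppoly n F"
      have IH: "\<forall>\<B>. finite \<B> \<and> (\<forall>F\<in>\<B>. ppoly n F) \<longrightarrow> tame (\<A> \<union> \<B>)"
        by (rule insert.IH) (use insert.prems in blast)
      have "tame (insert F (\<A> \<union> \<B>))"
      proof (rule tame_insert[OF insert.hyps(1) \<B>(1)])
        show "tame (\<A> \<union> \<B>')" if "finite \<B>'" "\<And>G. G \<in> \<B>' \<Longrightarrow> ppoly n G" for \<B>'
          by (rule IH[rule_format], rule conjI[OF that(1)], rule ballI) (rule that(2))
        show "ppoly (Suc n) G" if "G \<in> \<A>" for G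
          by (rule insert.prems[rule_format]) (rule insertI2[OF that])
        show "ppoly n G" if "G \<in> \<B>" for G
          by (rule \<B>(2)[rule_format, OF that])
        show "ppoly (Suc n) F"
          by (rule insert.prems[rule_format]) (rule insertI1)
      qed
      then show "tame (insert F \<A> \<union> \<B>)" by simp
    qed
  qed
  then have "tame (\<F> \<union> {})"
    by (elim allE[of _ "{}"]) simp
  then show ?case
    by (simp only: Un_empty_right)
qed

end

section \<open>Polynomial functions and elimination of quantifiers\<close>

inductive_set polyfun :: "'v set \<Rightarrow> (('v \<Rightarrow> 'r::comm_ring_1) \<Rightarrow> 'r) set" for I where
  polyfun_const: "(\<lambda>x. a) \<in> polyfun I"
| polyfun_var: "i \<in> I \<Longrightarrow> (\<lambda>x. x i) \<in> polyfun I"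
| polyfun_add: "c \<in> polyfun I \<Longrightarrow> d \<in> polyfun I \<Longrightarrow> (\<lambda>x. c x + d x) \<in> polyfun I"
| polyfun_mult: "c \<in> polyfun I \<Longrightarrow> d \<in> polyfun I \<Longrightarrow> (\<lambda>x. c x * d x) \<in> polyfun I"

lemma polyfun_mono: "c \<in> polyfun I \<Longrightarrow> I \<subseteq> J \<Longrightarrow> c \<in> polyfun J"
  by (induction rule: polyfun.induct) (auto intro: polyfun.intros)

interpretation polyfun: function_algebra "polyfun I" for I :: "'v set"
  by unfold_locales (rule polyfun.intros; assumption)+

lemma polyfun_as_ppoly:
  fixes c :: "('v \<Rightarrow> 'r::real_closed_field) \<Rightarrow> 'r"
  assumes "c \<in> polyfun UNIV"
  shows "\<exists>n F. polyfun.ppoly UNIV n F \<and> (\<forall>x t. poly (F x) t = c (x(k := t)))"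
  using assms
proof (induction rule: polyfun.induct)
  case (polyfun_const a)
  show ?case
    by (intro exI[of _ 1] exI[of _ "\<lambda>x. [:a:]"] conjI polyfun.ppoly_const polyfun.const_closed) auto
next
  case (polyfun_var i)
  show ?case
  proof (cases "i = k")
    case True
    then show ?thesis
      by (intro exI[of _ 2] exI[of _ "\<lambda>x. [:0, 1:]"] conjI polyfun.ppoly_X) auto
  next
    case False
    then show ?thesis
      by (intro exI[of _ 1] exI[of _ "\<lambda>x. [:x i:]"] conjI polyfun.ppoly_const polyfun.intros) auto
  qed
next
  case (polyfun_add c d)
  then obtain n F m G where "polyfun.ppoly UNIV n F" "\<forall>x t. poly (F x) t = c (x(k := t))"
    "polyfun.ppoly UNIV m G" "\<forall>x t. poly (G x) t = d (x(k := t))"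
    by blast
  then show ?case
    by (intro exI[of _ "max n m"] exI[of _ "\<lambda>x. F x + G x"] conjI polyfun.ppoly_add) (auto simp only: poly_add)
next
  case (polyfun_mult c d)
  then obtain n F m G where "polyfun.ppoly UNIV n F" "\<forall>x t. poly (F x) t = c (x(k := t))"
    "polyfun.ppoly UNIV m G" "\<forall>x t. poly (G x) t = d (x(k := t))"
    by blast
  then show ?case
    by (intro exI[of _ "n + m"] exI[of _ "\<lambda>x. F x * G x"] conjI polyfun.ppoly_mult) (auto simp only: poly_mult)
qed

text \<open>\<open>P\<close> only depends on the signs of finitely many polynomials; as there are finitely many sign
  patterns, this is the usual notion of a semialgebraic set.\<close>

definition semialg :: "(('v \<Rightarrow> 'r::real_closed_field) \<Rightarrow> bool) \<Rightarrow> bool" where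
  "semialg P \<longleftrightarrow> (\<exists>D. finite D \<and> D \<subseteq> polyfun UNIV \<and>
    (\<forall>x y. polyfun.same_signs D x y \<longrightarrow> P x = P y))"

lemma semialg_conj:
  assumes "semialg P" "semialg Q"
  shows "semialg (\<lambda>x. P x \<and> Q x)"
proof -
  obtain D E where D: "finite D" "D \<subseteq> polyfun UNIV" "\<And>x y. polyfun.same_signs D x y \<Longrightarrow> P x = P y"
    and E: "finite E" "E \<subseteq> polyfun UNIV" "\<And>x y. polyfun.same_signs E x y \<Longrightarrow> Q x = Q y"
    using assms unfolding semialg_def by metis
  have "(P x \<and> Q x) = (P y \<and> Q y)" if "polyfun.same_signs (D \<union> E) x y" for x y
    using that D(3)[of x y] E(3)[of x y] by (auto simp: polyfun.same_signs_def)
  then show ?thesis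
    unfolding semialg_def using D E by (intro exI[of _ "D \<union> E"]) auto
qed

lemma semialg_not: "semialg P \<Longrightarrow> semialg (\<lambda>x. \<not> P x)"
  unfolding semialg_def by metis

lemma semialg_const: "semialg (\<lambda>x. b)"
  unfolding semialg_def by (intro exI[of _ "{}"]) auto

lemma semialg_ball: "finite I \<Longrightarrow> (\<And>i. i \<in> I \<Longrightarrow> semialg (P i)) \<Longrightarrow> semialg (\<lambda>x. \<forall>i\<in>I. P i x)"
  by (induction I rule: finite_induct) (auto intro: semialg_const semialg_conj)

lemma semialg_sgn:
  assumes "c \<in> polyfun I"
  shows "semialg (\<lambda>x. Q (sgn (c x)))"
  unfolding semialg_def using polyfun_mono[OF assms subset_UNIV]
  by (intro exI[of _ "{c}"]) (auto simp: polyfun.same_signs_def)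

lemma semialg_le:
  assumes "c \<in> polyfun I" "d \<in> polyfun I"
  shows "semialg (\<lambda>x. c x \<le> d x)"
proof -
  have "0 \<le> sgn (d x - c x) \<longleftrightarrow> c x \<le> d x" for x
    by (auto simp: sgn_if)
  then show ?thesis
    using semialg_sgn[OF polyfun.diff_closed[OF assms(2,1)], of "\<lambda>s. s \<ge> 0"] by (simp only:)
qed

lemma semialg_less: "c \<in> polyfun I \<Longrightarrow> d \<in> polyfun I \<Longrightarrow> semialg (\<lambda>x. c x < d x)"
  using semialg_not[OF semialg_le[of d I c]] by (simp add: not_le)

lemma semialg_eq: "c \<in> polyfun I \<Longrightarrow> d \<in> polyfun I \<Longrightarrow> semialg (\<lambda>x. c x = d x)"
  using semialg_conj[OF semialg_le[of c I d] semialg_le[of d I c]] by (simp add: order_eq_iff)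

lemma finite_polyfuns_as_ppoly:
  fixes D :: "(('v \<Rightarrow> 'r::real_closed_field) \<Rightarrow> 'r) set"
  assumes "finite D" "D \<subseteq> polyfun UNIV"
  obtains N F where "\<forall>c\<in>D. polyfun.ppoly UNIV N (F c)"
    "\<forall>c\<in>D. \<forall>x t. poly (F c x) t = c (x(k := t))"
proof -
  have "\<forall>c\<in>D. \<exists>nF. polyfun.ppoly UNIV (fst nF) (snd nF) \<and> (\<forall>x t. poly (snd nF x) t = c (x(k := t)))"
    using assms(2) polyfun_as_ppoly by fastforce
  from bchoice[OF this] obtain G where G: "\<forall>c\<in>D. polyfun.ppoly UNIV (fst (G c)) (snd (G c)) \<and>
    (\<forall>x t. poly (snd (G c) x) t = c (x(k := t)))"
    by blast
  have "polyfun.ppoly UNIV (\<Sum>c\<in>D. fst (G c)) (snd (G c))" if "c \<in> D" for c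
    by (rule polyfun.ppoly_mono[of _ "fst (G c)"]) (use G assms(1) that in \<open>auto intro!: member_le_sum\<close>)
  then show ?thesis
    using G that[of "\<Sum>c\<in>D. fst (G c)" "\<lambda>c. snd (G c)"] by blast
qed

text \<open>Tarski-Seidenberg for one variable: the order automorphism sends a witness at
  \<open>x\<close> to a witness at \<open>y\<close>, and every witness at \<open>y\<close> arises in
  this way by surjectivity.\<close>

theorem semialg_ex:
  fixes P :: "('v \<Rightarrow> 'r::real_closed_field) \<Rightarrow> bool"
  assumes "semialg P"
  shows "semialg (\<lambda>x. \<exists>t. P (x(k := t)))"
proof -
  obtain D where D: "finite D" "D \<subseteq> polyfun UNIV" "\<And>x y. polyfun.same_signs D x y \<Longrightarrow> P x = P y"
    using assms unfolding semialg_def by metis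
  obtain N F where F: "\<forall>c\<in>D. polyfun.ppoly UNIV N (F c)"
    "\<forall>c\<in>D. \<forall>x t. poly (F c x) t = c (x(k := t))"
    using finite_polyfuns_as_ppoly[OF D(1,2)] .
  have "polyfun.tame UNIV (F ` D)"
    by (rule polyfun.tame_ppoly[where n = N]) (use D(1) F(1) in auto)
  then obtain E where E: "finite E" "E \<subseteq> polyfun UNIV" "\<And>x y. polyfun.same_signs E x y \<Longrightarrow>
    \<exists>\<phi>. sign_match (F ` D) (\<lambda>F. F x) (\<lambda>F. F y) \<phi>"
    unfolding polyfun.tame_def by blast
  have "(\<exists>t. P (x(k := t))) = (\<exists>t. P (y(k := t)))" if xy: "polyfun.same_signs E x y" for x y
  proof -
    obtain \<phi> where \<phi>: "sign_match (F ` D) (\<lambda>F. F x) (\<lambda>F. F y) \<phi>"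
      using E(3)[OF xy] by blast
    have "polyfun.same_signs D (x(k := t)) (y(k := \<phi> t))" for t
      unfolding polyfun.same_signs_def
    proof
      fix c assume "c \<in> D"
      then show "sgn (c (x(k := t))) = sgn (c (y(k := \<phi> t)))"
        using sign_matchD[OF \<phi>, of "F c" t] F(2)[rule_format] by simp
    qed
    then have P: "P (x(k := t)) = P (y(k := \<phi> t))" for t
      by (rule D(3))
    have "surj \<phi>"
      using \<phi> by (simp add: sign_match_def)
    then show ?thesis
      using P by (metis surjD)
  qed
  then show ?thesis
    unfolding semialg_def using E by blast
qed

text \<open>Along the line the truth value changes only at zeros of finitely many nonzero
  polynomials, so the infimum can be found among finitely many candidates: it is the largest lower
  bound among those zeros and \<open>b\<close>.\<close>

lemma semialg_infimum:
  fixes P :: "('v \<Rightarrow> 'r::real_closed_field) \<Rightarrow> bool"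
  assumes "semialg P" and ne: "\<exists>t. P (x(k := t))" and lb: "\<And>t. P (x(k := t)) \<Longrightarrow> b \<le> t"
  shows "\<exists>m. (\<forall>t. P (x(k := t)) \<longrightarrow> m \<le> t) \<and> (\<forall>\<epsilon>>0. \<exists>t<m + \<epsilon>. P (x(k := t)))"
proof -
  obtain D where D: "finite D" "D \<subseteq> polyfun UNIV" "\<And>x y. polyfun.same_signs D x y \<Longrightarrow> P x = P y"
    using assms(1) unfolding semialg_def by metis
  obtain N F where "\<forall>c\<in>D. polyfun.ppoly UNIV N (F c)"
    and F': "\<forall>c\<in>D. \<forall>x t. poly (F c x) t = c (x(k := t))"
    using finite_polyfuns_as_ppoly[OF D(1,2)] .
  have F: "poly (F c x) t = c (x(k := t))" if "c \<in> D" for c t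
    using F' that by blast
  define Z where "Z = {t. \<exists>c\<in>D. F c x \<noteq> 0 \<and> poly (F c x) t = 0}"
  have "Z = (\<Union>c\<in>{c\<in>D. F c x \<noteq> 0}. {t. poly (F c x) t = 0})"
    by (auto simp: Z_def)
  then have "finite Z"
    using D(1) by (auto intro: poly_roots_finite)
  have gap: "P (x(k := s)) = P (x(k := t))" if "s \<le> t" and nz: "\<And>u. s \<le> u \<Longrightarrow> u \<le> t \<Longrightarrow> u \<notin> Z" for s t
  proof (rule D(3))
    have "sgn (poly (F c x) s) = sgn (poly (F c x) t)" if "c \<in> D" for c
    proof (cases "F c x = 0")
      case False
      show ?thesis
        using \<open>s \<le> t\<close> by (rule poly_sgn_const) (use that False nz in \<open>unfold Z_def, blast\<close>)
    qed simp
    then show "polyfun.same_signs D (x(k := s)) (x(k := t))"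
      by (auto simp: polyfun.same_signs_def F)
  qed
  let ?L = "{z \<in> insert b Z. \<forall>t. P (x(k := t)) \<longrightarrow> z \<le> t}"
  have "finite ?L"
    using \<open>finite Z\<close> by simp
  moreover have "b \<in> ?L"
    using lb by auto
  ultimately have "Max ?L \<in> ?L"
    by (intro Max_in) auto
  then obtain m where m: "m = Max ?L" "\<And>t. P (x(k := t)) \<Longrightarrow> m \<le> t"
    by auto
  have "\<exists>t<m + \<epsilon>. P (x(k := t))" if \<epsilon>: "\<epsilon> > 0" for \<epsilon>
  proof (rule ccontr)
    assume "\<not> (\<exists>t<m + \<epsilon>. P (x(k := t)))"
    then have n: "m + \<epsilon> \<le> t" if "P (x(k := t))" for t
      using that not_le by blast
    from finite_gap_right[OF \<open>finite Z\<close>, of m] show False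
    proof (elim disjE bexE conjE)
      fix v assume v: "v \<in> Z" "m < v" "\<forall>w\<in>Z. v \<le> w \<or> w \<le> m"
      obtain p where p: "m < p" "p < min (m + \<epsilon>) v"
        using dense[of m "min (m + \<epsilon>) v"] v \<epsilon> by auto
      have "v \<le> t" if t: "P (x(k := t))" for t
      proof (rule ccontr)
        assume "\<not> v \<le> t"
        then have "t < v" by simp
        have "p \<le> t"
          using n[OF t] p by simp
        then have "P (x(k := p)) = P (x(k := t))"
          using p \<open>t < v\<close> v(3) by (intro gap) force+
        then show False
          using n[of p] p t by simp
      qed
      then have "v \<in> ?L"
        using v by auto
      then have "v \<le> m"
        unfolding m(1) using \<open>finite ?L\<close> by (rule Max_ge[rotated])
      then show False
        using v by simp
    next
      assume v: "\<forall>w\<in>Z. w \<le> m"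
      obtain t where t: "P (x(k := t))"
        using ne by blast
      define p where "p = m + \<epsilon> / 2"
      have p: "m < p" "p < m + \<epsilon>"
        using \<epsilon> by (auto simp: p_def field_simps)
      then have "p \<le> t"
        using n[OF t] by simp
      then have "P (x(k := p)) = P (x(k := t))"
        using p v by (intro gap) force+
      then show False
        using n[of p] p t by simp
    qed
  qed
  then show ?thesis
    using m by blast
qed

section \<open>Semialgebraic compactness\<close>

text \<open>Distance is measured in the coordinates of \<open>I\<close> alone, so a closed predicate
  depends on no others. This allows points to be functions on the whole index type.\<close>

definition closed_on :: "'v set \<Rightarrow> (('v \<Rightarrow> 'r::linordered_field) \<Rightarrow> bool) \<Rightarrow> bool" where
  "closed_on I P \<longleftrightarrow> (\<forall>x. (\<forall>\<delta>>0. \<exists>y. P y \<and> (\<forall>i\<in>I. \<bar>x i - y i\<bar> < \<delta>)) \<longrightarrow> P x)"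

definition bounded_on :: "'v set \<Rightarrow> (('v \<Rightarrow> 'r::linordered_field) \<Rightarrow> bool) \<Rightarrow> bool" where
  "bounded_on I P \<longleftrightarrow> (\<exists>b. \<forall>x. P x \<longrightarrow> (\<forall>i\<in>I. \<bar>x i\<bar> \<le> b))"

definition compact_on :: "'v set \<Rightarrow> (('v \<Rightarrow> 'r::real_closed_field) \<Rightarrow> bool) \<Rightarrow> bool" where
  "compact_on I P \<longleftrightarrow> semialg P \<and> closed_on I P \<and> bounded_on I P"

definition ex_on :: "'v set \<Rightarrow> (('v \<Rightarrow> 'r) \<Rightarrow> bool) \<Rightarrow> ('v \<Rightarrow> 'r) \<Rightarrow> bool" where
  "ex_on J P x \<longleftrightarrow> (\<exists>y. (\<forall>i. i \<notin> J \<longrightarrow> y i = x i) \<and> P y)"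

lemma closed_onD:
  assumes "closed_on I P" "\<And>\<delta>. \<delta> > 0 \<Longrightarrow> \<exists>y. P y \<and> (\<forall>i\<in>I. \<bar>x i - y i\<bar> < \<delta>)"
  shows "P x"
  using assms unfolding closed_on_def by blast

lemma closed_on_cong:
  assumes "closed_on I P" "\<And>i. i \<in> I \<Longrightarrow> x i = y i" "P x"
  shows "P y"
  by (rule closed_onD[OF assms(1)]) (use assms(2,3) in \<open>intro exI[of _ x], simp\<close>)

lemma ex_onI: "\<forall>i. i \<notin> J \<longrightarrow> y i = x i \<Longrightarrow> P y \<Longrightarrow> ex_on J P x"
  unfolding ex_on_def by (intro exI[of _ y] conjI)

lemma ex_on_empty: "ex_on {} P = P" for P :: "('v \<Rightarrow> 'r) \<Rightarrow> bool"
proof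
  fix x :: "'v \<Rightarrow> 'r"
  have "y = x" if "\<forall>i. i \<notin> {} \<longrightarrow> y i = x i" for y
    using that by (intro ext) simp
  then show "ex_on {} P x = P x"
    unfolding ex_on_def by blast
qed

lemma ex_on_insert:
  fixes P :: "('v \<Rightarrow> 'r) \<Rightarrow> bool"
  assumes "k \<notin> J"
  shows "ex_on (insert k J) P = (\<lambda>x. \<exists>t. ex_on J P (x(k := t)))"
proof
  fix x :: "'v \<Rightarrow> 'r"
  show "ex_on (insert k J) P x = (\<exists>t. ex_on J P (x(k := t)))"
  proof
    assume "ex_on (insert k J) P x"
    then obtain y where y: "\<forall>i. i \<notin> insert k J \<longrightarrow> y i = x i" "P y"
      unfolding ex_on_def by blast
    have "\<forall>i. i \<notin> J \<longrightarrow> y i = (x(k := y k)) i"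
      using y(1) by simp
    then show "\<exists>t. ex_on J P (x(k := t))"
      unfolding ex_on_def using y(2) by blast
  next
    assume "\<exists>t. ex_on J P (x(k := t))"
    then obtain t y where y: "\<forall>i. i \<notin> J \<longrightarrow> y i = (x(k := t)) i" "P y"
      unfolding ex_on_def by blast
    then have "\<forall>i. i \<notin> insert k J \<longrightarrow> y i = x i"
      by simp
    then show "ex_on (insert k J) P x"
      unfolding ex_on_def using y(2) by blast
  qed
qed

lemma semialg_ex_on: "finite J \<Longrightarrow> semialg P \<Longrightarrow> semialg (ex_on J P)"
proof (induction J rule: finite_induct)
  case empty
  then show ?case by (simp only: ex_on_empty)
next
  case (insert k J)
  then show ?case
    unfolding ex_on_insert[OF insert.hyps(2)] by (intro semialg_ex)
qed

lemma semialg_abs_le: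
  assumes "c \<in> polyfun UNIV" "d \<in> polyfun UNIV"
  shows "semialg (\<lambda>x. \<bar>c x\<bar> \<le> d x)"
proof -
  have "(\<lambda>x. - c x) \<in> polyfun UNIV"
    using polyfun.diff_closed[OF polyfun.const_closed assms(1), of 0] by simp
  then show ?thesis
    unfolding abs_le_iff by (intro semialg_conj semialg_le[OF assms] semialg_le[OF _ assms(2)])
qed

text \<open>A point \<open>x\<close> in the closure of the projection is lifted by giving coordinate
  \<open>k\<close> the limit superior of the fibre coordinates over points near \<open>x\<close>.
  This is the infimum of all \<open>w\<close> that bound these coordinates within some radius; the
  set of such \<open>w\<close> is semialgebraic, so the infimum exists.\<close>

lemma compact_on_project:
  fixes P :: "('v \<Rightarrow> 'r::real_closed_field) \<Rightarrow> bool"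
  assumes inf: "infinite (UNIV :: 'v set)" and fin: "finite I" and k: "k \<notin> I"
    and P: "compact_on (insert k I) P"
  shows "compact_on I (\<lambda>x. \<exists>t. P (x(k := t)))"
proof -
  have sP: "semialg P" and cP: "closed_on (insert k I) P"
    using P unfolding compact_on_def by simp_all
  obtain b where b: "\<And>x i. P x \<Longrightarrow> i \<in> insert k I \<Longrightarrow> \<bar>x i\<bar> \<le> b"
    using P unfolding compact_on_def bounded_on_def by blast
  have "bounded_on I (\<lambda>x. \<exists>t. P (x(k := t)))"
    unfolding bounded_on_def
  proof (intro exI[of _ b] allI impI ballI, elim exE)
    fix x i t assume "i \<in> I" "P (x(k := t))"
    then show "\<bar>x i\<bar> \<le> b"
      using b[of "x(k := t)" i] k by (cases "i = k") simp_all
  qed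
  moreover have "closed_on I (\<lambda>x. \<exists>t. P (x(k := t)))"
    unfolding closed_on_def
  proof (intro allI impI)
    fix x :: "'v \<Rightarrow> 'r"
    assume x: "\<forall>\<delta>>0. \<exists>y. (\<exists>t. P (y(k := t))) \<and> (\<forall>i\<in>I. \<bar>x i - y i\<bar> < \<delta>)"
    obtain a where a: "a \<notin> insert k I"
      using ex_new_if_finite[OF inf, of "insert k I"] fin by auto
    obtain u where u: "u \<notin> insert a (insert k I)"
      using ex_new_if_finite[OF inf, of "insert a (insert k I)"] fin by auto
    define B where "B \<tau> y t \<longleftrightarrow> P (y(k := t)) \<and> (\<forall>i\<in>I. \<bar>x i - y i\<bar> \<le> \<tau>)" for \<tau> y t
    \<comment> \<open>The spare variable \<open>a\<close> holds the radius and \<open>u\<close> the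
      candidate bound \<open>w\<close>, so that \<open>W\<close> becomes a semialgebraic predicate:
      some positive radius has no fibre coordinate above \<open>w\<close>.\<close>
    define Q where "Q E \<longleftrightarrow> P E \<and> (\<forall>i\<in>I. \<bar>x i - E i\<bar> \<le> E a) \<and> E u < E k" for E
    define W where "W E \<longleftrightarrow> (\<exists>\<tau>. (E(a := \<tau>)) a > 0 \<and> \<not> ex_on (insert k I) Q (E(a := \<tau>)))" for E
    note var = polyfun_var[of _ "UNIV :: 'v set", OF UNIV_I]
    have near: "semialg (\<lambda>E. \<bar>x i - E i\<bar> \<le> E a)" for i
    proof (rule semialg_abs_le)
      show "(\<lambda>E. x i - E i) \<in> polyfun UNIV"
        by (rule polyfun.diff_closed[OF polyfun.const_closed var])
    qed (rule var)
    have all_near: "semialg (\<lambda>E. \<forall>i\<in>I. \<bar>x i - E i\<bar> \<le> E a)"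
      by (rule semialg_ball[OF fin near])
    have less: "semialg (\<lambda>E :: 'v \<Rightarrow> 'r. E u < E k)"
      by (rule semialg_less[OF var var])
    have "semialg Q"
      unfolding Q_def by (rule semialg_conj[OF sP semialg_conj[OF all_near less]])
    then have "semialg (ex_on (insert k I) Q)"
      using fin by (intro semialg_ex_on) simp_all
    then have "semialg (\<lambda>E :: 'v \<Rightarrow> 'r. 0 < E a \<and> \<not> ex_on (insert k I) Q E)"
      by (rule semialg_conj[OF semialg_less[OF polyfun.const_closed var] semialg_not])
    from semialg_ex[OF this, of a] have "semialg W"
      unfolding W_def by simp
    have W: "W (E(u := w)) \<longleftrightarrow> (\<exists>\<tau>>0. \<forall>y t. B \<tau> y t \<longrightarrow> t \<le> w)" for E w
    proof -
      have "ex_on (insert k I) Q (E(u := w, a := \<tau>)) \<longleftrightarrow> (\<exists>y t. B \<tau> y t \<and> w < t)" for \<tau>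
      proof
        assume "ex_on (insert k I) Q (E(u := w, a := \<tau>))"
        then obtain y where y: "\<forall>i. i \<notin> insert k I \<longrightarrow> y i = (E(u := w, a := \<tau>)) i" "Q y"
          unfolding ex_on_def by blast
        have "y a = \<tau>" "y u = w"
          using y(1)[rule_format, of a] y(1)[rule_format, of u] a u by simp_all
        then have "B \<tau> y (y k)" "w < y k"
          using y(2) unfolding Q_def B_def by simp_all
        then show "\<exists>y t. B \<tau> y t \<and> w < t" by blast
      next
        assume "\<exists>y t. B \<tau> y t \<and> w < t"
        then obtain y t where y: "B \<tau> y t" "w < t" by blast
        define z where "z i = (if i \<in> I then y i else if i = k then t else (E(u := w, a := \<tau>)) i)" for i
        have z: "z i = y i" if "i \<in> I" for i
          using that by (simp add: z_def)
        have zk: "z k = t" "z a = \<tau>" "z u = w"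
          using k a u by (simp_all add: z_def)
        have "P (y(k := t))"
          using y(1) by (simp add: B_def)
        have "P z"
        proof (rule closed_on_cong[OF cP _ \<open>P (y(k := t))\<close>])
          fix i assume "i \<in> insert k I"
          then show "(y(k := t)) i = z i"
            using k z[of i] zk(1) by (cases "i = k") simp_all
        qed
        then have "Q z"
          using y zk z unfolding Q_def B_def by simp
        moreover have "\<forall>i. i \<notin> insert k I \<longrightarrow> z i = (E(u := w, a := \<tau>)) i"
          by (simp add: z_def)
        ultimately show "ex_on (insert k I) Q (E(u := w, a := \<tau>))"
          by (rule ex_onI[rotated])
      qed
      then show ?thesis
        unfolding W_def fun_upd_same by (simp only:) (meson not_less)
    qed
    define E where "E = (\<lambda>i :: 'v. 0 :: 'r)"
    have "W (E(u := b))"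
      unfolding W
    proof (intro exI[of _ 1] conjI allI impI)
      fix y t assume "B 1 y t"
      then have "\<bar>t\<bar> \<le> b"
        using b[of "y(k := t)" k] by (simp add: B_def)
      then show "t \<le> b" by simp
    qed simp
    then have ne: "\<exists>w. W (E(u := w))" by blast
    have lb: "- b \<le> w" if w: "W (E(u := w))" for w
    proof -
      obtain \<tau> where \<tau>: "\<tau> > 0" "\<forall>y t. B \<tau> y t \<longrightarrow> t \<le> w"
        using w unfolding W by blast
      obtain y t where y: "P (y(k := t))" "\<forall>i\<in>I. \<bar>x i - y i\<bar> < \<tau>"
        using x \<tau>(1) by blast
      have "B \<tau> y t"
        unfolding B_def using y by (simp add: less_imp_le)
      then have "t \<le> w" using \<tau> by blast
      moreover have "\<bar>t\<bar> \<le> b"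
        using b[OF y(1), of k] by simp
      ultimately show ?thesis by simp
    qed
    obtain m where m: "\<forall>w. W (E(u := w)) \<longrightarrow> m \<le> w" "\<forall>\<epsilon>>0. \<exists>w<m + \<epsilon>. W (E(u := w))"
      using semialg_infimum[OF \<open>semialg W\<close> ne lb] by blast
    have "P (x(k := m))"
    proof (rule closed_onD[OF cP])
      fix \<delta> :: 'r assume \<delta>: "\<delta> > 0"
      obtain w where w: "w < m + \<delta>" "W (E(u := w))"
        using m(2) \<delta> by blast
      obtain \<tau> where \<tau>: "\<tau> > 0" "\<forall>y t. B \<tau> y t \<longrightarrow> t \<le> w"
        using w(2) unfolding W by blast
      define \<tau>' where "\<tau>' = min \<tau> (\<delta> / 2)"
      have \<tau>': "\<tau>' > 0" "\<tau>' \<le> \<tau>" "\<tau>' < \<delta>"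
        using \<tau> \<delta> by (auto simp: \<tau>'_def min_less_iff_disj)
      \<comment> \<open>\<open>m - \<delta>\<close> bounds the fibre coordinates within no radius,
        whereas \<open>w < m + \<delta>\<close> bounds them within \<open>\<tau>\<close>. So some
        point within \<open>\<tau>'\<close> has a fibre coordinate that differs from
        \<open>m\<close> by less than \<open>\<delta>\<close>.\<close>
      have "\<not> W (E(u := m - \<delta>))"
        using m(1) \<delta> by force
      then obtain y t where y: "B \<tau>' y t" "m - \<delta> < t"
        unfolding W using \<tau>'(1) not_le by blast
      have "B \<tau> y t"
        using y(1) \<tau>'(2) unfolding B_def by (meson order_trans)
      then have "t \<le> w" using \<tau> by blast
      then have "\<bar>m - t\<bar> < \<delta>"
        using w y by (simp add: abs_less_iff)
      then have "\<forall>i\<in>insert k I. \<bar>(x(k := m)) i - (y(k := t)) i\<bar> < \<delta>"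
        using y(1) \<tau>'(3) k unfolding B_def by fastforce
      then show "\<exists>z. P z \<and> (\<forall>i\<in>insert k I. \<bar>(x(k := m)) i - z i\<bar> < \<delta>)"
        using y(1) unfolding B_def by blast
    qed
    then show "\<exists>t. P (x(k := t))" ..
  qed
  ultimately show ?thesis
    unfolding compact_on_def using semialg_ex[OF sP] by blast
qed

lemma compact_on_ex_on:
  fixes P :: "('v \<Rightarrow> 'r::real_closed_field) \<Rightarrow> bool"
  assumes inf: "infinite (UNIV :: 'v set)"
  shows "finite J \<Longrightarrow> finite I \<Longrightarrow> I \<inter> J = {} \<Longrightarrow> compact_on (I \<union> J) P \<Longrightarrow> compact_on I (ex_on J P)"
proof (induction J arbitrary: I rule: finite_induct)
  case empty
  then show ?case by (simp only: ex_on_empty Un_empty_right)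
next
  case (insert k J)
  have "compact_on (insert k I) (ex_on J P)"
    by (rule insert.IH) (use insert in auto)
  then show ?case
    unfolding ex_on_insert[OF insert.hyps(2)]
    by (intro compact_on_project[OF inf]) (use insert in auto)
qed

section \<open>Closed and bounded predicates; continuity of polynomial functions\<close>

lemma closed_on_mono: "closed_on I P \<Longrightarrow> I \<subseteq> J \<Longrightarrow> closed_on J P"
  unfolding closed_on_def by (meson subsetD)

lemma closed_on_all:
  assumes "\<And>z. closed_on I (P z)"
  shows "closed_on I (\<lambda>x. \<forall>z. P z x)"
  unfolding closed_on_def
proof (intro allI impI)
  fix x z assume "\<forall>\<delta>>0. \<exists>y. (\<forall>z. P z y) \<and> (\<forall>i\<in>I. \<bar>x i - y i\<bar> < \<delta>)"
  then show "P z x"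
    by (intro closed_onD[OF assms]) blast
qed

lemma closed_on_conj:
  assumes "closed_on I P" "closed_on I Q"
  shows "closed_on I (\<lambda>x. P x \<and> Q x)"
  using closed_on_all[of I "\<lambda>b. if b then P else Q"] assms
  by (simp add: all_bool_eq conj_commute)

lemma closed_on_imp_const: "closed_on I P \<Longrightarrow> closed_on I (\<lambda>x. b \<longrightarrow> P x)"
  by (cases b) (simp_all add: closed_on_def)

lemma closed_on_ball:
  assumes "\<And>z. z \<in> A \<Longrightarrow> closed_on I (P z)"
  shows "closed_on I (\<lambda>x. \<forall>z\<in>A. P z x)"
  unfolding Ball_def
proof (rule closed_on_all)
  show "closed_on I (\<lambda>x. z \<in> A \<longrightarrow> P z x)" for z
  proof (cases "z \<in> A")
    case True
    show ?thesis
      by (rule closed_on_imp_const[OF assms[OF True]])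
  next
    case False
    then show ?thesis
      unfolding closed_on_def by blast
  qed
qed

lemma bounded_on_mono: "bounded_on I P \<Longrightarrow> (\<And>x. Q x \<Longrightarrow> P x) \<Longrightarrow> bounded_on I Q"
  unfolding bounded_on_def by blast

lemma bounded_on_Un:
  assumes "bounded_on I P" "bounded_on J P"
  shows "bounded_on (I \<union> J) P"
proof -
  obtain b c where "\<forall>x. P x \<longrightarrow> (\<forall>i\<in>I. \<bar>x i\<bar> \<le> b)" "\<forall>x. P x \<longrightarrow> (\<forall>i\<in>J. \<bar>x i\<bar> \<le> c)"
    using assms unfolding bounded_on_def by blast
  then have "\<forall>x. P x \<longrightarrow> (\<forall>i\<in>I \<union> J. \<bar>x i\<bar> \<le> max b c)"
    by (meson UnE le_max_iff_disj)
  then show ?thesis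
    unfolding bounded_on_def by blast
qed

lemma bounded_on_UN:
  "finite A \<Longrightarrow> (\<And>k. k \<in> A \<Longrightarrow> bounded_on (I k) P) \<Longrightarrow> bounded_on (\<Union>k\<in>A. I k) P"
proof (induction A rule: finite_induct)
  case empty
  then show ?case by (simp add: bounded_on_def)
next
  case (insert k A)
  have "bounded_on (I k \<union> (\<Union>k\<in>A. I k)) P"
    by (rule bounded_on_Un) (use insert in simp_all)
  then show ?case by simp
qed

lemma polyfun_continuous:
  fixes c :: "('v \<Rightarrow> 'r::linordered_field) \<Rightarrow> 'r"
  assumes "c \<in> polyfun I" "\<epsilon> > 0"
  shows "\<exists>\<delta>>0. \<forall>y. (\<forall>i\<in>I. \<bar>x i - y i\<bar> < \<delta>) \<longrightarrow> \<bar>c x - c y\<bar> < \<epsilon>"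
  using assms
proof (induction arbitrary: \<epsilon> rule: polyfun.induct)
  case (polyfun_const a)
  then show ?case by (intro exI[of _ 1]) simp
next
  case (polyfun_var i)
  then show ?case by (intro exI[of _ \<epsilon>]) blast
next
  case (polyfun_add c d)
  have "\<epsilon> / 2 > 0" using polyfun_add by simp
  then obtain \<delta>1 \<delta>2 where \<delta>: "\<delta>1 > 0" "\<forall>y. (\<forall>i\<in>I. \<bar>x i - y i\<bar> < \<delta>1) \<longrightarrow> \<bar>c x - c y\<bar> < \<epsilon> / 2"
    "\<delta>2 > 0" "\<forall>y. (\<forall>i\<in>I. \<bar>x i - y i\<bar> < \<delta>2) \<longrightarrow> \<bar>d x - d y\<bar> < \<epsilon> / 2"
    using polyfun_add.IH by metis
  have "\<bar>c x + d x - (c y + d y)\<bar> < \<epsilon>" if "\<forall>i\<in>I. \<bar>x i - y i\<bar> < min \<delta>1 \<delta>2" for y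
  proof -
    have "\<bar>c x - c y\<bar> < \<epsilon> / 2" "\<bar>d x - d y\<bar> < \<epsilon> / 2"
      using \<delta> that by simp_all
    moreover have "\<bar>c x + d x - (c y + d y)\<bar> \<le> \<bar>c x - c y\<bar> + \<bar>d x - d y\<bar>"
      using abs_triangle_ineq[of "c x - c y" "d x - d y"] by (simp add: algebra_simps)
    ultimately show ?thesis by simp
  qed
  then show ?case
    using \<delta> by (intro exI[of _ "min \<delta>1 \<delta>2"]) simp
next
  case (polyfun_mult c d)
  \<comment> \<open>The cap 1 in \<open>\<beta>\<close> keeps \<open>d y\<close> bounded by
    \<open>|d x| + 1\<close> in absolute value; the other constants make each of the two terms of
    the product estimate at most \<open>\<epsilon> / 2\<close>.\<close>
  define \<alpha> \<beta> where "\<alpha> = \<epsilon> / (2 * (\<bar>d x\<bar> + 1))" and "\<beta> = min 1 (\<epsilon> / (2 * (\<bar>c x\<bar> + 1)))"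
  have p: "\<bar>d x\<bar> + 1 > 0" "\<bar>c x\<bar> + 1 > 0"
    by (simp_all add: add_nonneg_pos)
  then have \<alpha>\<beta>: "\<alpha> > 0" "\<beta> > 0"
    using polyfun_mult.prems by (simp_all add: \<alpha>_def \<beta>_def)
  obtain \<delta>1 \<delta>2 where \<delta>: "\<delta>1 > 0" "\<forall>y. (\<forall>i\<in>I. \<bar>x i - y i\<bar> < \<delta>1) \<longrightarrow> \<bar>c x - c y\<bar> < \<alpha>"
    "\<delta>2 > 0" "\<forall>y. (\<forall>i\<in>I. \<bar>x i - y i\<bar> < \<delta>2) \<longrightarrow> \<bar>d x - d y\<bar> < \<beta>"
    using polyfun_mult.IH(1)[OF \<alpha>\<beta>(1)] polyfun_mult.IH(2)[OF \<alpha>\<beta>(2)] by metis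
  have "\<bar>c x * d x - c y * d y\<bar> < \<epsilon>" if "\<forall>i\<in>I. \<bar>x i - y i\<bar> < min \<delta>1 \<delta>2" for y
  proof -
    have cd: "\<bar>c x - c y\<bar> < \<alpha>" "\<bar>d x - d y\<bar> < \<beta>"
      using \<delta> that by simp_all
    have "\<bar>d y\<bar> \<le> \<bar>d x\<bar> + 1"
      using cd(2) unfolding \<beta>_def by (simp add: abs_if split: if_splits)
    then have 1: "\<bar>c x - c y\<bar> * \<bar>d y\<bar> \<le> \<alpha> * (\<bar>d x\<bar> + 1)"
      using cd \<alpha>\<beta> by (intro mult_mono) auto
    have "\<bar>c x\<bar> * \<bar>d x - d y\<bar> \<le> \<bar>c x\<bar> * (\<epsilon> / (2 * (\<bar>c x\<bar> + 1)))"
      using cd unfolding \<beta>_def by (intro mult_left_mono) auto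
    also have "\<dots> < (\<bar>c x\<bar> + 1) * (\<epsilon> / (2 * (\<bar>c x\<bar> + 1)))"
      using p polyfun_mult.prems by (intro mult_strict_right_mono) auto
    also have "\<dots> = \<epsilon> / 2"
      using p by (simp add: field_simps)
    finally have 2: "\<bar>c x\<bar> * \<bar>d x - d y\<bar> < \<epsilon> / 2" .
    have 3: "\<alpha> * (\<bar>d x\<bar> + 1) = \<epsilon> / 2"
      using p by (simp add: \<alpha>_def field_simps)
    have "c x * d x - c y * d y = c x * (d x - d y) + (c x - c y) * d y"
      by (simp add: algebra_simps)
    then have "\<bar>c x * d x - c y * d y\<bar> \<le> \<bar>c x\<bar> * \<bar>d x - d y\<bar> + \<bar>c x - c y\<bar> * \<bar>d y\<bar>"
      using abs_triangle_ineq[of "c x * (d x - d y)" "(c x - c y) * d y"] by (simp add: abs_mult)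
    then show ?thesis
      using 1 2 3 by simp
  qed
  then show ?case
    using \<delta> by (intro exI[of _ "min \<delta>1 \<delta>2"]) simp
qed

lemma polyfun_bounded:
  fixes c :: "('v \<Rightarrow> 'r::linordered_field) \<Rightarrow> 'r"
  assumes "c \<in> polyfun I"
  shows "\<exists>B. \<forall>x. (\<forall>i\<in>I. \<bar>x i\<bar> \<le> b) \<longrightarrow> \<bar>c x\<bar> \<le> B"
  using assms
proof (induction rule: polyfun.induct)
  case (polyfun_const a)
  show ?case by (intro exI[of _ "\<bar>a\<bar>"]) simp
next
  case (polyfun_var i)
  then show ?case by blast
next
  case (polyfun_add c d)
  then obtain B1 B2 where B: "\<forall>x. (\<forall>i\<in>I. \<bar>x i\<bar> \<le> b) \<longrightarrow> \<bar>c x\<bar> \<le> B1"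
    "\<forall>x. (\<forall>i\<in>I. \<bar>x i\<bar> \<le> b) \<longrightarrow> \<bar>d x\<bar> \<le> B2"
    by blast
  have "\<bar>c x + d x\<bar> \<le> B1 + B2" if "\<forall>i\<in>I. \<bar>x i\<bar> \<le> b" for x
    using B that abs_triangle_ineq[of "c x" "d x"] by (meson add_mono order_trans)
  then show ?case by blast
next
  case (polyfun_mult c d)
  then obtain B1 B2 where B: "\<forall>x. (\<forall>i\<in>I. \<bar>x i\<bar> \<le> b) \<longrightarrow> \<bar>c x\<bar> \<le> B1"
    "\<forall>x. (\<forall>i\<in>I. \<bar>x i\<bar> \<le> b) \<longrightarrow> \<bar>d x\<bar> \<le> B2"
    by blast
  have "\<bar>c x * d x\<bar> \<le> B1 * B2" if "\<forall>i\<in>I. \<bar>x i\<bar> \<le> b" for x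
    unfolding abs_mult using B that by (meson abs_ge_zero mult_mono order_trans)
  then show ?case by blast
qed

lemma polyfun_cong:
  assumes "c \<in> polyfun I" "\<And>i. i \<in> I \<Longrightarrow> x i = y i"
  shows "c x = c y"
  using assms(1) by (induction rule: polyfun.induct) (use assms(2) in simp_all)

lemma closed_on_le:
  assumes c: "c \<in> polyfun I" and d: "d \<in> polyfun I"
  shows "closed_on I (\<lambda>x. c x \<le> d (x :: 'v \<Rightarrow> 'r::real_closed_field))"
  unfolding closed_on_def
proof (intro allI impI)
  fix x :: "'v \<Rightarrow> 'r"
  assume x: "\<forall>\<delta>>0. \<exists>y. c y \<le> d y \<and> (\<forall>i\<in>I. \<bar>x i - y i\<bar> < \<delta>)"
  show "c x \<le> d x"
  proof (rule ccontr)
    assume "\<not> c x \<le> d x"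
    then have "c x - d x > 0" by simp
    then obtain \<delta> where \<delta>: "\<delta> > 0"
      "\<forall>y. (\<forall>i\<in>I. \<bar>x i - y i\<bar> < \<delta>) \<longrightarrow> \<bar>(c x - d x) - (c y - d y)\<bar> < c x - d x"
      using polyfun_continuous[OF polyfun.diff_closed[OF c d], of "c x - d x" x] by blast
    obtain y where y: "c y \<le> d y" "\<forall>i\<in>I. \<bar>x i - y i\<bar> < \<delta>"
      using x \<delta>(1) by blast
    then have "\<bar>(c x - d x) - (c y - d y)\<bar> < c x - d x"
      using \<delta>(2) by blast
    then show False
      using y(1) by (simp add: abs_less_iff)
  qed
qed

lemma closed_on_eq:
  assumes "c \<in> polyfun I" "d \<in> polyfun I"
  shows "closed_on I (\<lambda>x. c x = d (x :: 'v \<Rightarrow> 'r::real_closed_field))"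
  using closed_on_conj[OF closed_on_le[OF assms] closed_on_le[OF assms(2,1)]]
  by (simp add: order_eq_iff)

text \<open>The graph of \<open>c\<close> over \<open>P\<close> is compact. Its projection to the
  spare coordinate \<open>u\<close> is a closed semialgebraic set of values that is bounded below,
  and so contains its infimum.\<close>

lemma compact_on_minimum:
  fixes P :: "('v \<Rightarrow> 'r::real_closed_field) \<Rightarrow> bool"
  assumes inf: "infinite (UNIV :: 'v set)" and fin: "finite I" and P: "compact_on I P"
    and ne: "\<exists>x. P x" and c: "c \<in> polyfun I"
  shows "\<exists>x. P x \<and> (\<forall>y. P y \<longrightarrow> c x \<le> c y)"
proof -
  obtain u where u: "u \<notin> I"
    using ex_new_if_finite[OF inf fin] by blast
  define Q where "Q x \<longleftrightarrow> P x \<and> x u = c x" for x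
  have sP: "semialg P" and cP: "closed_on I P" and bP: "bounded_on I P"
    using P unfolding compact_on_def by simp_all
  have c': "c \<in> polyfun (insert u I)" and u': "(\<lambda>x. x u) \<in> polyfun (insert u I)"
    by (rule polyfun_mono[OF c subset_insertI]) (rule polyfun_var[OF insertI1])
  obtain b where b: "\<forall>x. P x \<longrightarrow> (\<forall>i\<in>I. \<bar>x i\<bar> \<le> b)"
    using bP unfolding bounded_on_def by blast
  obtain B where B: "\<forall>x. (\<forall>i\<in>I. \<bar>x i\<bar> \<le> b) \<longrightarrow> \<bar>c x\<bar> \<le> B"
    using polyfun_bounded[OF c] by blast
  have "\<bar>x i\<bar> \<le> max b B" if "Q x" "i \<in> insert u I" for x i
    using that b B unfolding Q_def by (cases "i = u") (auto simp: le_max_iff_disj)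
  then have "bounded_on (insert u I) Q"
    unfolding bounded_on_def by blast
  moreover have "closed_on (insert u I) Q"
    unfolding Q_def
    by (intro closed_on_conj closed_on_eq c' u' closed_on_mono[OF cP] subset_insertI)
  moreover have "semialg Q"
    unfolding Q_def by (intro semialg_conj sP semialg_eq[OF u' c'])
  ultimately have "compact_on ({u} \<union> I) Q"
    unfolding compact_on_def by simp
  then have R: "compact_on {u} (ex_on I Q)"
    by (rule compact_on_ex_on[OF inf fin, rotated -1]) (use u in auto)
  have RQ: "ex_on I Q (E(u := t)) \<longleftrightarrow> (\<exists>x. P x \<and> c x = t)" for E t
  proof
    assume "ex_on I Q (E(u := t))"
    then obtain y where y: "\<forall>i. i \<notin> I \<longrightarrow> y i = (E(u := t)) i" "Q y"
      unfolding ex_on_def by blast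
    have "y u = t"
      using y(1)[rule_format, OF u] by simp
    then show "\<exists>x. P x \<and> c x = t"
      using y(2) unfolding Q_def by (intro exI[of _ y]) simp
  next
    assume "\<exists>x. P x \<and> c x = t"
    then obtain x where x: "P x" "c x = t" by blast
    define y where "y i = (if i \<in> I then x i else (E(u := t)) i)" for i
    have xy: "x i = y i" if "i \<in> I" for i
      using that by (simp add: y_def)
    have "P y" "c x = c y"
      by (rule closed_on_cong[OF cP xy x(1)], assumption) (rule polyfun_cong[OF c xy])
    moreover have "y u = t"
      using u by (simp add: y_def)
    ultimately have "Q y"
      using x unfolding Q_def by simp
    moreover have "\<forall>i. i \<notin> I \<longrightarrow> y i = (E(u := t)) i"
      by (simp add: y_def)
    ultimately show "ex_on I Q (E(u := t))"
      by (rule ex_onI[rotated])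
  qed
  define E where "E = (\<lambda>i :: 'v. 0 :: 'r)"
  have ne': "\<exists>t. ex_on I Q (E(u := t))"
    unfolding RQ using ne by blast
  have lb: "- B \<le> t" if "ex_on I Q (E(u := t))" for t
  proof -
    obtain x where "P x" "c x = t"
      using \<open>ex_on I Q (E(u := t))\<close> unfolding RQ by blast
    then have "\<bar>t\<bar> \<le> B"
      using b B by blast
    then show ?thesis
      by (simp add: abs_le_iff)
  qed
  have sR: "semialg (ex_on I Q)" and cR: "closed_on {u} (ex_on I Q)"
    using R unfolding compact_on_def by simp_all
  obtain m where m: "\<forall>t. ex_on I Q (E(u := t)) \<longrightarrow> m \<le> t"
    "\<forall>\<epsilon>>0. \<exists>t<m + \<epsilon>. ex_on I Q (E(u := t))"
    using semialg_infimum[OF sR ne' lb] by blast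
  have "ex_on I Q (E(u := m))"
  proof (rule closed_onD[OF cR])
    fix \<delta> :: 'r assume "\<delta> > 0"
    then obtain t where t: "t < m + \<delta>" "ex_on I Q (E(u := t))"
      using m(2) by blast
    moreover have "m \<le> t"
      using m(1) t(2) by blast
    ultimately have "\<forall>i\<in>{u}. \<bar>(E(u := m)) i - (E(u := t)) i\<bar> < \<delta>"
      by (simp add: abs_less_iff)
    then show "\<exists>y. ex_on I Q y \<and> (\<forall>i\<in>{u}. \<bar>(E(u := m)) i - y i\<bar> < \<delta>)"
      using t(2) by blast
  qed
  then obtain x where x: "P x" "c x = m"
    unfolding RQ by blast
  have "c x \<le> c y" if "P y" for y
    using m(1) that unfolding RQ x(2) by blast
  then show ?thesis
    using x(1) by blast
qed

lemma polyfun_rename: "c \<in> polyfun I \<Longrightarrow> (\<lambda>x. c (\<lambda>i. x (r i))) \<in> polyfun (r ` I)"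
  by (induction rule: polyfun.induct) (auto intro: polyfun.intros)

lemma semialg_rename:
  fixes P :: "('v \<Rightarrow> 'r::real_closed_field) \<Rightarrow> bool"
  assumes "semialg P"
  shows "semialg (\<lambda>x. P (\<lambda>i. x (r i)))"
proof -
  obtain D where D: "finite D" "D \<subseteq> polyfun UNIV" "\<And>x y. polyfun.same_signs D x y \<Longrightarrow> P x = P y"
    using assms unfolding semialg_def by blast
  define D' where "D' = (\<lambda>c x. c (\<lambda>i. x (r i))) ` D"
  have "finite D'" "D' \<subseteq> polyfun UNIV"
    using D(1,2) polyfun_mono[OF polyfun_rename subset_UNIV] unfolding D'_def by auto
  moreover have "P (\<lambda>i. x (r i)) = P (\<lambda>i. y (r i))" if "polyfun.same_signs D' x y" for x y
    using that unfolding D'_def polyfun.same_signs_def by (intro D(3)) (simp add: polyfun.same_signs_def)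
  ultimately show ?thesis
    unfolding semialg_def by blast
qed

lemma closed_on_rename:
  assumes "closed_on I P"
  shows "closed_on (r ` I) (\<lambda>x. P (\<lambda>i. x (r i)))"
  unfolding closed_on_def
proof (intro allI impI)
  fix x
  assume x: "\<forall>\<delta>>0. \<exists>y. P (\<lambda>i. y (r i)) \<and> (\<forall>i\<in>r ` I. \<bar>x i - y i\<bar> < \<delta>)"
  show "P (\<lambda>i. x (r i))"
    by (rule closed_onD[OF assms]) (use x in \<open>simp only: ball_simps, blast\<close>)
qed

lemma bounded_on_rename: "bounded_on I P \<Longrightarrow> bounded_on (r ` I) (\<lambda>x. P (\<lambda>i. x (r i)))"
  unfolding bounded_on_def by (simp only: ball_simps) blast

section \<open>Noetherian rings of polynomial functions\<close>

definition subring_set :: "'a::comm_ring_1 set \<Rightarrow> bool" where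
  "subring_set A \<longleftrightarrow> 0 \<in> A \<and> 1 \<in> A \<and> -1 \<in> A \<and> (\<forall>x\<in>A. \<forall>y\<in>A. x + y \<in> A \<and> x * y \<in> A)"

definition ideal_in :: "'a::comm_ring_1 set \<Rightarrow> 'a set \<Rightarrow> bool" where
  "ideal_in A J \<longleftrightarrow> J \<subseteq> A \<and> 0 \<in> J \<and> (\<forall>x\<in>J. \<forall>y\<in>J. x + y \<in> J) \<and> (\<forall>a\<in>A. \<forall>x\<in>J. a * x \<in> J)"

definition ascending_chain_condition :: "'a::comm_ring_1 set \<Rightarrow> bool" where
  "ascending_chain_condition A \<longleftrightarrow> (\<forall>I :: nat \<Rightarrow> 'a set.
    (\<forall>n. ideal_in A (I n)) \<and> (\<forall>n. I n \<subseteq> I (Suc n)) \<longrightarrow> (\<exists>m. \<forall>n\<ge>m. I n = I m))"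

text \<open>The ring generated by \<open>A\<close> and \<open>t\<close> inside the ambient ring;
  \<open>t\<close> may satisfy relations over \<open>A\<close>, so this is a quotient of the
  polynomial ring.\<close>

definition adjoin :: "'a::comm_ring_1 set \<Rightarrow> 'a \<Rightarrow> 'a set" where
  "adjoin A t = {poly p t | p. \<forall>i. coeff p i \<in> A}"

lemma subring_setD:
  assumes "subring_set A"
  shows "0 \<in> A" "1 \<in> A" "x \<in> A \<Longrightarrow> y \<in> A \<Longrightarrow> x + y \<in> A" "x \<in> A \<Longrightarrow> y \<in> A \<Longrightarrow> x * y \<in> A"
    "x \<in> A \<Longrightarrow> y \<in> A \<Longrightarrow> x - y \<in> A"
proof -
  show *: "0 \<in> A" "1 \<in> A" "x \<in> A \<Longrightarrow> y \<in> A \<Longrightarrow> x + y \<in> A" "x \<in> A \<Longrightarrow> y \<in> A \<Longrightarrow> x * y \<in> A" for x y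
    using assms unfolding subring_set_def by blast+
  have "-1 \<in> A"
    using assms unfolding subring_set_def by blast
  then show "x \<in> A \<Longrightarrow> y \<in> A \<Longrightarrow> x - y \<in> A"
    using *(3)[of x "-1 * y"] *(4)[of "-1" y] by simp
qed

lemma ideal_inD:
  assumes "ideal_in A J"
  shows "0 \<in> J" "x \<in> J \<Longrightarrow> y \<in> J \<Longrightarrow> x + y \<in> J" "a \<in> A \<Longrightarrow> x \<in> J \<Longrightarrow> a * x \<in> J" "J \<subseteq> A"
  using assms unfolding ideal_in_def by blast+

lemma adjoinI: "(\<And>i. coeff p i \<in> A) \<Longrightarrow> poly p t \<in> adjoin A t"
  unfolding adjoin_def by blast

lemma coeff_pCons_in: "a \<in> A \<Longrightarrow> (\<And>i. coeff p i \<in> A) \<Longrightarrow> coeff (pCons a p) i \<in> A"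
  by (cases i) simp_all

lemma adjoin_base: "subring_set A \<Longrightarrow> a \<in> A \<Longrightarrow> a \<in> adjoin A t"
  using adjoinI[of "[:a:]" A t] coeff_pCons_in[of a A 0] subring_setD(1)[of A] by simp

lemma adjoin_generator: "subring_set A \<Longrightarrow> t \<in> adjoin A t"
  using adjoinI[of "[:0, 1:]" A t] coeff_pCons_in[of 0 A "[:1:]"] coeff_pCons_in[of 1 A 0]
    subring_setD(1,2)[of A] by simp

text \<open>Leading coefficients are read off from polynomials that represent elements of the
  ideals, which also covers a \<open>t\<close> with relations. The ideals \<open>L n m\<close> grow
  in both indices: the diagonal stabilizes at some \<open>N\<close>, and the finitely many rows
  below \<open>N\<close> stabilize separately, so beyond one common \<open>m\<close> none of them
  changes.\<close>

theorem hilbert_basis: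
  fixes A :: "'a::comm_ring_1 set"
  assumes A: "subring_set A" and acc: "ascending_chain_condition A"
  shows "ascending_chain_condition (adjoin A t)"
  unfolding ascending_chain_condition_def
proof (intro allI impI, elim conjE)
  fix I :: "nat \<Rightarrow> 'a set"
  assume id: "\<forall>n. ideal_in (adjoin A t) (I n)" and inc: "\<forall>n. I n \<subseteq> I (Suc n)"
  note A_sub = adjoin_base[OF A, of _ t] and t = adjoin_generator[OF A, of t]
  note A = subring_setD[OF A]
  note id = ideal_inD[OF id[rule_format]]
  have mono: "I m \<subseteq> I n" if "m \<le> n" for m n
    by (rule lift_Suc_mono_le[of I m n]) (use inc that in blast)+
  define S where "S n m = {p. (\<forall>i. coeff p i \<in> A) \<and> (\<forall>i>n. coeff p i = 0) \<and> poly p t \<in> I m}" for n m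
  define L where "L n m = (\<lambda>p. coeff p n) ` S n m" for n m
  have LI: "ideal_in A (L n m)" for n m
    unfolding ideal_in_def
  proof (intro conjI ballI)
    show "L n m \<subseteq> A"
      unfolding L_def S_def by blast
    have "0 \<in> S n m"
      unfolding S_def using A(1) id(1) by simp
    then show "0 \<in> L n m"
      unfolding L_def by (rule image_eqI[rotated]) simp
  next
    fix x y assume "x \<in> L n m" "y \<in> L n m"
    then obtain p q where pq: "p \<in> S n m" "q \<in> S n m" "x = coeff p n" "y = coeff q n"
      unfolding L_def by blast
    then have "p + q \<in> S n m"
      unfolding S_def using A(3) id(2) by simp
    then show "x + y \<in> L n m"
      unfolding L_def by (rule image_eqI[rotated]) (simp add: pq)
  next
    fix a x assume a: "a \<in> A" and "x \<in> L n m"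
    then obtain p where p: "p \<in> S n m" "x = coeff p n"
      unfolding L_def by blast
    then have "smult a p \<in> S n m"
      unfolding S_def using A(4) id(3) a A_sub by simp
    then show "a * x \<in> L n m"
      unfolding L_def by (rule image_eqI[rotated]) (simp add: p)
  qed
  have Lm: "L n m \<subseteq> L n m'" if "m \<le> m'" for n m m'
    unfolding L_def S_def using mono[OF that] by blast
  have LSuc: "L n m \<subseteq> L (Suc n) m" for n m
  proof
    fix x assume "x \<in> L n m"
    then obtain p where p: "p \<in> S n m" "x = coeff p n"
      unfolding L_def by blast
    then have "pCons 0 p \<in> S (Suc n) m"
      unfolding S_def using A(1) id(3)[OF t] by (auto simp: coeff_pCons split: nat.splits)
    then show "x \<in> L (Suc n) m"
      unfolding L_def by (rule image_eqI[rotated]) (simp add: p)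
  qed
  have Ln: "L n m \<subseteq> L n' m" if "n \<le> n'" for n n' m
    by (rule lift_Suc_mono_le[of "\<lambda>n. L n m" n n']) (use LSuc that in blast)+
  have stab: "\<exists>m. \<forall>n\<ge>m. J n = J m" if "\<forall>n. ideal_in A (J n)" "\<forall>n. J n \<subseteq> J (Suc n)" for J :: "nat \<Rightarrow> 'a set"
    using acc that unfolding ascending_chain_condition_def by blast
  have "\<exists>m. \<forall>n\<ge>m. L n n = L m m"
    by (rule stab) (use LI Lm Ln le_SucI order_refl in \<open>meson subset_trans\<close>)+
  then obtain N where N: "\<forall>n\<ge>N. L n n = L N N" ..
  have "\<forall>n. \<exists>m. \<forall>k\<ge>m. L n k = L n m"
    by (intro allI stab LI Lm) simp
  then obtain M where M: "\<forall>n. \<forall>k\<ge>M n. L n k = L n (M n)"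
    by (rule choice[THEN exE])
  define m where "m = Max (insert N (M ` {..<N}))"
  have "N \<le> m" and Mm: "n < N \<Longrightarrow> M n \<le> m" for n
    unfolding m_def by (auto intro!: Max_ge)
  have big: "L n k = L N N" if "N \<le> n" "N \<le> k" for n k
  proof
    have "L n k \<subseteq> L (max n k) (max n k)"
      using Lm[of k "max n k" n] Ln[of n "max n k" "max n k"] by simp
    then show "L n k \<subseteq> L N N"
      using N[rule_format, of "max n k"] that by simp
    show "L N N \<subseteq> L n k"
      using Lm[of N k N] Ln[of N n k] that by simp
  qed
  have eq: "L n k = L n m" if "m \<le> k" for n k
  proof (cases "N \<le> n")
    case True
    have "L n k = L N N" "L n m = L N N"
      by (rule big[OF True]; use \<open>N \<le> m\<close> that in simp)+
    then show ?thesis by simp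
  next
    case False
    then have "M n \<le> m" "M n \<le> k"
      using Mm[of n] that by simp_all
    then show ?thesis
      using M by metis
  qed
  have "I k = I m" if "m \<le> k" for k
  proof
    show "I m \<subseteq> I k"
      by (rule mono[OF that])
    \<comment> \<open>Induction on the formal length: an element of \<open>I m\<close> with the same
      top coefficient is subtracted, which leaves a shorter representative.\<close>
    have low: "\<forall>p. (\<forall>i. coeff p i \<in> A) \<and> (\<forall>i\<ge>n. coeff p i = 0) \<and> poly p t \<in> I k \<longrightarrow> poly p t \<in> I m" for n
    proof (induction n)
      case 0
      then show ?case
        using id(1) by (auto simp: poly_eq_iff[of _ 0, simplified, symmetric])
    next
      case (Suc n)
      show ?case
      proof (intro allI impI, elim conjE)
        fix p assume p: "\<forall>i. coeff p i \<in> A" "\<forall>i\<ge>Suc n. coeff p i = 0" "poly p t \<in> I k"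
        then have "p \<in> S n k"
          unfolding S_def by simp
        then have "coeff p n \<in> L n m"
          unfolding eq[OF that, symmetric] unfolding L_def by (rule imageI)
        then obtain q where q: "q \<in> S n m" "coeff p n = coeff q n"
          unfolding L_def by blast
        have q': "\<forall>i. coeff q i \<in> A" "\<forall>i>n. coeff q i = 0" "poly q t \<in> I m"
          using q(1) unfolding S_def by blast+
        have "coeff (p - q) i \<in> A" for i
          using p(1) q'(1) A(5) by simp
        moreover have "coeff (p - q) i = 0" if "n \<le> i" for i
          using p(2) q'(2) q(2) that by (cases "i = n") simp_all
        moreover have "poly (p - q) t \<in> I k"
        proof -
          have "-1 \<in> adjoin A t"
            using A(5)[OF A(1,2)] by (intro A_sub) simp
          then have "-1 * poly q t \<in> I k"
            using q'(3) mono[OF that] by (intro id(3)) blast+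
          then show ?thesis
            using id(2)[OF p(3), of "-1 * poly q t"] by simp
        qed
        ultimately have "poly (p - q) t \<in> I m"
          using Suc.IH by blast
        then show "poly p t \<in> I m"
          using id(2)[OF _ q'(3), of "poly (p - q) t"] by simp
      qed
    qed
    show "I k \<subseteq> I m"
    proof
      fix x assume x: "x \<in> I k"
      then obtain p where p: "x = poly p t" "\<forall>i. coeff p i \<in> A"
        using id(4)[of k] unfolding adjoin_def by blast
      have "\<forall>i\<ge>Suc (degree p). coeff p i = 0"
        by (simp add: coeff_eq_0)
      then show "x \<in> I m"
        using low[of "Suc (degree p)"] p x by blast
    qed
  qed
  then show "\<exists>m. \<forall>n\<ge>m. I n = I m"
    by blast
qed

lemma polyfun_subring: "subring_set (polyfun I :: (('v \<Rightarrow> 'r::comm_ring_1) \<Rightarrow> 'r) set)"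
  unfolding subring_set_def plus_fun_def times_fun_def zero_fun_def one_fun_def fun_Compl_def
  by (intro conjI ballI polyfun_const polyfun_add polyfun_mult)

lemma polyfun_insert:
  "polyfun (insert k I) = adjoin (polyfun I :: (('v \<Rightarrow> 'r::comm_ring_1) \<Rightarrow> 'r) set) (\<lambda>x. x k)"
proof
  note A = subring_setD[OF polyfun_subring]
  let ?t = "\<lambda>x :: 'v \<Rightarrow> 'r. x k"
  let ?A = "polyfun I :: (('v \<Rightarrow> 'r) \<Rightarrow> 'r) set"
  note const = adjoin_base[OF polyfun_subring]
  show "polyfun (insert k I) \<subseteq> adjoin ?A ?t"
  proof
    fix c :: "('v \<Rightarrow> 'r) \<Rightarrow> 'r" assume "c \<in> polyfun (insert k I)"
    then show "c \<in> adjoin ?A ?t"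
    proof (induction rule: polyfun.induct)
      case (polyfun_const a)
      show ?case by (intro const polyfun.polyfun_const)
    next
      case (polyfun_var i)
      show ?case
      proof (cases "i = k")
        case True
        then show ?thesis
          using adjoin_generator[OF polyfun_subring, of ?t I] by simp
      next
        case False
        then show ?thesis
          using polyfun_var by (intro const polyfun.polyfun_var) simp
      qed
    next
      case (polyfun_add c d)
      then obtain p q where pq: "c = poly p ?t" "\<forall>i. coeff p i \<in> ?A" "d = poly q ?t" "\<forall>i. coeff q i \<in> ?A"
        unfolding adjoin_def by blast
      have "poly (p + q) ?t \<in> adjoin ?A ?t"
        by (rule adjoinI) (simp add: A(3) pq(2,4)[rule_format])
      then show ?case
        unfolding pq(1,3) poly_add plus_fun_def .
    next
      case (polyfun_mult c d)
      then obtain p q where pq: "c = poly p ?t" "\<forall>i. coeff p i \<in> ?A" "d = poly q ?t" "\<forall>i. coeff q i \<in> ?A"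
        unfolding adjoin_def by blast
      have sum: "sum f J \<in> ?A" if "\<And>j. j \<in> J \<Longrightarrow> f j \<in> ?A" for f :: "nat \<Rightarrow> _" and J
        using that by (induction J rule: infinite_finite_induct) (simp_all add: A(1,3))
      have "poly (p * q) ?t \<in> adjoin ?A ?t"
        by (rule adjoinI) (simp add: coeff_mult sum A(4) pq(2,4)[rule_format])
      then show ?case
        unfolding pq(1,3) poly_mult times_fun_def .
    qed
  qed
  show "adjoin ?A ?t \<subseteq> polyfun (insert k I)"
  proof
    fix c assume "c \<in> adjoin ?A ?t"
    then obtain p where p: "c = poly p ?t" "\<forall>i. coeff p i \<in> ?A"
      unfolding adjoin_def by blast
    have "poly p ?t \<in> polyfun (insert k I)"
      using p(2)
    proof (induction p)
      case 0
      show ?case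
        using polyfun_const[of 0 "insert k I"] by (simp add: zero_fun_def)
    next
      case (pCons a p)
      have "coeff (pCons a p) 0 \<in> ?A" "coeff (pCons a p) (Suc i) \<in> ?A" for i
        using pCons.prems by blast+
      then have "a \<in> ?A" "poly p ?t \<in> polyfun (insert k I)"
        using pCons.IH by simp_all
      then have "(\<lambda>x. a x + x k * poly p ?t x) \<in> polyfun (insert k I)"
        by (intro polyfun_add polyfun_mult polyfun_var insertI1) (rule polyfun_mono[OF _ subset_insertI])
      then show ?case
        by (simp add: plus_fun_def times_fun_def)
    qed
    then show "c \<in> polyfun (insert k I)"
      unfolding p(1) .
  qed
qed

text \<open>Without variables the functions are constant, and a field has only the two trivial
  ideals.\<close>

lemma acc_polyfun_empty:
  "ascending_chain_condition (polyfun {} :: (('v \<Rightarrow> 'r::field) \<Rightarrow> 'r) set)"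
  unfolding ascending_chain_condition_def
proof (intro allI impI, elim conjE)
  let ?A = "polyfun {} :: (('v \<Rightarrow> 'r) \<Rightarrow> 'r) set"
  fix I :: "nat \<Rightarrow> (('v \<Rightarrow> 'r) \<Rightarrow> 'r) set"
  assume id: "\<forall>n. ideal_in ?A (I n)" and inc: "\<forall>n. I n \<subseteq> I (Suc n)"
  note id = ideal_inD[OF id[rule_format]]
  have mono: "I m \<subseteq> I n" if "m \<le> n" for m n
    by (rule lift_Suc_mono_le[of I m n]) (use inc that in blast)+
  have const: "\<exists>a. c = (\<lambda>x. a)" if "c \<in> ?A" for c
    using that by (induction rule: polyfun.induct) auto
  show "\<exists>m. \<forall>n\<ge>m. I n = I m"
  proof (cases "\<exists>m. \<exists>c\<in>I m. c \<noteq> 0")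
    case True
    then obtain m c where c: "c \<in> I m" "c \<noteq> 0" by blast
    then obtain a where a: "c = (\<lambda>x. a)"
      using const id(4) by blast
    then have "a \<noteq> 0"
      using c(2) by (auto simp: zero_fun_def)
    have full: "I n = ?A" if "m \<le> n" for n
    proof
      show "I n \<subseteq> ?A" by (rule id(4))
      show "?A \<subseteq> I n"
      proof
        fix b assume "b \<in> ?A"
        then obtain b' where b': "b = (\<lambda>x. b')"
          using const by blast
        have "(\<lambda>x. b' / a) * c \<in> I n"
          using c(1) mono[OF that] by (intro id(3) polyfun_const) blast
        then show "b \<in> I n"
          using \<open>a \<noteq> 0\<close> by (simp add: a b' times_fun_def)
      qed
    qed
    have "I n = I m" if "m \<le> n" for n
      using full[OF that] full[of m] by simp
    then show ?thesis by blast
  next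
    case False
    then have "I n = {0}" for n
      using id(1)[of n] by blast
    then show ?thesis by simp
  qed
qed

lemma acc_polyfun:
  "finite I \<Longrightarrow> ascending_chain_condition (polyfun I :: (('v \<Rightarrow> 'r::field) \<Rightarrow> 'r) set)"
proof (induction I rule: finite_induct)
  case empty
  show ?case by (rule acc_polyfun_empty)
next
  case (insert k I)
  then show ?case
    unfolding polyfun_insert by (intro hilbert_basis polyfun_subring)
qed

text \<open>Otherwise each finite \<open>B\<close> misses some equation \<open>g B\<close>. Adding
  these one at a time makes the ideal of functions vanishing on the common zeros grow strictly at
  every step, contrary to the ascending chain condition.\<close>

lemma finite_equations_suffice:
  fixes F :: "(('v \<Rightarrow> 'r::field) \<Rightarrow> 'r) set"
  assumes I: "finite I" and F: "F \<subseteq> polyfun I"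
  shows "\<exists>B\<subseteq>F. finite B \<and> (\<forall>x. (\<forall>c\<in>B. c x = 0) \<longrightarrow> (\<forall>c\<in>F. c x = 0))"
proof (rule ccontr)
  assume neg: "\<not> ?thesis"
  have "\<exists>c. c \<in> F \<and> (\<exists>x. (\<forall>b\<in>B. b x = 0) \<and> c x \<noteq> 0)" if "finite B" "B \<subseteq> F" for B
    using neg that by blast
  then obtain g where g: "\<And>B. finite B \<Longrightarrow> B \<subseteq> F \<Longrightarrow> g B \<in> F \<and> (\<exists>x. (\<forall>b\<in>B. b x = 0) \<and> g B x \<noteq> 0)"
    by metis
  define B where "B = rec_nat {} (\<lambda>_ B. insert (g B) B)"
  have B: "B 0 = {}" "B (Suc n) = insert (g (B n)) (B n)" for n
    by (simp_all add: B_def)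
  have BF: "finite (B n) \<and> B n \<subseteq> F" for n
  proof (induction n)
    case (Suc n)
    then show ?case
      using g[of "B n"] by (simp add: B(2))
  qed (simp add: B(1))
  define J where "J n = {c \<in> polyfun I. \<forall>x. (\<forall>b\<in>B n. b x = 0) \<longrightarrow> c x = 0}" for n
  note A = subring_setD[OF polyfun_subring[of I]]
  have "ideal_in (polyfun I) (J n)" for n
    unfolding ideal_in_def J_def by (simp add: A(1,3,4))
  moreover have "J n \<subseteq> J (Suc n)" for n
    unfolding J_def B(2) by blast
  ultimately obtain m where m: "\<forall>n\<ge>m. J n = J m"
    using acc_polyfun[OF I] unfolding ascending_chain_condition_def by metis
  have gm: "g (B m) \<in> F" "\<exists>x. (\<forall>b\<in>B m. b x = 0) \<and> g (B m) x \<noteq> 0"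
    using g[of "B m"] BF by blast+
  then have "g (B m) \<in> J (Suc m)"
    unfolding J_def B(2) using F by blast
  then have "g (B m) \<in> J m"
    using m[rule_format, of "Suc m"] by simp
  then show False
    using gm(2) unfolding J_def by blast
qed

section \<open>Convex combinations\<close>

text \<open>Gaussian elimination: a nonzero entry of the last equation serves to eliminate one
  unknown.\<close>

lemma homogeneous_system_solution:
  fixes a :: "nat \<Rightarrow> 'k \<Rightarrow> 'r::field"
  assumes "finite K" "d < card K"
  shows "\<exists>\<mu>. (\<exists>k\<in>K. \<mu> k \<noteq> 0) \<and> (\<forall>i<d. (\<Sum>k\<in>K. a i k * \<mu> k) = 0)"
  using assms
proof (induction d arbitrary: K a)
  case 0
  then obtain k where "k \<in> K" by fastforce
  then show ?case
    by (intro exI[of _ "\<lambda>_. 1"]) auto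
next
  case (Suc d)
  show ?case
  proof (cases "\<exists>k0\<in>K. a d k0 \<noteq> 0")
    case False
    have "d < card K" using Suc.prems by simp
    from Suc.IH[OF Suc.prems(1) this, of a] obtain \<mu> where
      "\<exists>k\<in>K. \<mu> k \<noteq> 0" "\<forall>i<d. (\<Sum>k\<in>K. a i k * \<mu> k) = 0"
      by blast
    moreover have "(\<Sum>k\<in>K. a d k * \<mu> k) = 0"
      using False by (intro sum.neutral) simp
    ultimately show ?thesis
      by (intro exI[of _ \<mu>]) (simp add: less_Suc_eq)
  next
    case True
    then obtain k0 where k0: "k0 \<in> K" "a d k0 \<noteq> 0" by blast
    define b where "b i k = a i k - a i k0 * a d k / a d k0" for i k
    have "finite (K - {k0})" "d < card (K - {k0})"
      using Suc.prems k0 by simp_all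
    from Suc.IH[OF this, of b] obtain \<mu> where
      \<mu>: "\<exists>k\<in>K - {k0}. \<mu> k \<noteq> 0" "\<forall>i<d. (\<Sum>k\<in>K - {k0}. b i k * \<mu> k) = 0"
      by blast
    define s where "s = (\<Sum>k\<in>K - {k0}. a d k * \<mu> k)"
    define \<nu> where "\<nu> = \<mu>(k0 := - s / a d k0)"
    have split: "(\<Sum>k\<in>K. a i k * \<nu> k) = - a i k0 * s / a d k0 + (\<Sum>k\<in>K - {k0}. a i k * \<mu> k)" for i
    proof -
      have "(\<Sum>k\<in>K. a i k * \<nu> k) = a i k0 * \<nu> k0 + (\<Sum>k\<in>K - {k0}. a i k * \<nu> k)"
        by (rule sum.remove[OF Suc.prems(1) k0(1)])
      also have "(\<Sum>k\<in>K - {k0}. a i k * \<nu> k) = (\<Sum>k\<in>K - {k0}. a i k * \<mu> k)"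
        by (intro sum.cong) (simp_all add: \<nu>_def)
      finally show ?thesis
        by (simp add: \<nu>_def)
    qed
    have "(\<Sum>k\<in>K. a i k * \<nu> k) = 0" if "i < Suc d" for i
    proof (cases "i = d")
      case True
      then show ?thesis
        unfolding split using k0 by (simp add: s_def)
    next
      case False
      then have "(\<Sum>k\<in>K - {k0}. b i k * \<mu> k) = 0"
        using \<mu>(2) that by simp
      then have "(\<Sum>k\<in>K - {k0}. a i k * \<mu> k) = (\<Sum>k\<in>K - {k0}. a i k0 / a d k0 * (a d k * \<mu> k))"
        by (simp add: b_def algebra_simps sum_subtractf)
      also have "\<dots> = a i k0 / a d k0 * s"
        by (simp add: s_def sum_distrib_left)
      finally show ?thesis
        unfolding split by simp
    qed
    moreover have "\<exists>k\<in>K. \<nu> k \<noteq> 0"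
    proof -
      obtain k where "k \<in> K - {k0}" "\<mu> k \<noteq> 0"
        using \<mu>(1) by blast
      then show ?thesis
        by (intro bexI[of _ k]) (simp_all add: \<nu>_def)
    qed
    ultimately show ?thesis by blast
  qed
qed

text \<open>With more than \<open>d + 1\<close> points there is a nontrivial affine dependence
  \<open>\<mu>\<close>. Moving the weights along \<open>-\<mu>\<close> keeps their sum and the
  barycentre; the move stops when the first weight reaches 0, and that point is dropped.\<close>

lemma caratheodory:
  fixes p :: "'k \<Rightarrow> nat \<Rightarrow> 'r::linordered_field"
  assumes "finite K" "\<forall>k\<in>K. 0 \<le> w k" "sum w K = 1"
  shows "\<exists>K'\<subseteq>K. \<exists>w'. card K' \<le> Suc d \<and> (\<forall>k\<in>K'. 0 \<le> w' k) \<and> sum w' K' = 1 \<and>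
    (\<forall>i<d. (\<Sum>k\<in>K'. w' k * p k i) = (\<Sum>k\<in>K. w k * p k i))"
  using assms
proof (induction "card K" arbitrary: K w rule: less_induct)
  case (less K w)
  show ?case
  proof (cases "card K \<le> Suc d")
    case True
    then show ?thesis
      using less.prems by blast
  next
    case False
    then have "Suc d < card K" by simp
    \<comment> \<open>The equation with index \<open>d\<close> has all coefficients 1 and forces
      \<open>sum \<mu> K = 0\<close>.\<close>
    from homogeneous_system_solution[OF less.prems(1) this, of "\<lambda>i k. if i < d then p k i else 1"]
    obtain \<mu> where \<mu>: "\<exists>k\<in>K. \<mu> k \<noteq> 0"
      and eq: "\<forall>i<Suc d. (\<Sum>k\<in>K. (if i < d then p k i else 1) * \<mu> k) = 0"
      by blast
    have s0: "sum \<mu> K = 0"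
      using eq[rule_format, of d] by simp
    have sp: "(\<Sum>k\<in>K. \<mu> k * p k i) = 0" if "i < d" for i
      using eq[rule_format, of i] that by (simp add: mult.commute)
    define K1 where "K1 = {k\<in>K. \<mu> k > 0}"
    have "K1 \<noteq> {}"
    proof
      assume "K1 = {}"
      then have "\<forall>k\<in>K. 0 \<le> - \<mu> k"
        unfolding K1_def by (simp add: not_less)
      moreover have "(\<Sum>k\<in>K. - \<mu> k) = 0"
        using s0 by (simp add: sum_negf)
      ultimately have "\<forall>k\<in>K. - \<mu> k = 0"
        using sum_nonneg_eq_0_iff[OF less.prems(1), of "\<lambda>k. - \<mu> k"] by blast
      then show False
        using \<mu> by simp
    qed
    moreover have "finite K1"
      unfolding K1_def using less.prems(1) by simp
    ultimately obtain k0 where k0: "k0 \<in> K1" "\<forall>k\<in>K1. w k0 / \<mu> k0 \<le> w k / \<mu> k"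
      using finite_has_minimal[of "(\<lambda>k. w k / \<mu> k) ` K1"]
      by (metis (no_types, lifting) arg_min_if_finite(1) arg_min_least)
    \<comment> \<open>The smallest ratio over positive \<open>\<mu> k\<close> is the longest step
      that keeps all weights nonnegative.\<close>
    define t where "t = w k0 / \<mu> k0"
    have k0': "k0 \<in> K" "\<mu> k0 > 0"
      using k0 by (simp_all add: K1_def)
    have "t \<ge> 0"
      using k0' less.prems(2) by (simp add: t_def)
    define w' where "w' k = w k - t * \<mu> k" for k
    have w0: "w' k0 = 0"
      using k0' by (simp add: w'_def t_def)
    have nn: "0 \<le> w' k" if "k \<in> K" for k
    proof (cases "\<mu> k > 0")
      case True
      then have "t \<le> w k / \<mu> k"
        using k0(2) that by (simp add: K1_def t_def)
      then show ?thesis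
        using True by (simp add: w'_def field_simps)
    next
      case False
      then have "t * \<mu> k \<le> 0"
        using \<open>t \<ge> 0\<close> by (simp add: mult_nonneg_nonpos)
      then show ?thesis
        using less.prems(2) that unfolding w'_def by (smt (verit) diff_ge_0_iff_ge order_trans)
    qed
    have rem: "(\<Sum>k\<in>K - {k0}. w' k * q k) = (\<Sum>k\<in>K. w k * q k) - t * (\<Sum>k\<in>K. \<mu> k * q k)" for q
    proof -
      have "(\<Sum>k\<in>K. w' k * q k) = (\<Sum>k\<in>K - {k0}. w' k * q k)"
        using sum.remove[OF less.prems(1) k0'(1), of "\<lambda>k. w' k * q k"] w0 by simp
      then show ?thesis
        by (simp add: w'_def algebra_simps sum_subtractf sum_distrib_left)
    qed
    have 1: "card (K - {k0}) < card K"
      using less.prems(1) k0'(1) by (rule card_Diff1_less)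
    have 2: "finite (K - {k0})" "\<forall>k\<in>K - {k0}. 0 \<le> w' k"
      using less.prems(1) nn by simp_all
    have 3: "sum w' (K - {k0}) = 1"
      using rem[of "\<lambda>_. 1"] s0 less.prems(3) by simp
    from less.hyps[OF 1 2 3] obtain K' w'' where K': "K' \<subseteq> K - {k0}" "card K' \<le> Suc d"
      "\<forall>k\<in>K'. 0 \<le> w'' k" "sum w'' K' = 1"
      "\<forall>i<d. (\<Sum>k\<in>K'. w'' k * p k i) = (\<Sum>k\<in>K - {k0}. w' k * p k i)"
      by blast
    moreover have "(\<Sum>k\<in>K - {k0}. w' k * p k i) = (\<Sum>k\<in>K. w k * p k i)" if "i < d" for i
      using rem[of "\<lambda>k. p k i"] sp[OF that] by simp
    ultimately show ?thesis
      by (intro exI[of _ K'] exI[of _ w'']) auto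
  qed
qed

section \<open>Fixed points of compact matrix groups\<close>

text \<open>Names of the real variables in the formulas below: \<open>Pt k l\<close> is coordinate
  \<open>l\<close> of the \<open>k\<close>-th group element, \<open>Wt k\<close> its weight,
  \<open>Co i\<close> a coordinate of the hull point, and \<open>Lev\<close> the level in the
  epigraph.\<close>

datatype var = Pt nat nat | Wt nat | Co nat | Lev

lemma infinite_var: "infinite (UNIV :: var set)"
proof
  assume "finite (UNIV :: var set)"
  then have "finite (range Wt)"
    by (rule finite_subset[rotated]) simp
  then have "finite (UNIV :: nat set)"
    by (rule finite_imageD) (simp add: inj_def)
  then show False by simp
qed

lemma bounded_on_polyfun_value:
  assumes "bounded_on J P" "c \<in> polyfun J" "\<And>y. P y \<Longrightarrow> y u = c y"
  shows "bounded_on {u} P"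
proof -
  obtain b where b: "\<forall>x. P x \<longrightarrow> (\<forall>i\<in>J. \<bar>x i\<bar> \<le> b)"
    using assms(1) unfolding bounded_on_def by blast
  obtain B where B: "\<forall>x. (\<forall>i\<in>J. \<bar>x i\<bar> \<le> b) \<longrightarrow> \<bar>c x\<bar> \<le> B"
    using polyfun_bounded[OF assms(2)] by blast
  have "\<bar>y u\<bar> \<le> B" if "P y" for y
    unfolding assms(3)[OF that] using b B that by blast
  then show ?thesis
    unfolding bounded_on_def by blast
qed

text \<open>\<open>K\<close> is the group in coordinates, and \<open>m i j\<close> gives the matrix
  entries as polynomials in them. Injectivity of the matrices is the form in which inverses
  enter.\<close>

locale compact_matrix_group =
  fixes K :: "(nat \<Rightarrow> 'r::real_closed_field) \<Rightarrow> bool"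
    and m :: "nat \<Rightarrow> nat \<Rightarrow> (nat \<Rightarrow> 'r) \<Rightarrow> 'r"
    and N d :: nat
  assumes K_cpt: "compact_on {..<N} K"
    and K_ne: "\<exists>x. K x"
    and m_poly: "i < d \<Longrightarrow> j < d \<Longrightarrow> m i j \<in> polyfun {..<N}"
    and m_mult: "K x \<Longrightarrow> K y \<Longrightarrow> \<exists>z. K z \<and> (\<forall>i<d. \<forall>j<d. m i j z = (\<Sum>k<d. m i k x * m k j y))"
    and m_inj: "K x \<Longrightarrow> \<forall>i<d. (\<Sum>j<d. m i j x * w j) = 0 \<Longrightarrow> j < d \<Longrightarrow> w j = 0"
begin

definition ap :: "(nat \<Rightarrow> 'r) \<Rightarrow> (nat \<Rightarrow> 'r) \<Rightarrow> nat \<Rightarrow> 'r" where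
  "ap x w i = (\<Sum>j<d. m i j x * w j)"

definition sqnorm :: "(nat \<Rightarrow> 'r) \<Rightarrow> 'r" where
  "sqnorm w = (\<Sum>i<d. w i * w i)"

text \<open>By Caratheodory's theorem in dimension \<open>d\<close>, combinations of
  \<open>d + 1\<close> terms, some possibly of weight 0, exhaust the hull. The fixed number of terms
  makes it a projection of a compact semialgebraic set.\<close>

definition orbit_hull :: "(nat \<Rightarrow> 'r) \<Rightarrow> (nat \<Rightarrow> 'r) \<Rightarrow> bool" where
  "orbit_hull v a \<longleftrightarrow> (\<exists>w Z. (\<forall>k\<le>d. K (Z k)) \<and> (\<forall>k\<le>d. 0 \<le> w k) \<and> sum w {..d} = 1 \<and>
    (\<forall>i<d. a i = (\<Sum>k\<le>d. w k * ap (Z k) v i)))"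

lemma ap_cong: "(\<And>j. j < d \<Longrightarrow> v j = w j) \<Longrightarrow> ap x v i = ap x w i"
  unfolding ap_def by (intro sum.cong) simp_all

lemma ap_mult:
  assumes "K x" "K y"
  shows "\<exists>z. K z \<and> (\<forall>v. \<forall>i<d. ap z v i = ap x (ap y v) i)"
proof -
  obtain z where z: "K z" "\<forall>i<d. \<forall>j<d. m i j z = (\<Sum>k<d. m i k x * m k j y)"
    using m_mult[OF assms] by blast
  have "ap z v i = ap x (ap y v) i" if "i < d" for v i
  proof -
    have "ap z v i = (\<Sum>j<d. \<Sum>k<d. m i k x * (m k j y * v j))"
      unfolding ap_def using z(2) that by (intro sum.cong) (simp_all add: sum_distrib_right mult.assoc)
    also have "\<dots> = (\<Sum>k<d. \<Sum>j<d. m i k x * (m k j y * v j))"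
      by (rule sum.swap)
    finally show ?thesis
      unfolding ap_def by (simp add: sum_distrib_left)
  qed
  then show ?thesis
    using z(1) by blast
qed

lemma ap_sum: "ap x (\<lambda>i. \<Sum>k\<in>A. w k * f k i) i = (\<Sum>k\<in>A. w k * ap x (f k) i)"
proof -
  have "ap x (\<lambda>i. \<Sum>k\<in>A. w k * f k i) i = (\<Sum>j<d. \<Sum>k\<in>A. w k * (m i j x * f k j))"
    unfolding ap_def by (simp add: sum_distrib_left algebra_simps)
  also have "\<dots> = (\<Sum>k\<in>A. \<Sum>j<d. w k * (m i j x * f k j))"
    by (rule sum.swap)
  finally show ?thesis
    unfolding ap_def by (simp add: sum_distrib_left)
qed

lemma ap_diff: "ap x (\<lambda>i. v i - w i) i = ap x v i - ap x w i"
  unfolding ap_def by (simp add: algebra_simps sum_subtractf)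

lemma ap_mid: "ap x (\<lambda>i. (v i + w i) / 2) i = (ap x v i + ap x w i) / 2"
  unfolding ap_def by (simp add: algebra_simps sum.distrib add_divide_distrib flip: sum_divide_distrib)

lemma sqnorm_cong: "(\<And>j. j < d \<Longrightarrow> v j = w j) \<Longrightarrow> sqnorm v = sqnorm w"
  unfolding sqnorm_def by (intro sum.cong) simp_all

lemma sqnorm_nonneg: "0 \<le> sqnorm w"
  unfolding sqnorm_def by (intro sum_nonneg) simp

text \<open>Strict convexity in quantitative form: the gain at the midpoint is a quarter of the
  squared distance.\<close>

lemma sqnorm_parallelogram:
  "sqnorm (\<lambda>i. (v i + w i) / 2) = (sqnorm v + sqnorm w) / 2 - sqnorm (\<lambda>i. v i - w i) / 4"
proof -
  have "((v i + w i) / 2) * ((v i + w i) / 2) =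
      (v i * v i + w i * w i) / 2 - ((v i - w i) * (v i - w i)) / 4" for i
    by (simp add: field_simps)
  then show ?thesis
    unfolding sqnorm_def
    by (simp only: sum_subtractf sum.distrib flip: sum_divide_distrib)
qed

lemma hull_ap:
  assumes "orbit_hull v a" "K x"
  shows "orbit_hull v (ap x a)"
proof -
  obtain w Z where Z: "\<forall>k\<le>d. K (Z k)" "\<forall>k\<le>d. 0 \<le> w k" "sum w {..d} = 1"
    "\<forall>i<d. a i = (\<Sum>k\<le>d. w k * ap (Z k) v i)"
    using assms(1) unfolding orbit_hull_def by blast
  have "\<forall>k\<in>{..d}. \<exists>z. K z \<and> (\<forall>i<d. ap z v i = ap x (ap (Z k) v) i)"
  proof
    fix k assume "k \<in> {..d}"
    then have "K (Z k)" using Z(1) by simp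
    from ap_mult[OF assms(2) this] show "\<exists>z. K z \<and> (\<forall>i<d. ap z v i = ap x (ap (Z k) v) i)"
      by blast
  qed
  from bchoice[OF this] obtain Y where Y: "\<forall>k\<in>{..d}. K (Y k) \<and> (\<forall>i<d. ap (Y k) v i = ap x (ap (Z k) v) i)"
    by blast
  have "ap x a i = (\<Sum>k\<le>d. w k * ap (Y k) v i)" if "i < d" for i
  proof -
    have "ap x a i = ap x (\<lambda>i. \<Sum>k\<le>d. w k * ap (Z k) v i) i"
      by (rule ap_cong) (use Z(4) in simp)
    also have "\<dots> = (\<Sum>k\<le>d. w k * ap (Y k) v i)"
      unfolding ap_sum using Y that by (intro sum.cong) simp_all
    finally show ?thesis .
  qed
  then show ?thesis
    unfolding orbit_hull_def using Z(2,3) Y by (intro exI[of _ w] exI[of _ Y]) simp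
qed

lemma hull_of_finite_combination:
  assumes K: "finite A" "\<forall>k\<in>A. K (Z k)" "\<forall>k\<in>A. 0 \<le> w k" "sum w A = 1"
    and a: "\<forall>i<d. a i = (\<Sum>k\<in>A. w k * ap (Z k) v i)"
  shows "orbit_hull v a"
proof -
  obtain B w' where B: "B \<subseteq> A" "card B \<le> Suc d" "\<forall>k\<in>B. 0 \<le> w' k" "sum w' B = 1"
    "\<forall>i<d. (\<Sum>k\<in>B. w' k * ap (Z k) v i) = (\<Sum>k\<in>A. w k * ap (Z k) v i)"
    using caratheodory[OF K(1,3,4), of d "\<lambda>k. ap (Z k) v"] by blast
  have "finite B"
    using B(1) K(1) by (rule finite_subset)
  then obtain f where f: "bij_betw f {..<card B} B"
    using ex_bij_betw_nat_finite[of B] by (auto simp: atLeast0LessThan)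
  obtain x0 where x0: "K x0" using K_ne by blast
  \<comment> \<open>Missing terms are filled up with weight 0 at an arbitrary group element
    \<open>x0\<close>.\<close>
  define u where "u k = (if k < card B then w' (f k) else 0)" for k
  define Y where "Y k = (if k < card B then Z (f k) else x0)" for k
  have fB: "f k \<in> B" if "k < card B" for k
    using f that by (auto simp: bij_betw_def)
  have sum: "(\<Sum>k\<le>d. u k * g (Y k)) = (\<Sum>k\<in>B. w' k * g (Z k))" for g :: "(nat \<Rightarrow> 'r) \<Rightarrow> 'r"
  proof -
    have "(\<Sum>k\<le>d. u k * g (Y k)) = (\<Sum>k<card B. u k * g (Y k))"
      using B(2) by (intro sum.mono_neutral_right) (auto simp: u_def)
    also have "\<dots> = (\<Sum>k<card B. w' (f k) * g (Z (f k)))"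
      by (intro sum.cong) (simp_all add: u_def Y_def)
    also have "\<dots> = (\<Sum>k\<in>B. w' k * g (Z k))"
      by (rule sum.reindex_bij_betw[OF f])
    finally show ?thesis .
  qed
  show ?thesis
    unfolding orbit_hull_def
  proof (intro exI[of _ u] exI[of _ Y] conjI allI impI)
    fix k
    show "K (Y k)"
      using fB[of k] B(1) K(2) x0 unfolding Y_def by auto
    show "0 \<le> u k"
      using fB[of k] B(3) unfolding u_def by auto
  next
    show "sum u {..d} = 1"
      using sum[of "\<lambda>_. 1"] B(4) by simp
  next
    fix i assume "i < d"
    then show "a i = (\<Sum>k\<le>d. u k * ap (Y k) v i)"
      using sum[of "\<lambda>x. ap x v i"] a B(5) by simp
  qed
qed

lemma hull_mid:
  assumes "orbit_hull v a" "orbit_hull v b"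
  shows "orbit_hull v (\<lambda>i. (a i + b i) / 2)"
proof -
  obtain w Z where Z: "\<forall>k\<le>d. K (Z k)" "\<forall>k\<le>d. 0 \<le> w k" "sum w {..d} = 1"
    "\<forall>i<d. a i = (\<Sum>k\<le>d. w k * ap (Z k) v i)"
    using assms(1) unfolding orbit_hull_def by blast
  obtain u Y where Y: "\<forall>k\<le>d. K (Y k)" "\<forall>k\<le>d. 0 \<le> u k" "sum u {..d} = 1"
    "\<forall>i<d. b i = (\<Sum>k\<le>d. u k * ap (Y k) v i)"
    using assms(2) unfolding orbit_hull_def by blast
  have split: "(\<Sum>k\<in>{..d} <+> {..d}. f k) = (\<Sum>k\<le>d. f (Inl k)) + (\<Sum>k\<le>d. f (Inr k))"
    for f :: "nat + nat \<Rightarrow> 'r"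
    by (subst sum.Plus) simp_all
  show ?thesis
  proof (rule hull_of_finite_combination[of "{..d} <+> {..d}" "case_sum Z Y" "case_sum (\<lambda>k. w k / 2) (\<lambda>k. u k / 2)"])
    show "sum (case_sum (\<lambda>k. w k / 2) (\<lambda>k. u k / 2)) ({..d} <+> {..d}) = 1"
      unfolding split using Z(3) Y(3) by (simp flip: sum_divide_distrib)
    show "\<forall>i<d. (a i + b i) / 2 = (\<Sum>k\<in>{..d} <+> {..d}. case_sum (\<lambda>k. w k / 2) (\<lambda>k. u k / 2) k * ap (case_sum Z Y k) v i)"
      unfolding split using Z(4) Y(4) by (simp add: add_divide_distrib flip: sum_divide_distrib)
  qed (use Z(1,2) Y(1,2) in \<open>auto\<close>)
qed

lemma K_cong:
  assumes "K x" "\<And>i. i < N \<Longrightarrow> x i = y i"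
  shows "K y"
proof (rule closed_on_cong[of "{..<N}" K x y])
  show "closed_on {..<N} K"
    using K_cpt unfolding compact_on_def by simp
  show "K x"
    by (rule assms(1))
  show "x i = y i" if "i \<in> {..<N}" for i
    using assms(2) that by simp
qed

lemma ap_cong_point:
  assumes "\<And>l. l < N \<Longrightarrow> x l = y l" "i < d"
  shows "ap x w i = ap y w i"
proof -
  have "m i j x = m i j y" if "j < d" for j
    by (rule polyfun_cong[OF m_poly[OF assms(2) that]]) (use assms(1) in simp)
  then show ?thesis
    unfolding ap_def by simp
qed

section \<open>The orbit hull and the epigraph as compact semialgebraic sets\<close>

definition hull_pred :: "(nat \<Rightarrow> 'r) \<Rightarrow> (var \<Rightarrow> 'r) \<Rightarrow> bool" where
  "hull_pred v y \<longleftrightarrow> (\<forall>k\<in>{..d}. K (\<lambda>l. y (Pt k l))) \<and> (\<forall>k\<in>{..d}. 0 \<le> y (Wt k)) \<and>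
    (\<Sum>k\<le>d. y (Wt k)) = 1 \<and>
    (\<forall>i\<in>{..<d}. y (Co i) = (\<Sum>k\<le>d. y (Wt k) * (\<Sum>j<d. m i j (\<lambda>l. y (Pt k l)) * v j)))"

definition aux_vars :: "var set" where
  "aux_vars = (\<Union>k\<in>{..d}. Pt k ` {..<N}) \<union> Wt ` {..d}"

lemma m_poly_Pt: "i < d \<Longrightarrow> j < d \<Longrightarrow> (\<lambda>y. m i j (\<lambda>l. y (Pt k l))) \<in> polyfun (Pt k ` {..<N})"
  by (rule polyfun_rename[OF m_poly])

lemma combination_poly:
  assumes "i < d"
  shows "(\<lambda>y. \<Sum>k\<le>d. y (Wt k) * (\<Sum>j<d. m i j (\<lambda>l. y (Pt k l)) * v j)) \<in> polyfun aux_vars"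
proof -
  have Wt: "(\<lambda>y. y (Wt k)) \<in> polyfun aux_vars" if "k \<in> {..d}" for k
    by (rule polyfun_var) (use that in \<open>simp add: aux_vars_def\<close>)
  have m: "(\<lambda>y. m i j (\<lambda>l. y (Pt k l))) \<in> polyfun aux_vars" if "k \<in> {..d}" "j \<in> {..<d}" for k j
    by (rule polyfun_mono[OF m_poly_Pt]) (use that assms in \<open>auto simp: aux_vars_def\<close>)
  have inner: "(\<lambda>y. \<Sum>j<d. m i j (\<lambda>l. y (Pt k l)) * v j) \<in> polyfun aux_vars" if "k \<in> {..d}" for k
    by (rule polyfun.sum_closed) (rule polyfun_mult[OF m[OF that] polyfun_const])
  show ?thesis
    by (rule polyfun.sum_closed) (rule polyfun_mult[OF Wt inner])
qed

text \<open>The weights are bounded because they are nonnegative with sum 1, the group elements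
  because \<open>K\<close> is bounded, and the hull coordinates because they are polynomial values
  in the former.\<close>

lemma hull_pred_cpt: "compact_on (Co ` {..<d} \<union> aux_vars) (hull_pred v)"
proof -
  let ?I = "Co ` {..<d} \<union> aux_vars"
  have sK: "semialg K" and cK: "closed_on {..<N} K" and bK: "bounded_on {..<N} K"
    using K_cpt unfolding compact_on_def by simp_all
  have Wt: "(\<lambda>y :: var \<Rightarrow> 'r. y (Wt k)) \<in> polyfun ?I" if "k \<in> {..d}" for k
    by (rule polyfun_var) (use that in \<open>simp add: aux_vars_def\<close>)
  have Co: "(\<lambda>y. y (Co i)) \<in> polyfun ?I" if "i \<in> {..<d}" for i
    by (rule polyfun_var) (use that in simp)
  have comb: "(\<lambda>y. \<Sum>k\<le>d. y (Wt k) * (\<Sum>j<d. m i j (\<lambda>l. y (Pt k l)) * v j)) \<in> polyfun ?I"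
    if "i \<in> {..<d}" for i
    by (rule polyfun_mono[OF combination_poly]) (use that in auto)
  have sumWt: "(\<lambda>y :: var \<Rightarrow> 'r. \<Sum>k\<le>d. y (Wt k)) \<in> polyfun ?I"
    by (rule polyfun.sum_closed) (rule Wt)
  have sK': "semialg (\<lambda>y :: var \<Rightarrow> 'r. K (\<lambda>l. y (Pt k l)))" for k
    by (rule semialg_rename[OF sK])
  have s1: "semialg (\<lambda>y :: var \<Rightarrow> 'r. \<forall>k\<in>{..d}. K (\<lambda>l. y (Pt k l)))"
    by (rule semialg_ball[OF finite_atMost sK'])
  have s2: "semialg (\<lambda>y :: var \<Rightarrow> 'r. \<forall>k\<in>{..d}. 0 \<le> y (Wt k))"
    by (rule semialg_ball[OF finite_atMost semialg_le[OF polyfun_const Wt]])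
  have s3: "semialg (\<lambda>y :: var \<Rightarrow> 'r. (\<Sum>k\<le>d. y (Wt k)) = 1)"
    by (rule semialg_eq[OF sumWt polyfun_const])
  have s4: "semialg (\<lambda>y :: var \<Rightarrow> 'r. \<forall>i\<in>{..<d}. y (Co i) =
      (\<Sum>k\<le>d. y (Wt k) * (\<Sum>j<d. m i j (\<lambda>l. y (Pt k l)) * v j)))"
    by (rule semialg_ball[OF finite_lessThan semialg_eq[OF Co comb]])
  have "semialg (hull_pred v)"
    unfolding hull_pred_def by (rule semialg_conj[OF s1 semialg_conj[OF s2 semialg_conj[OF s3 s4]]])
  moreover have "closed_on ?I (hull_pred v)"
  proof -
    have "closed_on ?I (\<lambda>y. K (\<lambda>l. y (Pt k l)))" if "k \<in> {..d}" for k
      by (rule closed_on_mono[OF closed_on_rename[OF cK]]) (use that in \<open>auto simp: aux_vars_def\<close>)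
    then show ?thesis
      unfolding hull_pred_def
      by (intro closed_on_conj closed_on_ball closed_on_le[OF polyfun_const Wt]
          closed_on_eq[OF sumWt polyfun_const] closed_on_eq[OF Co comb])
  qed
  moreover have "bounded_on ?I (hull_pred v)"
  proof -
    have bPt: "bounded_on (\<Union>k\<in>{..d}. Pt k ` {..<N}) (hull_pred v)"
    proof (rule bounded_on_UN)
      fix k assume "k \<in> {..d}"
      then show "bounded_on (Pt k ` {..<N}) (hull_pred v)"
        by (intro bounded_on_mono[OF bounded_on_rename[OF bK]]) (simp add: hull_pred_def)
    qed simp
    have "\<bar>y i\<bar> \<le> 1" if y: "hull_pred v y" and i: "i \<in> Wt ` {..d}" for y i
    proof -
      obtain k where k: "i = Wt k" "k \<in> {..d}"
        using i by blast
      have nn: "\<And>k. k \<in> {..d} \<Longrightarrow> 0 \<le> y (Wt k)" and s: "(\<Sum>k\<le>d. y (Wt k)) = 1"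
        using y unfolding hull_pred_def by simp_all
      have "y (Wt k) \<le> 1"
        unfolding s[symmetric] by (rule member_le_sum[OF k(2)]) (use nn in simp_all)
      then show ?thesis
        using nn[OF k(2)] k(1) by simp
    qed
    then have "bounded_on (Wt ` {..d}) (hull_pred v)"
      unfolding bounded_on_def by blast
    with bPt have aux: "bounded_on aux_vars (hull_pred v)"
      unfolding aux_vars_def by (rule bounded_on_Un)
    have "bounded_on (\<Union>i\<in>{..<d}. {Co i}) (hull_pred v)"
    proof (rule bounded_on_UN)
      fix i assume i: "i \<in> {..<d}"
      then show "bounded_on {Co i} (hull_pred v)"
        by (intro bounded_on_polyfun_value[OF aux combination_poly[of i v]]) (simp_all add: hull_pred_def)
    qed simp
    then have "bounded_on (Co ` {..<d}) (hull_pred v)"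
      by (simp add: UNION_singleton_eq_range)
    then show ?thesis
      using aux by (rule bounded_on_Un)
  qed
  ultimately show ?thesis
    unfolding compact_on_def by blast
qed

lemma finite_aux_vars: "finite aux_vars"
  by (simp add: aux_vars_def)

lemma ex_hull_pred: "ex_on aux_vars (hull_pred v) y \<longleftrightarrow> orbit_hull v (\<lambda>i. y (Co i))"
proof
  assume "ex_on aux_vars (hull_pred v) y"
  then obtain z where z: "\<forall>i. i \<notin> aux_vars \<longrightarrow> z i = y i" "hull_pred v z"
    unfolding ex_on_def by blast
  have "z (Co i) = y (Co i)" for i
    using z(1) by (auto simp: aux_vars_def)
  then show "orbit_hull v (\<lambda>i. y (Co i))"
    using z(2) unfolding hull_pred_def orbit_hull_def ap_def
    by (intro exI[of _ "\<lambda>k. z (Wt k)"] exI[of _ "\<lambda>k l. z (Pt k l)"]) simp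
next
  assume "orbit_hull v (\<lambda>i. y (Co i))"
  then obtain w Z where Z: "\<forall>k\<le>d. K (Z k)" "\<forall>k\<le>d. 0 \<le> w k" "sum w {..d} = 1"
    "\<forall>i<d. y (Co i) = (\<Sum>k\<le>d. w k * ap (Z k) v i)"
    unfolding orbit_hull_def by blast
  define z where "z u = (if u \<in> aux_vars then (case u of Pt k l \<Rightarrow> Z k l | Wt k \<Rightarrow> w k | _ \<Rightarrow> 0) else y u)" for u
  have zP: "z (Pt k l) = Z k l" if "k \<le> d" "l < N" for k l
    using that by (simp add: z_def aux_vars_def image_iff)
  have zW: "z (Wt k) = w k" if "k \<le> d" for k
    using that by (simp add: z_def aux_vars_def image_iff)
  have zC: "z (Co i) = y (Co i)" for i
    by (auto simp: z_def aux_vars_def)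
  \<comment> \<open>\<open>z\<close> is only known to agree with \<open>Z k\<close> on the first
    \<open>N\<close> coordinates, which are the ones that \<open>K\<close> depends on.\<close>
  have Kz: "K (\<lambda>l. z (Pt k l))" if "k \<le> d" for k
    by (rule K_cong[of "Z k"]) (use Z(1) zP that in simp_all)
  have apz: "(\<Sum>j<d. m i j (\<lambda>l. z (Pt k l)) * v j) = ap (Z k) v i" if "k \<le> d" "i < d" for k i
    using ap_cong_point[of "\<lambda>l. z (Pt k l)" "Z k" i v] zP that unfolding ap_def by simp
  have "hull_pred v z"
    unfolding hull_pred_def
  proof (intro conjI ballI)
    show "(\<Sum>k\<le>d. z (Wt k)) = 1"
      unfolding Z(3)[symmetric] by (intro sum.cong) (simp_all add: zW)
    fix i assume i: "i \<in> {..<d}"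
    show "z (Co i) = (\<Sum>k\<le>d. z (Wt k) * (\<Sum>j<d. m i j (\<lambda>l. z (Pt k l)) * v j))"
      unfolding zC using Z(4) i zW apz by simp
  next
    fix k assume k: "k \<in> {..d}"
    show "K (\<lambda>l. z (Pt k l))"
      by (rule Kz) (use k in simp)
    show "0 \<le> z (Wt k)"
      using k Z(2) zW[of k] by simp
  qed
  moreover have zy: "\<forall>i. i \<notin> aux_vars \<longrightarrow> z i = y i"
    unfolding z_def by simp
  ultimately show "ex_on aux_vars (hull_pred v) y"
    by (intro ex_onI[OF zy])
qed

text \<open>The minimum of \<open>sup\<^sub>x |x a|\<^sup>2\<close> over the convex hull is obtained as the minimal level of its
  epigraph, which avoids proving continuity of the supremum.\<close>

definition epigraph :: "(nat \<Rightarrow> 'r) \<Rightarrow> 'r \<Rightarrow> (var \<Rightarrow> 'r) \<Rightarrow> bool" where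
  "epigraph v b y \<longleftrightarrow> ex_on aux_vars (hull_pred v) y \<and> 0 \<le> y Lev \<and> y Lev \<le> b \<and>
    (\<forall>x. K x \<longrightarrow> sqnorm (ap x (\<lambda>i. y (Co i))) \<le> y Lev)"

lemma sqnorm_poly:
  fixes f :: "nat \<Rightarrow> nat \<Rightarrow> ('v \<Rightarrow> 'r) \<Rightarrow> 'r"
  assumes "\<And>i j. i \<in> {..<d} \<Longrightarrow> j \<in> {..<d} \<Longrightarrow> f i j \<in> polyfun I" "\<And>j. j \<in> {..<d} \<Longrightarrow> g j \<in> polyfun I"
  shows "(\<lambda>y. \<Sum>i<d. (\<Sum>j<d. f i j y * g j y) * (\<Sum>j<d. f i j y * g j y)) \<in> polyfun I"
proof -
  have "(\<lambda>y. \<Sum>j<d. f i j y * g j y) \<in> polyfun I" if "i \<in> {..<d}" for i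
    by (rule polyfun.sum_closed) (rule polyfun_mult[OF assms(1)[OF that] assms(2)])
  then have "(\<lambda>y. (\<Sum>j<d. f i j y * g j y) * (\<Sum>j<d. f i j y * g j y)) \<in> polyfun I" if "i \<in> {..<d}" for i
    using that by (intro polyfun_mult)
  then show ?thesis
    by (rule polyfun.sum_closed)
qed

text \<open>The bound on all \<open>x\<close> in the group is closed as an intersection of closed
  conditions. Semialgebraic predicates are not stable under infinite intersections; for them the
  quantifier over \<open>x\<close> is expressed by the variables \<open>Pt 0 l\<close> and
  eliminated.\<close>

lemma epigraph_cpt: "compact_on (insert Lev (Co ` {..<d})) (epigraph v b)"
proof -
  let ?I = "insert Lev (Co ` {..<d})"
  have "compact_on (Co ` {..<d}) (ex_on aux_vars (hull_pred v))"
    by (rule compact_on_ex_on[OF infinite_var finite_aux_vars _ _ hull_pred_cpt]) (auto simp: aux_vars_def)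
  then have H: "semialg (ex_on aux_vars (hull_pred v))" "closed_on (Co ` {..<d}) (ex_on aux_vars (hull_pred v))"
    "bounded_on (Co ` {..<d}) (ex_on aux_vars (hull_pred v))"
    unfolding compact_on_def by simp_all
  have Lev: "(\<lambda>y. y Lev) \<in> polyfun ?I"
    by (rule polyfun_var) simp
  have "bounded_on {Lev} (epigraph v b)"
    unfolding bounded_on_def epigraph_def by (intro exI[of _ b]) simp
  moreover have "bounded_on (Co ` {..<d}) (epigraph v b)"
    by (rule bounded_on_mono[OF H(3)]) (simp add: epigraph_def)
  ultimately have "bounded_on ?I (epigraph v b)"
    using bounded_on_Un by fastforce
  moreover have "closed_on ?I (epigraph v b)"
  proof -
    have "closed_on ?I (\<lambda>y. K x \<longrightarrow> sqnorm (ap x (\<lambda>i. y (Co i))) \<le> y Lev)" for x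
      unfolding sqnorm_def ap_def
      by (intro closed_on_imp_const closed_on_le[OF sqnorm_poly Lev] polyfun_const polyfun_var) simp
    then show ?thesis
      unfolding epigraph_def
      by (intro closed_on_conj closed_on_all closed_on_mono[OF H(2)] subset_insertI
          closed_on_le[OF polyfun_const Lev] closed_on_le[OF Lev polyfun_const])
  qed
  moreover have "semialg (epigraph v b)"
  proof -
    let ?J = "Pt 0 ` {..<N}"
    let ?Q = "\<lambda>y. K (\<lambda>l. y (Pt 0 l)) \<and> \<not> sqnorm (ap (\<lambda>l. y (Pt 0 l)) (\<lambda>i. y (Co i))) \<le> y Lev"
    have sK: "semialg K"
      using K_cpt unfolding compact_on_def by simp
    have "semialg (\<lambda>y. sqnorm (ap (\<lambda>l. y (Pt 0 l)) (\<lambda>i. y (Co i))) \<le> y Lev)"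
      unfolding sqnorm_def ap_def
      by (intro semialg_le[of _ UNIV] sqnorm_poly polyfun_var polyfun_mono[OF m_poly_Pt]) simp_all
    then have "semialg ?Q"
      by (intro semialg_conj semialg_not semialg_rename[OF sK])
    then have "semialg (\<lambda>y. \<not> ex_on ?J ?Q y)"
      by (intro semialg_not semialg_ex_on) simp_all
    moreover have "(\<forall>x. K x \<longrightarrow> sqnorm (ap x (\<lambda>i. y (Co i))) \<le> y Lev) \<longleftrightarrow> \<not> ex_on ?J ?Q y" for y
    proof
      assume l: "\<forall>x. K x \<longrightarrow> sqnorm (ap x (\<lambda>i. y (Co i))) \<le> y Lev"
      show "\<not> ex_on ?J ?Q y"
      proof
        assume "ex_on ?J ?Q y"
        then obtain z where z: "\<forall>i. i \<notin> ?J \<longrightarrow> z i = y i" "?Q z"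
          unfolding ex_on_def by blast
        have "z Lev = y Lev" "\<And>i. z (Co i) = y (Co i)"
          using z(1) by auto
        then show False
          using z(2) l[rule_format, of "\<lambda>l. z (Pt 0 l)"] by simp
      qed
    next
      assume r: "\<not> ex_on ?J ?Q y"
      show "\<forall>x. K x \<longrightarrow> sqnorm (ap x (\<lambda>i. y (Co i))) \<le> y Lev"
      proof (intro allI impI, rule ccontr)
        fix x assume x: "K x" "\<not> sqnorm (ap x (\<lambda>i. y (Co i))) \<le> y Lev"
        define z where "z u = (if u \<in> ?J then (case u of Pt k l \<Rightarrow> x l | _ \<Rightarrow> 0) else y u)" for u
        have zP: "z (Pt 0 l) = x l" if "l < N" for l
          using that by (simp add: z_def)
        have zC: "z (Co i) = y (Co i)" "z Lev = y Lev" for i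
          by (auto simp: z_def)
        have "sqnorm (ap (\<lambda>l. z (Pt 0 l)) (\<lambda>i. y (Co i))) = sqnorm (ap x (\<lambda>i. y (Co i)))"
          by (rule sqnorm_cong, rule ap_cong_point) (use zP in simp_all)
        moreover have "K (\<lambda>l. z (Pt 0 l))"
          by (rule K_cong[OF x(1)]) (use zP in simp)
        ultimately have "?Q z"
          using x(2) by (simp add: zC)
        moreover have zy: "\<forall>i. i \<notin> ?J \<longrightarrow> z i = y i"
          unfolding z_def by simp
        ultimately have "ex_on ?J ?Q y"
          by (intro ex_onI[OF zy])
        then show False
          using r by blast
      qed
    qed
    ultimately have "semialg (\<lambda>y. \<forall>x. K x \<longrightarrow> sqnorm (ap x (\<lambda>i. y (Co i))) \<le> y Lev)"
      by (simp only:)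
    then show ?thesis
      unfolding epigraph_def
      by (rule semialg_conj[OF H(1) semialg_conj[OF semialg_le[OF polyfun_const Lev]
          semialg_conj[OF semialg_le[OF Lev polyfun_const]]]])
  qed
  ultimately show ?thesis
    unfolding compact_on_def by blast
qed

text \<open>Let \<open>a\<close> attain the least level \<open>s\<close>. If
  \<open>c = ap x a\<close> differed from \<open>a\<close>, then \<open>c\<close> would also have
  level at most \<open>s\<close>, and by the parallelogram law their midpoint would have level at
  most \<open>s - \<epsilon> / 4\<close>, where \<open>\<epsilon>\<close> is the minimum over the
  group of the squared norm of the translates of \<open>a - c\<close>.\<close>

theorem hull_fixed_point: "\<exists>a. orbit_hull v a \<and> (\<forall>x. K x \<longrightarrow> (\<forall>i<d. ap x a i = a i))"
proof -
  have inf: "infinite (UNIV :: nat set)" by simp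
  have bK: "bounded_on {..<N} K"
    using K_cpt unfolding compact_on_def by simp
  obtain x0 where x0: "K x0" using K_ne by blast
  have sq_poly: "(\<lambda>x. sqnorm (ap x a)) \<in> polyfun {..<N}" for a
    unfolding sqnorm_def ap_def by (rule sqnorm_poly[OF m_poly polyfun_const]) simp_all
  have hull0: "orbit_hull v (ap x0 v)"
    by (rule hull_of_finite_combination[of "{0 :: nat}" "\<lambda>_. x0" "\<lambda>_. 1"]) (simp_all add: x0)
  obtain b0 where b0: "\<forall>x. K x \<longrightarrow> (\<forall>i\<in>{..<N}. \<bar>x i\<bar> \<le> b0)"
    using bK unfolding bounded_on_def by blast
  \<comment> \<open>\<open>b\<close> bounds the level of the hull point \<open>ap x0 v\<close>.
    Restricting to levels at most \<open>b\<close> makes the epigraph bounded without making it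
    empty.\<close>
  obtain b where b: "\<forall>x. (\<forall>i\<in>{..<N}. \<bar>x i\<bar> \<le> b0) \<longrightarrow> \<bar>sqnorm (ap x (ap x0 v))\<bar> \<le> b"
    using polyfun_bounded[OF sq_poly] by blast
  have b': "sqnorm (ap x (ap x0 v)) \<le> b" if "K x" for x
    using b b0 that sqnorm_nonneg by (metis abs_of_nonneg)
  define pt where "pt a s u = (case u of Co i \<Rightarrow> a i | Lev \<Rightarrow> s | _ \<Rightarrow> 0)" for a :: "nat \<Rightarrow> 'r" and s u
  have epi: "epigraph v b (pt a s) \<longleftrightarrow> orbit_hull v a \<and> 0 \<le> s \<and> s \<le> b \<and> (\<forall>x. K x \<longrightarrow> sqnorm (ap x a) \<le> s)" for a s
    unfolding epigraph_def ex_hull_pred by (simp add: pt_def)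
  have "0 \<le> b"
    using b'[OF x0] sqnorm_nonneg order_trans by blast
  then have "epigraph v b (pt (ap x0 v) b)"
    unfolding epi using hull0 b' by simp
  then have ne: "\<exists>y. epigraph v b y" by blast
  have "\<exists>y. epigraph v b y \<and> (\<forall>z. epigraph v b z \<longrightarrow> y Lev \<le> z Lev)"
    by (rule compact_on_minimum[OF infinite_var _ epigraph_cpt ne polyfun_var]) simp_all
  then obtain y where y: "epigraph v b y" "\<And>z. epigraph v b z \<Longrightarrow> y Lev \<le> z Lev"
    by blast
  define a s where "a = (\<lambda>i. y (Co i))" and "s = y Lev"
  have a: "orbit_hull v a" "0 \<le> s" "s \<le> b" "\<And>x. K x \<Longrightarrow> sqnorm (ap x a) \<le> s"
    using y(1) unfolding epigraph_def ex_hull_pred a_def s_def by simp_all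
  have min: "s \<le> t" if "epigraph v b (pt c t)" for c t
    using y(2)[OF that] by (simp add: s_def pt_def)
  have "ap x a i = a i" if x: "K x" and "i < d" for x i
  proof (rule ccontr)
    assume ne: "ap x a i \<noteq> a i"
    define c where "c = ap x a"
    have c: "orbit_hull v c" "\<And>z. K z \<Longrightarrow> sqnorm (ap z c) \<le> s"
    proof -
      show "orbit_hull v c"
        unfolding c_def by (rule hull_ap[OF a(1) x])
      fix z assume "K z"
      from ap_mult[OF this x] obtain z' where z': "K z'" "\<forall>v. \<forall>i<d. ap z' v i = ap z (ap x v) i"
        by blast
      have "sqnorm (ap z c) = sqnorm (ap z' a)"
        unfolding c_def by (rule sqnorm_cong) (simp add: z'(2))
      then show "sqnorm (ap z c) \<le> s"
        using a(4)[OF z'(1)] by simp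
    qed
    define e where "e = (\<lambda>i. a i - c i)"
    have "\<exists>z. K z \<and> (\<forall>z'. K z' \<longrightarrow> sqnorm (ap z e) \<le> sqnorm (ap z' e))"
      by (rule compact_on_minimum[OF inf _ K_cpt K_ne sq_poly]) simp
    then obtain z where z: "K z" "\<And>z'. K z' \<Longrightarrow> sqnorm (ap z e) \<le> sqnorm (ap z' e)"
      by blast
    define \<epsilon> where "\<epsilon> = sqnorm (ap z e)"
    \<comment> \<open>The minimum is attained at \<open>z\<close>, so it could vanish only if
      \<open>z\<close> mapped \<open>e\<close> to 0, which injectivity excludes.\<close>
    have "\<epsilon> > 0"
    proof (rule ccontr)
      assume "\<not> \<epsilon> > 0"
      then have "(\<Sum>i<d. ap z e i * ap z e i) = 0"
        using sqnorm_nonneg[of "ap z e"] unfolding \<epsilon>_def sqnorm_def by simp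
      then have "\<forall>i\<in>{..<d}. ap z e i * ap z e i = 0"
        by (subst (asm) sum_nonneg_eq_0_iff) simp_all
      then have "\<forall>i<d. (\<Sum>j<d. m i j z * e j) = 0"
        unfolding ap_def by simp
      then have "e i = 0"
        using m_inj[OF z(1)] \<open>i < d\<close> by blast
      then show False
        using ne by (simp add: e_def c_def)
    qed
    define p where "p = (\<lambda>i. (a i + c i) / 2)"
    have "sqnorm (ap x' p) \<le> s - \<epsilon> / 4" if "K x'" for x'
    proof -
      have "sqnorm (ap x' p) = sqnorm (\<lambda>i. (ap x' a i + ap x' c i) / 2)"
        unfolding p_def by (rule sqnorm_cong) (rule ap_mid)
      also have "\<dots> = (sqnorm (ap x' a) + sqnorm (ap x' c)) / 2 - sqnorm (\<lambda>i. ap x' a i - ap x' c i) / 4"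
        by (rule sqnorm_parallelogram)
      also have "sqnorm (\<lambda>i. ap x' a i - ap x' c i) = sqnorm (ap x' e)"
        unfolding e_def by (rule sqnorm_cong) (rule ap_diff[symmetric])
      finally show ?thesis
        using a(4)[OF that] c(2)[OF that] z(2)[OF that] unfolding \<epsilon>_def
        by (simp only:) (intro diff_mono; simp)
    qed
    note p = this
    have "0 \<le> s - \<epsilon> / 4"
      using p[OF x] sqnorm_nonneg order_trans by blast
    moreover have "s - \<epsilon> / 4 \<le> b"
      using a(3) \<open>\<epsilon> > 0\<close> by simp
    moreover have "orbit_hull v p"
      unfolding p_def by (rule hull_mid[OF a(1) c(1)])
    ultimately have "epigraph v b (pt p (s - \<epsilon> / 4))"
      unfolding epi using p by blast
    from min[OF this] show False
      using \<open>\<epsilon> > 0\<close> by simp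
  qed
  then show ?thesis
    using a(1) by blast
qed

end

section \<open>Evaluating tensors\<close>

text \<open>The universal property: a balanced biadditive map respects the generating relations,
  hence the congruence that they generate.\<close>

lemma tensor_eq_eval:
  fixes \<beta> :: "'a::comm_ring \<Rightarrow> 'b::comm_ring \<Rightarrow> 'd::ab_group_add"
  assumes "tensor_eq sA sB Z Y"
    and add1: "\<And>a a' b. \<beta> (a + a') b = \<beta> a b + \<beta> a' b"
    and add2: "\<And>a b b'. \<beta> a (b + b') = \<beta> a b + \<beta> a b'"
    and scale: "\<And>c a b. \<beta> (sA c a) b = \<beta> a (sB c b)"
  shows "(\<Sum>(a, b)\<in>#Z. \<beta> a b) = (\<Sum>(a, b)\<in>#Y. \<beta> a b)"
  using assms(1)
proof (induction rule: tensor_eq.induct)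
  case (zero b)
  have "\<beta> 0 b = \<beta> 0 b + \<beta> 0 b"
    using add1[of 0 0 b] by simp
  then show ?case by simp
qed (simp_all add: add1 add2 scale)

lemma tensor3_eq_eval:
  fixes \<beta> :: "'a::comm_ring \<Rightarrow> 'b::comm_ring \<Rightarrow> 'c::comm_ring \<Rightarrow> 'd::ab_group_add"
  assumes "tensor3_eq sA sB sC Z Y"
    and add1: "\<And>a a' b c. \<beta> (a + a') b c = \<beta> a b c + \<beta> a' b c"
    and add2: "\<And>a b b' c. \<beta> a (b + b') c = \<beta> a b c + \<beta> a b' c"
    and add3: "\<And>a b c c'. \<beta> a b (c + c') = \<beta> a b c + \<beta> a b c'"
    and scale12: "\<And>r a b c. \<beta> (sA r a) b c = \<beta> a (sB r b) c"
    and scale23: "\<And>r a b c. \<beta> a (sB r b) c = \<beta> a b (sC r c)"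
  shows "(\<Sum>(a, b, c)\<in>#Z. \<beta> a b c) = (\<Sum>(a, b, c)\<in>#Y. \<beta> a b c)"
  using assms(1)
proof (induction rule: tensor3_eq.induct)
  case (zero b c)
  have "\<beta> 0 b c = \<beta> 0 b c + \<beta> 0 b c"
    using add1[of 0 0 b c] by simp
  then show ?case by simp
next
  case (scale12 r a b c)
  then show ?case using assms(5) by simp
next
  case (scale23 r a b c)
  then show ?case using assms(6) by simp
qed (simp_all add: add1 add2 add3)

lemma sum_mset_additive:
  fixes f :: "'a::comm_monoid_add \<Rightarrow> 'b::ab_group_add"
  assumes "\<And>x y. f (x + y) = f x + f y"
  shows "f (\<Sum>x\<in>#Z. t x) = (\<Sum>x\<in>#Z. f (t x))"
proof (induction Z)
  case empty
  have "f 0 = f 0 + f 0"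
    using assms[of 0 0] by simp
  then show ?case by simp
qed (simp add: assms)

lemma sum_mset_nested:
  fixes F :: "'c \<Rightarrow> 'd::comm_monoid_add"
  shows "(\<Sum>z\<in>#(\<Sum>x\<in>#Z. image_mset (p x) (Y x)). F z) = (\<Sum>x\<in>#Z. \<Sum>y\<in>#Y x. F (p x y))"
  by (induction Z) (simp_all add: multiset.map_comp comp_def)

lemma tensor_mult_eval:
  fixes a :: "'a::comm_ring \<Rightarrow> 'd::comm_ring" and b :: "'b::comm_ring \<Rightarrow> 'd"
  assumes "\<And>x y. a (x * y) = a x * a y" "\<And>x y. b (x * y) = b x * b y"
  shows "(\<Sum>(u, v)\<in>#tensor_mult Z Y. a u * b v) = (\<Sum>(u, v)\<in>#Z. a u * b v) * (\<Sum>(u, v)\<in>#Y. a u * b v)"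
proof -
  have Y: "(\<Sum>(u', v')\<in>#Y. a (u * u') * b (v * v')) = a u * b v * (\<Sum>(u, v)\<in>#Y. a u * b v)" for u v
    by (induction Y) (auto simp: assms algebra_simps)
  have "(\<Sum>(u, v)\<in>#tensor_mult Z Y. a u * b v) =
    (\<Sum>(u, v)\<in>#Z. \<Sum>(u', v')\<in>#Y. a (u * u') * b (v * v'))"
    unfolding tensor_mult_def by (induction Z) (auto simp: multiset.map_comp comp_def case_prod_unfold)
  also have "\<dots> = (\<Sum>(u, v)\<in>#Z. a u * b v) * (\<Sum>(u, v)\<in>#Y. a u * b v)"
    unfolding Y by (induction Z) (auto simp: algebra_simps)
  finally show ?thesis .
qed

text \<open>The product of the compatible homomorphisms \<open>a\<close> and \<open>b\<close> is
  well defined on the tensor product and composes with \<open>\<phi>\<close> to a homomorphism. It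
  is used with values in R for products of group points, and with values in R[V] for the
  action.\<close>

lemma tensor_algebra_hom_eval:
  fixes a :: "'a::comm_ring \<Rightarrow> 'd::comm_ring" and b :: "'b::comm_ring \<Rightarrow> 'd"
  assumes hom: "tensor_algebra_hom sC eC sA eA sB eB \<phi>"
    and a: "\<And>x y. a (x + y) = a x + a y" "\<And>x y. a (x * y) = a x * a y" "\<And>c x. a (sA c x) = sD c (a x)"
    and b: "\<And>x y. b (x + y) = b x + b y" "\<And>x y. b (x * y) = b x * b y" "\<And>c x. b (sB c x) = sD c (b x)"
    and D: "\<And>c u v. sD c (u + v) = sD c u + sD c v" "\<And>c u v. sD c (u * v) = sD c u * v"
  defines "F \<equiv> \<lambda>z. \<Sum>(x, y)\<in>#\<phi> z. a x * b y"
  shows "F (x + y) = F x + F y" "F (sC c x) = sD c (F x)" "F (x * y) = F x * F y" "F eC = a eA * b eB"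
proof -
  have D2: "u * sD c v = sD c u * v" for c u v
    using D(2)[of c u v] D(2)[of c v u] by (simp add: mult.commute)
  have eval: "(\<Sum>(x, y)\<in>#Z. a x * b y) = (\<Sum>(x, y)\<in>#Y. a x * b y)" if "tensor_eq sA sB Z Y" for Z Y
    using that by (rule tensor_eq_eval) (simp_all add: a(1,3) b(1,3) D2 distrib_left distrib_right)
  have hom': "tensor_eq sA sB (\<phi> (x + y)) (\<phi> x + \<phi> y)"
    "tensor_eq sA sB (\<phi> (sC c x)) (image_mset (\<lambda>(a, b). (sA c a, b)) (\<phi> x))"
    "tensor_eq sA sB (\<phi> (x * y)) (tensor_mult (\<phi> x) (\<phi> y))"
    "tensor_eq sA sB (\<phi> eC) {#(eA, eB)#}"
    using hom unfolding tensor_algebra_hom_def by blast+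
  show "F (x + y) = F x + F y"
    unfolding F_def eval[OF hom'(1)] by simp
  show "F (x * y) = F x * F y"
    unfolding F_def eval[OF hom'(3)] by (rule tensor_mult_eval[OF a(2) b(2)])
  show "F eC = a eA * b eB"
    unfolding F_def eval[OF hom'(4)] by simp
  have "sD c (F x) = (\<Sum>(u, v)\<in>#\<phi> x. sD c (a u * b v))"
    unfolding F_def by (subst sum_mset_additive[of "sD c"]) (simp_all add: D case_prod_unfold)
  then show "F (sC c x) = sD c (F x)"
    unfolding F_def eval[OF hom'(2)]
    by (simp add: multiset.map_comp comp_def case_prod_unfold a D)
qed

section \<open>The action of the rational points\<close>

lemma vector_space_self: "vector_space ((*) :: 'r::field \<Rightarrow> 'r \<Rightarrow> 'r)"
  by unfold_locales (simp_all add: algebra_simps)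

lemma algebra_homD:
  assumes "algebra_hom sA eA sB eB \<phi>"
  shows "\<phi> (x + y) = \<phi> x + \<phi> y" "\<phi> (sA c x) = sB c (\<phi> x)" "\<phi> (x * y) = \<phi> x * \<phi> y" "\<phi> eA = eB"
  using assms unfolding algebra_hom_def Vector_Spaces.linear_iff by blast+

lemma algebra_homI:
  assumes "vector_space sA" "vector_space sB" "\<And>x y. \<phi> (x + y) = \<phi> x + \<phi> y" "\<And>c x. \<phi> (sA c x) = sB c (\<phi> x)"
    "\<And>x y. \<phi> (x * y) = \<phi> x * \<phi> y" "\<phi> eA = eB"
  shows "algebra_hom sA eA sB eB \<phi>"
  unfolding algebra_hom_def Vector_Spaces.linear_iff using assms by blast

context affine_G_variety
begin

abbreviation "points \<equiv> rational_points sG eG"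
abbreviation "ac \<equiv> act sV \<alpha>"
abbreviation "inv_ring \<equiv> invariants sG eG sV \<alpha>"

lemma point_hom:
  assumes "g \<in> points"
  shows "g (x + y) = g x + g y" "g (sG c x) = c * g x" "g (x * y) = g x * g y" "g eG = 1"
  using assms algebra_homD[of sG eG "(*)" 1 g] unfolding rational_points_def by simp_all

definition mul :: "('h \<Rightarrow> 'r) \<Rightarrow> ('h \<Rightarrow> 'r) \<Rightarrow> 'h \<Rightarrow> 'r" where
  "mul g g' h = (\<Sum>(h1, h2)\<in>#\<Delta> h. g h1 * g' h2)"

lemma mul_points:
  assumes "g \<in> points" "g' \<in> points"
  shows "mul g g' \<in> points"
proof -
  note g = point_hom[OF assms(1)] and g' = point_hom[OF assms(2)]
  note ev = tensor_algebra_hom_eval[OF G.comult_hom, of g "(*)" g']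
  have "algebra_hom sG eG (*) 1 (mul g g')"
  proof (rule algebra_homI)
    show "vector_space sG" by (rule G.vector_space_axioms)
    show "vector_space ((*) :: 'r \<Rightarrow> 'r \<Rightarrow> 'r)" by (rule vector_space_self)
    show "mul g g' (x + y) = mul g g' x + mul g g' y" for x y
      unfolding mul_def by (rule ev) (simp_all add: g g' algebra_simps)
    show "mul g g' (sG c x) = c * mul g g' x" for c x
      unfolding mul_def by (rule ev) (simp_all add: g g' algebra_simps)
    show "mul g g' (x * y) = mul g g' x * mul g g' y" for x y
      unfolding mul_def by (rule ev) (simp_all add: g g' algebra_simps)
    have "mul g g' eG = g eG * g' eG"
      unfolding mul_def by (rule ev) (simp_all add: g g' algebra_simps)
    then show "mul g g' eG = 1"
      by (simp add: g g')
  qed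
  then show ?thesis
    by (simp add: rational_points_def)
qed

lemma counit_point: "\<epsilon> \<in> points"
  using G.counit_hom by (simp add: rational_points_def)

lemma antipode_point:
  assumes "g \<in> points"
  shows "(\<lambda>h. g (S h)) \<in> points"
proof -
  note g = point_hom[OF assms] and s = algebra_homD[OF G.antipode_hom]
  have "algebra_hom sG eG (*) 1 (\<lambda>h. g (S h))"
    by (rule algebra_homI) (simp_all add: g s G.vector_space_axioms vector_space_self)
  then show ?thesis
    by (simp add: rational_points_def)
qed

lemma mul_antipode:
  assumes "g \<in> points"
  shows "mul g (\<lambda>h. g (S h)) = \<epsilon>"
proof
  fix x
  note g = point_hom[OF assms]
  have "mul g (\<lambda>h. g (S h)) x = (\<Sum>z\<in>#\<Delta> x. g (case z of (h, k) \<Rightarrow> h * S k))"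
    unfolding mul_def by (simp add: case_prod_unfold g)
  also have "\<dots> = g (\<Sum>(h, k)\<in>#\<Delta> x. h * S k)"
    by (rule sum_mset_additive[symmetric]) (rule g)
  also have "\<dots> = \<epsilon> x"
    unfolding G.antipode_right by (simp add: g)
  finally show "mul g (\<lambda>h. g (S h)) x = \<epsilon> x" .
qed

lemma V_scale_mult_right: "sV c (x * y) = x * sV c y"
  using V.scale_mult[of c y x] by (simp add: mult.commute)

text \<open>The scalars \<open>g h\<close> are turned into elements of R[V], so that the action
  takes the form of a product of two homomorphisms.\<close>

lemma ac_eq: "ac g f = (\<Sum>(h, f')\<in>#\<alpha> f. sV (g h) eV * f')"
  unfolding act_def by (simp add: V.unit_mult flip: V.scale_mult)

lemma ac_hom:
  assumes "g \<in> points"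
  shows "ac g (x + y) = ac g x + ac g y" "ac g (sV c x) = sV c (ac g x)" "ac g (x * y) = ac g x * ac g y"
    "ac g eV = eV"
proof -
  note g = point_hom[OF assms]
  have m: "sV (a * b) eV = sV a eV * sV b eV" for a b
    by (simp add: V.unit_mult flip: V.scale_mult V.scale_scale)
  note ev = tensor_algebra_hom_eval[OF coact_hom, of "\<lambda>h. sV (g h) eV" sV "\<lambda>f. f"]
  note simps = g m V.scale_left_distrib V.scale_right_distrib V.scale_scale V.scale_mult
  show "ac g (x + y) = ac g x + ac g y"
    unfolding ac_eq by (rule ev) (simp_all add: simps)
  show "ac g (sV c x) = sV c (ac g x)"
    unfolding ac_eq by (rule ev) (simp_all add: simps)
  show "ac g (x * y) = ac g x * ac g y"
    unfolding ac_eq by (rule ev) (simp_all add: simps)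
  have "ac g eV = sV (g eG) eV * eV"
    unfolding ac_eq by (rule ev) (simp_all add: simps)
  then show "ac g eV = eV"
    by (simp add: g V.unit_mult)
qed

lemma ac_zero: "g \<in> points \<Longrightarrow> ac g 0 = 0"
  using ac_hom(2)[of g 0 0] by simp

lemma ac_sum: "g \<in> points \<Longrightarrow> ac g (\<Sum>k\<in>A. f k) = (\<Sum>k\<in>A. ac g (f k))"
  by (induction A rule: infinite_finite_induct) (simp_all add: ac_zero ac_hom)

lemma ac_counit: "ac \<epsilon> f = f"
  unfolding act_def by (rule coact_counit)

text \<open>The order is reversed because \<open>f^g(x) = f(g x)\<close> defines a right action. The
  identity is the associativity axiom of the coaction, evaluated at \<open>g\<close> and
  \<open>g'\<close> in the two group factors.\<close>

lemma ac_mul: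
  assumes "g \<in> points" "g' \<in> points"
  shows "ac (mul g g') x = ac g' (ac g x)"
proof -
  note g = point_hom[OF assms(1)] and g' = point_hom[OF assms(2)]
  let ?\<beta> = "\<lambda>h1 h2 f. sV (g h1 * g' h2) f"
  have sV_sum: "sV (\<Sum>z\<in>#Z. t z) f = (\<Sum>z\<in>#Z. sV (t z) f)" for Z :: "('h \<times> 'h) multiset" and t f
    by (rule sum_mset_additive) (rule V.scale_left_distrib)
  have sV_sum': "sV c (\<Sum>z\<in>#Z. t z) = (\<Sum>z\<in>#Z. sV c (t z))" for Z :: "('h \<times> 'a) multiset" and t c
    by (rule sum_mset_additive) (rule V.scale_right_distrib)
  have ac_sum': "ac g' (\<Sum>z\<in>#Z. t z) = (\<Sum>z\<in>#Z. ac g' (t z))" for Z :: "('h \<times> 'a) multiset" and t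
    by (rule sum_mset_additive) (rule ac_hom(1)[OF assms(2)])
  have "ac (mul g g') x =
    (\<Sum>(h, f)\<in>#\<alpha> x. \<Sum>(h', h'')\<in>#\<Delta> h. ?\<beta> h' h'' f)"
    unfolding act_def mul_def by (simp add: case_prod_unfold sV_sum)
  also have "\<dots> = (\<Sum>(a, b, c)\<in>#(\<Sum>(h, f)\<in>#\<alpha> x. image_mset (\<lambda>(h', h''). (h', h'', f)) (\<Delta> h)). ?\<beta> a b c)"
    unfolding case_prod_unfold sum_mset_nested by simp
  also have "\<dots> = (\<Sum>(a, b, c)\<in>#(\<Sum>(h, f)\<in>#\<alpha> x. image_mset (\<lambda>(h', f'). (h, h', f')) (\<alpha> f)). ?\<beta> a b c)"
    by (rule tensor3_eq_eval[OF coact_assoc])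
      (simp_all add: g g' V.scale_left_distrib V.scale_right_distrib V.scale_scale algebra_simps)
  also have "\<dots> = (\<Sum>(h, f)\<in>#\<alpha> x. \<Sum>(h', f')\<in>#\<alpha> f. ?\<beta> h h' f')"
    unfolding case_prod_unfold sum_mset_nested by simp
  also have "\<dots> = (\<Sum>(h, f)\<in>#\<alpha> x. ac g' (sV (g h) f))"
    unfolding ac_hom(2)[OF assms(2)] unfolding act_def by (simp add: case_prod_unfold sV_sum')
  also have "\<dots> = ac g' (ac g x)"
    unfolding act_def[of sV \<alpha> g] case_prod_unfold ac_sum' by simp
  finally show ?thesis .
qed

text \<open>Translation by the inverse point, which the antipode provides, undoes
  \<open>ac g\<close>.\<close>

lemma ac_inj:
  assumes "g \<in> points" "ac g f = 0"
  shows "f = 0"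
proof -
  have "ac (mul g (\<lambda>h. g (S h))) f = 0"
    using assms by (simp add: ac_mul antipode_point ac_zero)
  then show ?thesis
    by (simp add: mul_antipode[OF assms(1)] ac_counit)
qed

end

section \<open>Polynomial functions on the group\<close>

text \<open>\<open>represents sc e xs c h\<close>: the polynomial function \<open>c\<close> in the coordinates given by the generators
  \<open>xs\<close> induces \<open>h\<close>.\<close>

inductive represents ::
  "('r::field \<Rightarrow> 'h::comm_ring \<Rightarrow> 'h) \<Rightarrow> 'h \<Rightarrow> 'h list \<Rightarrow> ((nat \<Rightarrow> 'r) \<Rightarrow> 'r) \<Rightarrow> 'h \<Rightarrow> bool"
  for sc e xs where
  rep_const: "represents sc e xs (\<lambda>x. a) (sc a e)"
| rep_var: "i < length xs \<Longrightarrow> represents sc e xs (\<lambda>x. x i) (xs ! i)"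
| rep_add: "represents sc e xs c h \<Longrightarrow> represents sc e xs d k \<Longrightarrow> represents sc e xs (\<lambda>x. c x + d x) (h + k)"
| rep_mult: "represents sc e xs c h \<Longrightarrow> represents sc e xs d k \<Longrightarrow> represents sc e xs (\<lambda>x. c x * d x) (h * k)"

lemma represents_polyfun: "represents sc e xs c h \<Longrightarrow> c \<in> polyfun {..<length xs}"
  by (induction rule: represents.induct) (auto intro: polyfun.intros)

context affine_variety
begin

lemma scale_unit_mult: "scale c e * x = scale c x"
  by (simp add: unit_mult flip: scale_mult)

lemma represents_scale: "represents scale e xs c h \<Longrightarrow> represents scale e xs (\<lambda>x. a * c x) (scale a h)"
  using rep_mult[OF rep_const, of scale e xs c h a] by (simp add: scale_unit_mult)

lemma represents_exists:
  assumes "generates scale e (set xs)"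
  shows "\<exists>c. represents scale e xs c h"
proof -
  let ?T = "{h. \<exists>c. represents scale e xs c h}"
  have "subalgebra scale e ?T"
    unfolding subalgebra_def subspace_def
  proof (intro conjI ballI allI)
    show "0 \<in> ?T"
      using rep_const[of scale e xs 0] by auto
    show "e \<in> ?T"
      using rep_const[of scale e xs 1] by auto
  qed (auto intro: rep_add rep_mult represents_scale)
  moreover have "set xs \<subseteq> ?T"
    using rep_var[of _ xs scale e] by (fastforce simp: in_set_conv_nth)
  ultimately have "subalgebra scale e hull set xs \<subseteq> ?T"
    by (intro hull_minimal)
  then show ?thesis
    using assms by (auto simp: generates_def)
qed

lemma represents_eval:
  assumes "represents scale e xs c h" "g \<in> rational_points scale e" "\<And>i. i < length xs \<Longrightarrow> x i = g (xs ! i)"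
  shows "c x = g h"
proof -
  have "algebra_hom scale e (*) 1 g"
    using assms(2) by (simp add: rational_points_def)
  note g = algebra_homD[OF this]
  show ?thesis
    using assms(1) by (induction rule: represents.induct) (simp_all add: g assms(3))
qed

text \<open>In the nontrivial direction, a vector that satisfies all relations defines a point by
  evaluating any polynomial that represents \<open>h\<close>: two representatives differ by a
  relation, so the value does not depend on the choice.\<close>

lemma rational_points_coordinates:
  assumes gen: "generates scale e (set xs)"
  shows "(\<exists>g\<in>rational_points scale e. \<forall>i<length xs. x i = g (xs ! i)) \<longleftrightarrow>
    (\<forall>c\<in>{c. represents scale e xs c 0}. c x = 0)"
proof
  assume "\<exists>g\<in>rational_points scale e. \<forall>i<length xs. x i = g (xs ! i)"
  then obtain g where g: "g \<in> rational_points scale e" "\<And>i. i < length xs \<Longrightarrow> x i = g (xs ! i)"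
    by blast
  have "algebra_hom scale e (*) 1 g"
    using g(1) by (simp add: rational_points_def)
  from algebra_homD(2)[OF this, of 0 0] have "g 0 = 0"
    by simp
  show "\<forall>c\<in>{c. represents scale e xs c 0}. c x = 0"
  proof
    fix c assume "c \<in> {c. represents scale e xs c 0}"
    then have "represents scale e xs c 0"
      by simp
    from represents_eval[OF this g] show "c x = 0"
      using \<open>g 0 = 0\<close> by simp
  qed
next
  assume z: "\<forall>c\<in>{c. represents scale e xs c 0}. c x = 0"
  define g where "g h = (SOME c. represents scale e xs c h) x" for h
  have g: "g h = c x" if "represents scale e xs c h" for c h
  proof -
    let ?d = "SOME c. represents scale e xs c h"
    have "represents scale e xs ?d h"
      using that by (rule someI[of "\<lambda>c. represents scale e xs c h" c])
    from rep_add[OF that represents_scale[OF this, of "-1"]]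
    have "represents scale e xs (\<lambda>x. c x + -1 * ?d x) 0"
      by simp
    then have "(\<lambda>x. c x + -1 * ?d x) \<in> {c. represents scale e xs c 0}"
      by (simp only: mem_Collect_eq)
    from bspec[OF z this] have "c x + -1 * ?d x = 0" .
    then show ?thesis
      by (simp add: g_def)
  qed
  obtain p where p: "\<And>h. represents scale e xs (p h) h"
    using represents_exists[OF gen] by metis
  have "algebra_hom scale e (*) 1 g"
  proof (rule algebra_homI)
    show "g (a + b) = g a + g b" for a b
      using g[OF rep_add[OF p p, of a b]] g[OF p, of a] g[OF p, of b] by simp
    show "g (a * b) = g a * g b" for a b
      using g[OF rep_mult[OF p p, of a b]] g[OF p, of a] g[OF p, of b] by simp
    show "g (scale c a) = c * g a" for c a
      using g[OF represents_scale[OF p, of c a]] g[OF p, of a] by simp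
    show "g e = 1"
      using g[OF rep_const, of 1] by simp
  qed (rule vector_space_axioms vector_space_self)+
  moreover have "x i = g (xs ! i)" if "i < length xs" for i
    using g[OF rep_var[OF that]] by simp
  ultimately show "\<exists>g\<in>rational_points scale e. \<forall>i<length xs. x i = g (xs ! i)"
    by (auto simp: rational_points_def)
qed

end

text \<open>By the basis theorem finitely many relations cut out the points, which makes them
  semialgebraic; closedness and boundedness are translated from coordinate lists to
  functions.\<close>

lemma compact_rational_points:
  fixes sc :: "'r::real_closed_field \<Rightarrow> 'h::comm_ring \<Rightarrow> 'h"
  assumes var: "affine_variety sc e" and gen: "generates sc e (set xs)"
    and cl: "closed_in_power (length xs) ((\<lambda>g. map g xs) ` rational_points sc e)"
    and bd: "bounded_in_power (length xs) ((\<lambda>g. map g xs) ` rational_points sc e)"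
  shows "compact_on {..<length xs} (\<lambda>x. \<exists>g\<in>rational_points sc e. \<forall>i<length xs. x i = g (xs ! i))" (is "compact_on ?I ?K")
proof -
  let ?F = "{c. represents sc e xs c 0}"
  have K: "?K x \<longleftrightarrow> (\<forall>c\<in>?F. c x = 0)" for x
    by (rule affine_variety.rational_points_coordinates[OF var gen])
  have "?F \<subseteq> polyfun ?I"
    using represents_polyfun by blast
  from finite_equations_suffice[OF finite_lessThan this]
  obtain B where B: "B \<subseteq> ?F" "finite B" "\<forall>x. (\<forall>c\<in>B. c x = 0) \<longrightarrow> (\<forall>c\<in>?F. c x = 0)"
    by blast
  have KB: "?K x \<longleftrightarrow> (\<forall>c\<in>B. c x = 0)" for x
    unfolding K using B(1,3) by blast
  have "semialg (\<lambda>x. c x = 0)" if "c \<in> B" for c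
  proof -
    have "c \<in> polyfun ?I"
      using that B(1) represents_polyfun by blast
    then show ?thesis
      by (rule semialg_eq[OF _ polyfun_const])
  qed
  then have "semialg (\<lambda>x. \<forall>c\<in>B. c x = 0)"
    by (rule semialg_ball[OF B(2)])
  then have "semialg ?K"
    unfolding KB .
  moreover have "bounded_on ?I ?K"
  proof -
    obtain b where b: "\<forall>p\<in>(\<lambda>g. map g xs) ` rational_points sc e. \<forall>i<length xs. \<bar>p ! i\<bar> \<le> b"
      using bd unfolding bounded_in_power_def by blast
    have "\<bar>x i\<bar> \<le> b" if x: "?K x" and i: "i \<in> ?I" for x i
    proof -
      obtain g where "g \<in> rational_points sc e" "\<forall>i<length xs. x i = g (xs ! i)"
        using x by blast
      then show ?thesis
        using b i by force
    qed
    then show ?thesis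
      unfolding bounded_on_def by blast
  qed
  moreover have "closed_on ?I ?K"
    unfolding closed_on_def
  proof (intro allI impI)
    fix x assume x: "\<forall>\<delta>>0. \<exists>y. ?K y \<and> (\<forall>i\<in>?I. \<bar>x i - y i\<bar> < \<delta>)"
    define p where "p = map x [0..<length xs]"
    have "\<forall>\<delta>>0. \<exists>q\<in>(\<lambda>g. map g xs) ` rational_points sc e. \<forall>i<length xs. \<bar>p ! i - q ! i\<bar> < \<delta>"
    proof (intro allI impI)
      fix \<delta> :: 'r assume "\<delta> > 0"
      then obtain y where y: "?K y" "\<forall>i\<in>?I. \<bar>x i - y i\<bar> < \<delta>"
        using x by blast
      then obtain g where g: "g \<in> rational_points sc e" "\<forall>i<length xs. y i = g (xs ! i)"
        by blast
      have "\<forall>i<length xs. \<bar>p ! i - map g xs ! i\<bar> < \<delta>"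
        using y(2) g(2) by (simp add: p_def)
      then show "\<exists>q\<in>(\<lambda>g. map g xs) ` rational_points sc e. \<forall>i<length xs. \<bar>p ! i - q ! i\<bar> < \<delta>"
        using g(1) by blast
    qed
    then have "p \<in> (\<lambda>g. map g xs) ` rational_points sc e"
      using cl unfolding closed_in_power_def by (simp add: p_def)
    then obtain g where g: "g \<in> rational_points sc e" "p = map g xs"
      by blast
    have "x i = g (xs ! i)" if "i < length xs" for i
      using arg_cong[OF g(2), of "\<lambda>l. l ! i"] that by (simp add: p_def)
    then show "?K x"
      using g(1) by blast
  qed
  ultimately show ?thesis
    unfolding compact_on_def by blast
qed

section \<open>Averaging operators\<close>

locale compact_affine_G_variety =
  affine_G_variety sG eG \<Delta> \<epsilon> S sV eV \<alpha>
  for sG :: "'r::real_closed_field \<Rightarrow> 'h::comm_ring \<Rightarrow> 'h" and eG \<Delta> \<epsilon> S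
    and sV :: "'r \<Rightarrow> 'a::comm_ring \<Rightarrow> 'a" and eV \<alpha> +
  assumes compact: "semialgebraically_compact sG eG"
begin

text \<open>Iterated finite convex combinations of translations, in place of integration over the
  group. Since combinations of averages are again allowed, closure under composition is a plain
  induction.\<close>

inductive avg :: "('a \<Rightarrow> 'a) \<Rightarrow> bool" where
  avg_point: "g \<in> points \<Longrightarrow> avg (ac g)"
| avg_convex: "finite (A :: nat set) \<Longrightarrow> (\<forall>k\<in>A. avg (T k)) \<Longrightarrow> (\<forall>k\<in>A. 0 \<le> w k) \<Longrightarrow> sum w A = 1 \<Longrightarrow>
    avg (\<lambda>f. \<Sum>k\<in>A. sV (w k) (T k f))"

lemma avg_add: "avg T \<Longrightarrow> T (x + y) = T x + T y"
proof (induction arbitrary: x y rule: avg.induct)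
  case (avg_convex A T w)
  have "(\<Sum>k\<in>A. sV (w k) (T k (x + y))) = (\<Sum>k\<in>A. sV (w k) (T k x) + sV (w k) (T k y))"
    by (intro sum.cong HOL.refl) (use avg_convex.IH in \<open>simp add: V.scale_right_distrib\<close>)
  then show ?case by (simp add: sum.distrib)
qed (rule ac_hom)

lemma avg_zero: "avg T \<Longrightarrow> T 0 = 0"
  using avg_add[of T 0 0] by simp

lemma avg_mult_invariant: "avg T \<Longrightarrow> u \<in> inv_ring \<Longrightarrow> T (u * x) = u * T x"
proof (induction arbitrary: x rule: avg.induct)
  case (avg_point g)
  then show ?case by (simp add: ac_hom invariants_def)
next
  case (avg_convex A T w)
  have "(\<Sum>k\<in>A. sV (w k) (T k (u * x))) = (\<Sum>k\<in>A. u * sV (w k) (T k x))"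
  proof (rule sum.cong[OF HOL.refl])
    fix k assume "k \<in> A"
    then have "T k (u * x) = u * T k x"
      using avg_convex by blast
    then show "sV (w k) (T k (u * x)) = u * sV (w k) (T k x)"
      by (simp add: V_scale_mult_right)
  qed
  then show ?case by (simp add: sum_distrib_left)
qed

lemma avg_invariant: "avg T \<Longrightarrow> u \<in> inv_ring \<Longrightarrow> T u = u"
proof (induction rule: avg.induct)
  case (avg_point g)
  then show ?case by (simp add: invariants_def)
next
  case (avg_convex A T w)
  have "(\<Sum>k\<in>A. sV (w k) (T k u)) = (\<Sum>k\<in>A. sV (w k) u)"
    by (intro sum.cong HOL.refl) (use avg_convex in simp)
  also have "\<dots> = sV (sum w A) u"
    by (simp add: V.scale_sum_left)
  finally show ?case
    using avg_convex.hyps by simp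
qed

lemma avg_subspace: "avg T \<Longrightarrow> V.subspace N \<Longrightarrow> G_invariant sG eG sV \<alpha> N \<Longrightarrow> n \<in> N \<Longrightarrow> T n \<in> N"
proof (induction rule: avg.induct)
  case (avg_point g)
  then show ?case by (simp add: G_invariant_def)
next
  case (avg_convex A T w)
  show ?case
    by (rule V.subspace_sum[OF avg_convex.prems(1)], rule V.subspace_scale[OF avg_convex.prems(1)])
      (use avg_convex in blast)
qed

text \<open>\<open>c\<close> is a square in R, so multiplication by \<open>c\<close> is
  multiplication by a square in R[V]; this makes quadratic modules convex cones.\<close>

lemma quadratic_module_scale:
  assumes "quadratic_module UNIV eV M" "f \<in> M" "0 \<le> c"
  shows "sV c f \<in> M"
proof -
  obtain y where y: "c = y * y"
    using nonneg_imp_square[OF assms(3)] by blast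
  have "sV y eV * sV y eV * f \<in> M"
    using assms(1,2) unfolding quadratic_module_def by blast
  also have "sV y eV * sV y eV * f = sV c f"
    by (simp add: y V.unit_mult flip: V.scale_mult)
  finally show ?thesis .
qed

lemma quadratic_module_zero: "quadratic_module UNIV eV M \<Longrightarrow> 0 \<in> M"
  unfolding quadratic_module_def by (metis UNIV_I mult_zero_left)

lemma avg_quadratic_module:
  "avg T \<Longrightarrow> quadratic_module UNIV eV M \<Longrightarrow> G_invariant sG eG sV \<alpha> M \<Longrightarrow> f \<in> M \<Longrightarrow> T f \<in> M"
proof (induction rule: avg.induct)
  case (avg_point g)
  then show ?case by (simp add: G_invariant_def)
next
  case (avg_convex A T w)
  have TM: "sV (w k) (T k f) \<in> M" if "k \<in> A" for k
  proof (rule quadratic_module_scale[OF avg_convex.prems(1)])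
    show "T k f \<in> M"
      using avg_convex.IH avg_convex.prems that by blast
    show "0 \<le> w k"
      using avg_convex.hyps(2) that by blast
  qed
  have sum_M: "sum h B \<in> M" if "finite B" "\<forall>k\<in>B. h k \<in> M" for h and B :: "nat set"
    using that
  proof (induction B rule: finite_induct)
    case empty
    show ?case using quadratic_module_zero[OF avg_convex.prems(1)] by simp
  next
    case (insert k B)
    then have "h k \<in> M" "sum h B \<in> M" by simp_all
    then show ?case
      using avg_convex.prems(1) insert.hyps unfolding quadratic_module_def by simp
  qed
  show ?case
    by (rule sum_M[OF avg_convex.hyps(1)]) (use TM in simp)
qed

lemma avg_comp:
  assumes "avg T" "avg T'"
  shows "avg (\<lambda>f. T (T' f))"
  using assms(1)
proof (induction rule: avg.induct)
  case (avg_point g)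
  show ?case
    using assms(2)
  proof (induction rule: avg.induct)
    case (avg_point g')
    have "(\<lambda>f. ac g (ac g' f)) = ac (mul g' g)"
      by (rule ext) (rule ac_mul[OF avg_point \<open>g \<in> points\<close>, symmetric])
    then show ?case
      using avg.avg_point[OF mul_points[OF avg_point \<open>g \<in> points\<close>]] by simp
  next
    case (avg_convex A T w)
    have "avg (\<lambda>f. \<Sum>k\<in>A. sV (w k) (ac g (T k f)))"
      by (rule avg.avg_convex[OF avg_convex.hyps(1)]) (use avg_convex in blast)+
    then show ?case
      by (simp add: ac_sum[OF \<open>g \<in> points\<close>] ac_hom[OF \<open>g \<in> points\<close>])
  qed
next
  case (avg_convex A T w)
  show ?case
    by (rule avg.avg_convex[OF avg_convex.hyps(1), of "\<lambda>k f. T k (T' f)"]) (use avg_convex in blast)+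
qed

text \<open>Local finiteness of the action: the right-hand factors of the tensor
  \<open>\<alpha> f\<close> do not depend on \<open>g\<close>.\<close>

lemma orbit_in_span: "ac g f \<in> V.span (snd ` set_mset (\<alpha> f))"
proof -
  have "(\<Sum>z\<in>#Z. sV (g (fst z)) (snd z)) \<in> V.span (snd ` set_mset Z)" for Z :: "('h \<times> 'a) multiset"
  proof (induction Z)
    case empty
    show ?case by (simp add: V.span_zero)
  next
    case (add z Z)
    have "(\<Sum>z\<in>#Z. sV (g (fst z)) (snd z)) \<in> V.span (snd ` set_mset (add_mset z Z))"
      using add V.span_mono[of "snd ` set_mset Z" "snd ` set_mset (add_mset z Z)"] by auto
    moreover have "sV (g (fst z)) (snd z) \<in> V.span (snd ` set_mset (add_mset z Z))"
      by (intro V.span_scale V.span_base) simp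
    ultimately show ?case
      using V.span_add by simp
  qed
  then show ?thesis
    by (simp add: act_def case_prod_unfold)
qed

text \<open>The coordinate functionals are extended from the span of \<open>B\<close> to all of
  R[V], because they will be applied to the factors of \<open>\<alpha> (b j)\<close>, which may lie
  outside that span.\<close>

lemma coordinates_exist:
  assumes "V.independent B" "finite B"
  obtains b d c where "bij_betw b {..<d :: nat} B"
    "\<forall>i x y. c i (x + y) = c i x + c i y" "\<forall>i a x. c i (sV a x) = a * c i x"
    "\<forall>x\<in>V.span B. x = (\<Sum>i<d. sV (c i x) (b i))"
    "\<forall>i<d. \<forall>j<d. c i (b j) = (if i = j then 1 else 0)"
proof -
  interpret P: vector_space_pair sV "(*) :: 'r \<Rightarrow> 'r \<Rightarrow> 'r"
    by (intro vector_space_pair.intro V.vector_space_axioms vector_space_self)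
  obtain b where b: "bij_betw b {..<card B} B"
    using ex_bij_betw_nat_finite[OF assms(2)] by (auto simp: atLeast0LessThan)
  have "\<forall>i. \<exists>c. Vector_Spaces.linear sV (*) c \<and> (\<forall>x\<in>B. c x = (if x = b i then 1 else 0))"
    by (intro allI P.linear_independent_extend[OF assms(1)])
  from choice[OF this] obtain c where
    c: "\<And>i. Vector_Spaces.linear sV (*) (c i)" "\<And>i x. x \<in> B \<Longrightarrow> c i x = (if x = b i then 1 else 0)"
    by blast
  have lin: "c i (x + y) = c i x + c i y" "c i (sV a x) = a * c i x" for i x y a
    using c(1)[of i] unfolding Vector_Spaces.linear_iff by blast+
  have sum: "c i (sum h A) = (\<Sum>k\<in>A. c i (h k))" for i h and A :: "nat set"
  proof (induction A rule: infinite_finite_induct)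
    case empty
    show ?case using lin(2)[of i 0 0] by simp
  next
    case (infinite A)
    then show ?case using lin(2)[of i 0 0] by simp
  qed (simp add: lin)
  have bB: "b j \<in> B" if "j < card B" for j
    using b that by (auto simp: bij_betw_def)
  have delta: "c i (b j) = (if i = j then 1 else 0)" if "i < card B" "j < card B" for i j
  proof -
    have "b j = b i \<longleftrightarrow> j = i"
      using b that by (auto simp: bij_betw_def inj_on_def)
    then show ?thesis
      using c(2)[OF bB[OF that(2)], of i] by auto
  qed
  have "x = (\<Sum>i<card B. sV (c i x) (b i))" if x: "x \<in> V.span B" for x
  proof -
    obtain u where u: "x = (\<Sum>v\<in>B. sV (u v) v)"
      using x V.span_finite[OF assms(2)] by auto
    have x': "x = (\<Sum>j<card B. sV (u (b j)) (b j))"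
      unfolding u by (rule sum.reindex_bij_betw[OF b, symmetric])
    have "c i x = u (b i)" if "i < card B" for i
    proof -
      have "c i x = (\<Sum>j<card B. u (b j) * c i (b j))"
        by (subst x') (simp add: sum lin)
      also have "\<dots> = (\<Sum>j<card B. if j = i then u (b j) else 0)"
        by (intro sum.cong HOL.refl) (use delta[OF that] in auto)
      finally show ?thesis
        using that by simp
    qed
    then have "(\<Sum>i<card B. sV (c i x) (b i)) = (\<Sum>j<card B. sV (u (b j)) (b j))"
      by (intro sum.cong HOL.refl) simp
    then show ?thesis
      using x' by simp
  qed
  then show ?thesis
    using that[OF b, of c] lin delta by blast
qed

text \<open>The orbit of \<open>n\<close> spans a finite-dimensional stable space on which the group
  acts by a compact group of matrices. A fixed point of the orbit hull is the value at
  \<open>n\<close> of an average; it is invariant and lies in \<open>N\<close>, hence is 0.\<close>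

lemma invariant_subspace_annihilated:
  assumes N: "V.subspace N" "G_invariant sG eG sV \<alpha> N" "inv_ring \<inter> N = {0}" and n: "n \<in> N"
  shows "\<exists>T. avg T \<and> T n = 0"
proof -
  define orb where "orb = (\<lambda>g. ac g n) ` points"
  \<comment> \<open>A basis taken from the orbit itself: translates of basis vectors stay in the
    orbit, hence in the span.\<close>
  obtain B where B: "B \<subseteq> orb" "V.independent B" "orb \<subseteq> V.span B"
    using V.maximal_independent_subset[of orb] by blast
  have "B \<subseteq> V.span (snd ` set_mset (\<alpha> n))"
    using B(1) orbit_in_span unfolding orb_def by blast
  then have "finite B"
    using V.independent_span_bound[OF _ B(2)] by blast
  obtain b d c where b: "bij_betw b {..<d :: nat} B" and coords:
    "\<forall>i x y. c i (x + y) = c i x + c i y" "\<forall>i a x. c i (sV a x) = a * c i x"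
    "\<forall>x\<in>V.span B. x = (\<Sum>i<d. sV (c i x) (b i))"
    "\<forall>i<d. \<forall>j<d. c i (b j) = (if i = j then 1 else 0)"
    using coordinates_exist[OF B(2) \<open>finite B\<close>] .
  note c_add = coords(1)[rule_format] and c_scale = coords(2)[rule_format]
    and span = coords(3)[rule_format] and delta = coords(4)[rule_format]
  have c0: "c i 0 = 0" for i
    using c_scale[of i 0 0] by simp
  have c_sum: "c i (sum h A) = (\<Sum>k\<in>A. c i (h k))" for i h and A :: "nat set"
    by (induction A rule: infinite_finite_induct) (simp_all add: c0 c_add)
  have b_orb: "b j \<in> orb" if "j < d" for j
    using b B(1) that by (auto simp: bij_betw_def)
  have ac_orb: "ac g x \<in> orb" if g: "g \<in> points" and x: "x \<in> orb" for g x
  proof -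
    obtain g' where g': "g' \<in> points" "x = ac g' n"
      using x unfolding orb_def by blast
    show ?thesis
      unfolding orb_def g'(2) ac_mul[OF g'(1) g, symmetric] by (intro imageI mul_points g' g)
  qed
  have ac_b: "ac g (b j) = (\<Sum>i<d. sV (c i (ac g (b j))) (b i))" if "g \<in> points" "j < d" for g j
    by (rule span) (use B(3) ac_orb[OF that(1) b_orb[OF that(2)]] in blast)
  have ac_comb: "ac g (\<Sum>j<d. sV (w j) (b j)) = (\<Sum>i<d. sV (\<Sum>j<d. c i (ac g (b j)) * w j) (b i))"
    if g: "g \<in> points" for g w
  proof -
    have "ac g (\<Sum>j<d. sV (w j) (b j)) = (\<Sum>j<d. sV (w j) (ac g (b j)))"
      by (simp add: ac_sum[OF g] ac_hom[OF g])
    also have "\<dots> = (\<Sum>j<d. \<Sum>i<d. sV (c i (ac g (b j)) * w j) (b i))"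
    proof (rule sum.cong[OF HOL.refl])
      fix j assume "j \<in> {..<d}"
      then have "sV (w j) (ac g (b j)) = sV (w j) (\<Sum>i<d. sV (c i (ac g (b j))) (b i))"
        using ac_b[OF g, of j] by simp
      also have "\<dots> = (\<Sum>i<d. sV (c i (ac g (b j)) * w j) (b i))"
        by (simp add: V.scale_sum_right V.scale_scale mult.commute)
      finally show "sV (w j) (ac g (b j)) = (\<Sum>i<d. sV (c i (ac g (b j)) * w j) (b i))" .
    qed
    also have "\<dots> = (\<Sum>i<d. \<Sum>j<d. sV (c i (ac g (b j)) * w j) (b i))"
      by (rule sum.swap)
    finally show ?thesis
      by (simp add: V.scale_sum_left)
  qed
  obtain xs where xs: "generates sG eG (set xs)"
    "closed_in_power (length xs) ((\<lambda>g. map g xs) ` points)"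
    "bounded_in_power (length xs) ((\<lambda>g. map g xs) ` points)"
    using compact unfolding semialgebraically_compact_def by blast
  define K where "K x \<longleftrightarrow> (\<exists>g\<in>points. \<forall>i<length xs. x i = g (xs ! i))" for x
  have K_cpt: "compact_on {..<length xs} K"
    unfolding K_def by (rule compact_rational_points[OF G.affine_variety_axioms xs])
  \<comment> \<open>The matrix coefficient as an element of the coordinate ring of G; a polynomial
    that represents it expresses the matrix entry in the coordinates of \<open>g\<close>.\<close>
  define H where "H i j = (\<Sum>(h, f)\<in>#\<alpha> (b j). sG (c i f) h)" for i j
  have H: "g (H i j) = c i (ac g (b j))" if g: "g \<in> points" for g i j
  proof -
    have "g (H i j) = (\<Sum>(h, f)\<in>#\<alpha> (b j). c i f * g h)"
      unfolding H_def by (subst sum_mset_additive[of g]) (simp_all add: point_hom[OF g] case_prod_unfold)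
    moreover have "c i (ac g (b j)) = (\<Sum>(h, f)\<in>#\<alpha> (b j). g h * c i f)"
      unfolding act_def by (subst sum_mset_additive[of "c i"]) (simp_all add: c_add c_scale case_prod_unfold)
    ultimately show ?thesis
      by (simp add: mult.commute)
  qed
  obtain p where p: "\<And>h. represents sG eG xs (p h) h"
    using G.represents_exists[OF xs(1)] by metis
  define m where "m i j = p (H i j)" for i j
  have m: "m i j x = c i (ac g (b j))" if "g \<in> points" "\<forall>i<length xs. x i = g (xs ! i)" for x g i j
    unfolding m_def H[OF that(1), symmetric] by (rule G.represents_eval[OF p that(1)]) (use that(2) in blast)
  define env where "env g i = g (xs ! i)" for g :: "'h \<Rightarrow> 'r" and i
  have env: "K (env g)" "m i j (env g) = c i (ac g (b j))" if "g \<in> points" for g i j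
    using that m[OF that, of "env g"] unfolding K_def by (auto simp: env_def)
  interpret M: compact_matrix_group K m "length xs" d
  proof
    show "compact_on {..<length xs} K" by (rule K_cpt)
    show "\<exists>x. K x"
      using env(1)[OF counit_point] by blast
    show "m i j \<in> polyfun {..<length xs}" for i j
      unfolding m_def by (rule represents_polyfun[OF p])
  next
    fix x y assume "K x" "K y"
    then obtain g g' where g: "g \<in> points" "\<forall>i<length xs. x i = g (xs ! i)"
      and g': "g' \<in> points" "\<forall>i<length xs. y i = g' (xs ! i)"
      unfolding K_def by blast
    \<comment> \<open>The matrix product corresponds to the reversed product of points, because
      translation is a right action.\<close>
    note z = mul_points[OF g'(1) g(1)]
    have "m i j (env (mul g' g)) = (\<Sum>k<d. m i k x * m k j y)" if "i < d" "j < d" for i j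
    proof -
      have "m i j (env (mul g' g)) = c i (ac g (ac g' (b j)))"
        unfolding env(2)[OF z] ac_mul[OF g'(1) g(1)] ..
      also have "ac g (ac g' (b j)) = ac g (\<Sum>k<d. sV (c k (ac g' (b j))) (b k))"
        using ac_b[OF g'(1) that(2)] by simp
      also have "c i \<dots> = (\<Sum>k<d. c k (ac g' (b j)) * c i (ac g (b k)))"
        by (simp add: ac_sum[OF g(1)] ac_hom[OF g(1)] c_sum c_scale)
      finally show ?thesis
        unfolding m[OF g] m[OF g'] by (simp add: mult.commute)
    qed
    then show "\<exists>z. K z \<and> (\<forall>i<d. \<forall>j<d. m i j z = (\<Sum>k<d. m i k x * m k j y))"
      using env(1)[OF z] by blast
  next
    fix x w j assume "K x" and w: "\<forall>i<d. (\<Sum>j<d. m i j x * w j) = 0" and j: "j < d"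
    then obtain g where g: "g \<in> points" "\<forall>i<length xs. x i = g (xs ! i)"
      unfolding K_def by blast
    have "ac g (\<Sum>j<d. sV (w j) (b j)) = 0"
      unfolding ac_comb[OF g(1)] m[OF g, symmetric] using w by simp
    then have "(\<Sum>j<d. sV (w j) (b j)) = 0"
      by (rule ac_inj[OF g(1)])
    then have "0 = (\<Sum>k<d. w k * c j (b k))"
      using c_sum[of j "\<lambda>k. sV (w k) (b k)" "{..<d}"] by (simp add: c_scale c0)
    also have "\<dots> = (\<Sum>k<d. if k = j then w k else 0)"
      by (intro sum.cong HOL.refl) (use delta[OF j] in auto)
    finally show "w j = 0"
      using j by simp
  qed
  define v where "v i = c i n" for i
  have "n \<in> orb"
    unfolding orb_def using counit_point ac_counit[of n] by force
  then have n_eq: "n = (\<Sum>j<d. sV (v j) (b j))"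
    unfolding v_def by (intro span) (use B(3) in blast)
  obtain a where a: "M.orbit_hull v a" "\<forall>x. K x \<longrightarrow> (\<forall>i<d. M.ap x a i = a i)"
    using M.hull_fixed_point by blast
  define u where "u = (\<Sum>j<d. sV (a j) (b j))"
  have "ac g u = u" if "g \<in> points" for g
  proof -
    have "(\<Sum>j<d. c i (ac g (b j)) * a j) = a i" if "i < d" for i
      using a(2)[rule_format, OF env(1)[OF \<open>g \<in> points\<close>] that]
      unfolding M.ap_def env(2)[OF \<open>g \<in> points\<close>] .
    then show ?thesis
      unfolding u_def ac_comb[OF that] by (intro sum.cong HOL.refl) simp
  qed
  then have "u \<in> inv_ring"
    by (simp add: invariants_def)
  obtain w Z where Z: "\<forall>k\<le>d. K (Z k)" "\<forall>k\<le>d. 0 \<le> w k" "sum w {..d} = 1"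
    "\<forall>i<d. a i = (\<Sum>k\<le>d. w k * M.ap (Z k) v i)"
    using a(1) unfolding M.orbit_hull_def by blast
  have "\<forall>k\<in>{..d}. \<exists>g. g \<in> points \<and> (\<forall>i<length xs. Z k i = g (xs ! i))"
    using Z(1) unfolding K_def by blast
  from bchoice[OF this] obtain g where
    g: "\<And>k. k \<le> d \<Longrightarrow> g k \<in> points" "\<And>k. k \<le> d \<Longrightarrow> \<forall>i<length xs. Z k i = g k (xs ! i)"
    by auto
  define T where "T f = (\<Sum>k\<in>{..d}. sV (w k) (ac (g k) f))" for f
  have "avg T"
    unfolding T_def by (rule avg_convex) (use g(1) Z(2,3) avg_point in auto)
  have "T n = (\<Sum>k\<le>d. sV (w k) (\<Sum>i<d. sV (M.ap (Z k) v i) (b i)))"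
    unfolding T_def
  proof (rule sum.cong[OF HOL.refl])
    fix k assume "k \<in> {..d}"
    then have k: "k \<le> d" by simp
    have "ac (g k) n = (\<Sum>i<d. sV (M.ap (Z k) v i) (b i))"
      unfolding M.ap_def m[OF g(1)[OF k] g(2)[OF k]]
      by (subst n_eq) (rule ac_comb[OF g(1)[OF k]])
    then show "sV (w k) (ac (g k) n) = sV (w k) (\<Sum>i<d. sV (M.ap (Z k) v i) (b i))"
      by simp
  qed
  also have "\<dots> = (\<Sum>k\<le>d. \<Sum>i<d. sV (w k * M.ap (Z k) v i) (b i))"
    by (simp add: V.scale_sum_right V.scale_scale)
  also have "\<dots> = (\<Sum>i<d. \<Sum>k\<le>d. sV (w k * M.ap (Z k) v i) (b i))"
    by (rule sum.swap)
  also have "\<dots> = u"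
    unfolding u_def by (intro sum.cong HOL.refl) (use Z(4) in \<open>simp add: V.scale_sum_left\<close>)
  finally have "T n = u" .
  moreover have "T n \<in> N"
    by (rule avg_subspace[OF \<open>avg T\<close> N(1,2) n])
  ultimately have "T n \<in> inv_ring \<inter> N"
    using \<open>u \<in> inv_ring\<close> by simp
  then show ?thesis
    using N(3) \<open>avg T\<close> by blast
qed

text \<open>A first average kills \<open>n\<close> and keeps \<open>n'\<close> inside
  \<open>N\<close>; a second one kills the image of \<open>n'\<close> and fixes 0.\<close>

lemma invariant_subspace_annihilated2:
  assumes N: "V.subspace N" "G_invariant sG eG sV \<alpha> N" "inv_ring \<inter> N = {0}" and n: "n \<in> N" "n' \<in> N"
  shows "\<exists>T. avg T \<and> T n = 0 \<and> T n' = 0"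
proof -
  obtain T where T: "avg T" "T n = 0"
    using invariant_subspace_annihilated[OF N n(1)] by blast
  have "T n' \<in> N"
    by (rule avg_subspace[OF T(1) N(1,2) n(2)])
  then obtain T' where T': "avg T'" "T' (T n') = 0"
    using invariant_subspace_annihilated[OF N] by blast
  have "T' (T n) = 0"
    using T(2) avg_zero[OF T'(1)] by simp
  then show ?thesis
    using avg_comp[OF T'(1) T(1)] T'(2) by blast
qed

section \<open>Sums of squares, and the Reynolds operator as a pointwise average\<close>

lemma sums_of_squares_closed:
  shows "x \<in> sums_of_squares \<Longrightarrow> y \<in> sums_of_squares \<Longrightarrow> x + y \<in> (sums_of_squares :: 'a set)"
    "x \<in> sums_of_squares \<Longrightarrow> a * a * x \<in> (sums_of_squares :: 'a set)"
    "x \<in> sums_of_squares \<Longrightarrow> y \<in> sums_of_squares \<Longrightarrow> x * y \<in> (sums_of_squares :: 'a set)"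
    "eV \<in> sums_of_squares"
proof -
  show add: "x + y \<in> (sums_of_squares :: 'a set)" if xy: "x \<in> sums_of_squares" "y \<in> sums_of_squares" for x y
  proof -
    obtain us vs where "x = (\<Sum>x\<leftarrow>us. x * x)" "y = (\<Sum>x\<leftarrow>vs. x * x)"
      using xy unfolding sums_of_squares_def by blast
    then have "x + y = (\<Sum>x\<leftarrow>us @ vs. x * x)" by simp
    then show ?thesis
      unfolding sums_of_squares_def by blast
  qed
  show sq: "a * a * x \<in> (sums_of_squares :: 'a set)" if x: "x \<in> sums_of_squares" for a x
  proof -
    obtain us where us: "x = (\<Sum>x\<leftarrow>us. x * x)"
      using x unfolding sums_of_squares_def by blast
    have "a * a * (\<Sum>x\<leftarrow>us. x * x) = (\<Sum>x\<leftarrow>map ((*) a) us. x * x)"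
      by (induction us) (simp_all add: algebra_simps)
    then show ?thesis
      unfolding sums_of_squares_def us by blast
  qed
  show "x * y \<in> (sums_of_squares :: 'a set)" if xy: "x \<in> sums_of_squares" "y \<in> sums_of_squares"
  proof -
    obtain us where us: "x = (\<Sum>x\<leftarrow>us. x * x)"
      using xy(1) unfolding sums_of_squares_def by blast
    have "(\<Sum>x\<leftarrow>us. x * x) * y \<in> sums_of_squares"
    proof (induction us)
      case Nil
      have "(0 :: 'a) \<in> sums_of_squares"
        unfolding sums_of_squares_def by (rule CollectI, rule exI[of _ "[]"]) simp
      then show ?case by simp
    next
      case (Cons u us)
      then show ?case
        using add[OF sq[OF xy(2), of u] Cons] by (simp add: distrib_right)
    qed
    then show ?thesis
      by (simp add: us)
  qed
  have "eV = (\<Sum>x\<leftarrow>[eV]. x * x)"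
    by (simp add: V.unit_mult)
  then show "eV \<in> sums_of_squares"
    unfolding sums_of_squares_def by blast
qed

lemma quadratic_module_sums_of_squares: "quadratic_module UNIV eV sums_of_squares"
  unfolding quadratic_module_def using sums_of_squares_closed by simp

lemma G_invariant_sums_of_squares: "G_invariant sG eG sV \<alpha> sums_of_squares"
  unfolding G_invariant_def
proof (intro ballI)
  fix g and f :: 'a assume g: "g \<in> points" and "f \<in> sums_of_squares"
  then obtain us where us: "f = (\<Sum>x\<leftarrow>us. x * x)"
    unfolding sums_of_squares_def by blast
  have "ac g (\<Sum>x\<leftarrow>us. x * x) = (\<Sum>x\<leftarrow>map (ac g) us. x * x)"
    by (induction us) (simp_all add: ac_zero[OF g] ac_hom[OF g])
  then show "ac g f \<in> sums_of_squares"
    unfolding us sums_of_squares_def by blast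
qed

lemma sum_of_squares_mult_quadratic_module:
  assumes "quadratic_module UNIV eV M" "s \<in> sums_of_squares" "x \<in> M"
  shows "s * x \<in> M"
proof -
  obtain us where us: "s = (\<Sum>x\<leftarrow>us. x * x)"
    using assms(2) unfolding sums_of_squares_def by blast
  have "(\<Sum>u\<leftarrow>us. u * u) * x \<in> M"
  proof (induction us)
    case Nil
    show ?case using quadratic_module_zero[OF assms(1)] by simp
  next
    case (Cons u us)
    have "u * u * x \<in> M"
      using assms(1,3) unfolding quadratic_module_def by blast
    then show ?case
      using Cons assms(1) unfolding quadratic_module_def by (simp add: distrib_right)
  qed
  then show ?thesis
    by (simp add: us)
qed

lemma inv_ring_closed:
  "eV \<in> inv_ring" "x \<in> inv_ring \<Longrightarrow> y \<in> inv_ring \<Longrightarrow> x + y \<in> inv_ring"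
  "x \<in> inv_ring \<Longrightarrow> y \<in> inv_ring \<Longrightarrow> x * y \<in> inv_ring" "0 \<in> inv_ring"
  by (simp_all add: invariants_def ac_hom ac_zero)

text \<open>An average that kills the component of \<open>f\<close> in the complement takes the
  value \<open>\<rho> f\<close> at \<open>f\<close>. So \<open>\<rho>\<close> inherits at each
  element the properties shared by all averages.\<close>

lemma reynolds_properties:
  assumes "reynolds_operator sG eG sV \<alpha> \<rho>"
  shows "\<rho> f \<in> inv_ring" "u \<in> inv_ring \<Longrightarrow> \<rho> u = u" "\<rho> (x + y) = \<rho> x + \<rho> y"
    "u \<in> inv_ring \<Longrightarrow> \<rho> (u * x) = u * \<rho> x"
    "quadratic_module UNIV eV M \<Longrightarrow> G_invariant sG eG sV \<alpha> M \<Longrightarrow> f \<in> M \<Longrightarrow> \<rho> f \<in> M"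
proof -
  obtain N where N: "V.subspace N" "G_invariant sG eG sV \<alpha> N" "inv_ring \<inter> N = {0}"
    and dec: "\<forall>f. \<exists>u\<in>inv_ring. \<exists>n\<in>N. f = u + n" and \<rho>: "\<forall>u\<in>inv_ring. \<forall>n\<in>N. \<rho> (u + n) = u"
    using assms unfolding reynolds_operator_def by blast
  have d: "\<exists>n\<in>N. \<rho> f \<in> inv_ring \<and> f = \<rho> f + n" for f
    using dec \<rho> by metis
  show "\<rho> f \<in> inv_ring"
    using d by blast
  show "\<rho> u = u" if "u \<in> inv_ring"
    using \<rho>[rule_format, OF that V.subspace_0[OF N(1)]] by simp
  obtain n n' where n: "n \<in> N" "n' \<in> N" "x = \<rho> x + n" "y = \<rho> y + n'" "\<rho> x \<in> inv_ring" "\<rho> y \<in> inv_ring"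
    using d by metis
  have "x + y = (\<rho> x + \<rho> y) + (n + n')"
    by (subst n(3), subst n(4)) (simp add: algebra_simps)
  then show "\<rho> (x + y) = \<rho> x + \<rho> y"
    using \<rho>[rule_format, OF inv_ring_closed(2)[OF n(5,6)] V.subspace_add[OF N(1) n(1,2)]] by simp
  show "\<rho> (u * x) = u * \<rho> x" if u: "u \<in> inv_ring"
  proof -
    \<comment> \<open>The two elements to be killed are the complement parts \<open>n\<close> of
      \<open>x\<close> and \<open>k\<close> of \<open>u * n\<close>. Then
      \<open>\<rho> (u * n) = T (u * n) = u * T n = 0\<close>, so \<open>u * n\<close> lies in
      \<open>N\<close>.\<close>
    obtain k where k: "k \<in> N" "u * n = \<rho> (u * n) + k" "\<rho> (u * n) \<in> inv_ring"
      using d by metis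
    obtain T where T: "avg T" "T n = 0" "T k = 0"
      using invariant_subspace_annihilated2[OF N n(1) k(1)] by blast
    have "T (u * n) = \<rho> (u * n)"
      using avg_add[OF T(1), of "\<rho> (u * n)" k] avg_invariant[OF T(1) k(3)] T(3) k(2) by simp
    moreover have "T (u * n) = 0"
      using avg_mult_invariant[OF T(1) u, of n] T(2) by simp
    ultimately have "u * n \<in> N"
      using k by simp
    moreover have "u * x = u * \<rho> x + u * n"
      by (subst n(3)) (simp add: distrib_left)
    ultimately show ?thesis
      using \<rho>[rule_format, OF inv_ring_closed(3)[OF u n(5)], of "u * n"] by simp
  qed
  show "\<rho> f \<in> M" if M: "quadratic_module UNIV eV M" "G_invariant sG eG sV \<alpha> M" "f \<in> M"
  proof -
    obtain k where k: "k \<in> N" "f = \<rho> f + k" "\<rho> f \<in> inv_ring"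
      using d by metis
    obtain T where T: "avg T" "T k = 0"
      using invariant_subspace_annihilated[OF N k(1)] by blast
    have "T f = \<rho> f"
      using avg_add[OF T(1), of "\<rho> f" k] avg_invariant[OF T(1) k(3)] T(2) k(2) by simp
    then show ?thesis
      using avg_quadratic_module[OF T(1) M] by simp
  qed
qed

end

theorem corollary3p6:
  fixes sG :: "'r::real_closed_field \<Rightarrow> 'h::comm_ring \<Rightarrow> 'h"
    and eG :: 'h
    and \<Delta> :: "'h \<Rightarrow> ('h \<times> 'h) multiset"
    and \<epsilon> :: "'h \<Rightarrow> 'r"
    and S :: "'h \<Rightarrow> 'h"
    and sV :: "'r \<Rightarrow> 'a::comm_ring \<Rightarrow> 'a"
    and eV :: 'a
    and \<alpha> :: "'a \<Rightarrow> ('h \<times> 'a) multiset"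
    and \<rho> :: "'a \<Rightarrow> 'a"
  assumes "affine_G_variety sG eG \<Delta> \<epsilon> S sV eV \<alpha>"
    and "rational_points_dense sG eG"
    and "semialgebraically_compact sG eG"
    and "reynolds_operator sG eG sV \<alpha> \<rho>"
  shows
    "let RW = invariants sG eG sV \<alpha>; S0 = \<rho> ` sums_of_squares in
       S0 = RW \<inter> sums_of_squares \<and>
       RW \<inter> sums_of_squares = invariant_part sG eG sV \<alpha> sums_of_squares \<and>
       ring_preordering RW eV S0 \<and>
       (\<forall>M. quadratic_module UNIV eV M \<longrightarrow> preordering_module RW eV S0 (\<rho> ` M)) \<and>
       (\<forall>M. quadratic_module UNIV eV M \<and> G_invariant sG eG sV \<alpha> M \<longrightarrow> \<rho> ` M = M \<inter> RW)"
proof -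
  interpret affine_G_variety sG eG \<Delta> \<epsilon> S sV eV \<alpha>
    by (rule assms(1))
  interpret compact_affine_G_variety sG eG \<Delta> \<epsilon> S sV eV \<alpha>
    by unfold_locales (rule assms(3))
  note \<rho> = reynolds_properties[OF assms(4)]
  have c: "\<rho> ` M = M \<inter> inv_ring" if M: "quadratic_module UNIV eV M" "G_invariant sG eG sV \<alpha> M" for M
  proof
    show "\<rho> ` M \<subseteq> M \<inter> inv_ring"
      using \<rho>(1) \<rho>(5)[OF M] by blast
    show "M \<inter> inv_ring \<subseteq> \<rho> ` M"
      using \<rho>(2) by (metis IntE image_eqI subsetI)
  qed
  \<comment> \<open>The equality in part (a) is part (c) for the G-invariant quadratic module of all
    sums of squares.\<close>
  have S0: "\<rho> ` sums_of_squares = inv_ring \<inter> sums_of_squares"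
    using c[OF quadratic_module_sums_of_squares G_invariant_sums_of_squares] by blast
  have pre: "ring_preordering inv_ring eV (inv_ring \<inter> sums_of_squares)"
    unfolding ring_preordering_def quadratic_module_def
    using sums_of_squares_closed inv_ring_closed by simp
  have b: "preordering_module inv_ring eV (inv_ring \<inter> sums_of_squares) (\<rho> ` M)"
    if M: "quadratic_module UNIV eV M" for M
    unfolding preordering_module_def quadratic_module_def
  proof (intro conjI ballI)
    have M': "eV \<in> M" "\<And>x y. x \<in> M \<Longrightarrow> y \<in> M \<Longrightarrow> x + y \<in> M" "\<And>a x. x \<in> M \<Longrightarrow> a * a * x \<in> M"
      using M unfolding quadratic_module_def by blast+
    show "\<rho> ` M \<subseteq> inv_ring"
      using \<rho>(1) by blast
    show "eV \<in> \<rho> ` M"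
      using \<rho>(2)[OF inv_ring_closed(1)] M'(1) by (metis image_eqI)
    show "x + y \<in> \<rho> ` M" if "x \<in> \<rho> ` M" "y \<in> \<rho> ` M" for x y
      using that M'(2) by (auto simp flip: \<rho>(3))
    show "a * a * x \<in> \<rho> ` M" if a: "a \<in> inv_ring" and "x \<in> \<rho> ` M" for a x
    proof -
      obtain y where "y \<in> M" "x = \<rho> y"
        using \<open>x \<in> \<rho> ` M\<close> by blast
      then show ?thesis
        using \<rho>(4)[OF inv_ring_closed(3)[OF a a], of y] M'(3)[of y a] by (metis image_eqI)
    qed
    show "s * x \<in> \<rho> ` M" if s: "s \<in> inv_ring \<inter> sums_of_squares" and "x \<in> \<rho> ` M" for s x
    proof -
      obtain y where "y \<in> M" "x = \<rho> y"
        using \<open>x \<in> \<rho> ` M\<close> by blast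
      then show ?thesis
        using \<rho>(4)[of s y] sum_of_squares_mult_quadratic_module[OF M, of s y] s by (metis IntE image_eqI)
    qed
  qed
  show ?thesis
    unfolding Let_def S0 invariant_part_def using pre b c by blast
qed

end
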